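(* Let $p$ be an odd prime and let $G$ be a finite nonabelian $p$-group with cyclic center. Suppose that all the automorphisms of $G$ of order $p$ fixing $G^p\gamma_3(G)$ elementwise are inner. Then the following hold: (i) $C_G(G^p\gamma_3(G))\cap Z_3(G)\not\le Z(\Phi(G))$. (ii) $\binom{d(G)+1}{2}\le r$, where $r$ is the coclass of $G$.
   Context: $G^p$ is the subgroup of $G$ generated by all $p$-th powers; $\gamma_i(G)$ is the $i$-th term of the lower central series ($\gamma_1(G)=G$, $\gamma_2(G)=[G,G]$, $\gamma_3(G)=[\gamma_2(G),G]$); $Z_i(G)$ is the $i$-th term of the upper central series ($Z_1(G)=Z(G)$); $\Phi(G)$ is the Frattini subgroup; $C_G(H)$ is the centralizer of $H$ in $G$; $d(G)$ is the minimal number of generators of $G$. If $|G|=p^n$ and $G$ has nilpotency class $c$, the coclass of $G$ is $n-c$. *)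

theory Defs
  imports "HOL-Algebra.Algebra"
begin

definition centralizer :: "('a, 'b) monoid_scheme \<Rightarrow> 'a set \<Rightarrow> 'a set" where
  "centralizer G H = {g \<in> carrier G. \<forall>h\<in>H. g \<otimes>\<^bsub>G\<^esub> h = h \<otimes>\<^bsub>G\<^esub> g}"

definition center :: "('a, 'b) monoid_scheme \<Rightarrow> 'a set" where
  "center G = centralizer G (carrier G)"

(* Same convention for the commutator of two elements as in the library's derived_set,
   so that commutator_subgroup G H H = derived G H. *)
definition commutator_subgroup :: "('a, 'b) monoid_scheme \<Rightarrow> 'a set \<Rightarrow> 'a set \<Rightarrow> 'a set" where
  "commutator_subgroup G H K =
     generate G {h \<otimes>\<^bsub>G\<^esub> k \<otimes>\<^bsub>G\<^esub> inv\<^bsub>G\<^esub> h \<otimes>\<^bsub>G\<^esub> inv\<^bsub>G\<^esub> k | h k. h \<in> H \<and> k \<in> K}"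

(* The series starts at index 1; the value at 0 is a dummy. *)
fun lower_central :: "('a, 'b) monoid_scheme \<Rightarrow> nat \<Rightarrow> 'a set" where
  "lower_central G 0 = carrier G"
| "lower_central G (Suc 0) = carrier G"
| "lower_central G (Suc (Suc i)) = commutator_subgroup G (lower_central G (Suc i)) (carrier G)"

(* The (i+1)-st term is the preimage in G of the centre of the quotient by the i-th term. *)
primrec upper_central :: "('a, 'b) monoid_scheme \<Rightarrow> nat \<Rightarrow> 'a set" where
  "upper_central G 0 = {\<one>\<^bsub>G\<^esub>}"
| "upper_central G (Suc i) =
     {x \<in> carrier G. upper_central G i #>\<^bsub>G\<^esub> x \<in> center (G Mod upper_central G i)}"

(* Only meaningful for nilpotent groups. *)
definition nilpotency_class :: "('a, 'b) monoid_scheme \<Rightarrow> nat" where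
  "nilpotency_class G = (LEAST c. lower_central G (Suc c) = {\<one>\<^bsub>G\<^esub>})"

definition power_subgroup :: "('a, 'b) monoid_scheme \<Rightarrow> nat \<Rightarrow> 'a set" where
  "power_subgroup G n = generate G {x [^]\<^bsub>G\<^esub> n | x. x \<in> carrier G}"

definition maximal_subgroup :: "'a set \<Rightarrow> ('a, 'b) monoid_scheme \<Rightarrow> bool" where
  "maximal_subgroup M G \<longleftrightarrow> subgroup M G \<and> M \<noteq> carrier G \<and>
     (\<forall>H. subgroup H G \<longrightarrow> M \<subseteq> H \<longrightarrow> H = M \<or> H = carrier G)"

definition frattini :: "('a, 'b) monoid_scheme \<Rightarrow> 'a set" where
  "frattini G = carrier G \<inter> \<Inter>{M. maximal_subgroup M G}"

definition min_generators :: "('a, 'b) monoid_scheme \<Rightarrow> nat" where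
  "min_generators G =
     (LEAST k. \<exists>S. S \<subseteq> carrier G \<and> finite S \<and> card S = k \<and> generate G S = carrier G)"

definition finite_p_group :: "nat \<Rightarrow> ('a, 'b) monoid_scheme \<Rightarrow> bool" where
  "finite_p_group p G \<longleftrightarrow> group G \<and> finite (carrier G) \<and> (\<exists>n. order G = p ^ n)"

(* Integer-valued, so that the subtraction is not truncated; for a prime p and a finite
   p-group G the exponent is unique. *)
definition coclass :: "nat \<Rightarrow> ('a, 'b) monoid_scheme \<Rightarrow> int" where
  "coclass p G = int (THE n. order G = p ^ n) - int (nilpotency_class G)"

(* Restricted to the carrier, as all elements of auto G are extensional. *)
definition inner_autos :: "('a, 'b) monoid_scheme \<Rightarrow> ('a \<Rightarrow> 'a) set" where
  "inner_autos G =
     {\<lambda>x\<in>carrier G. g \<otimes>\<^bsub>G\<^esub> x \<otimes>\<^bsub>G\<^esub> inv\<^bsub>G\<^esub> g | g. g \<in> carrier G}"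

end

theory Submission
  imports Defs "HOL-Number_Theory.Cong"
begin

text \<open>Write \<open>N\<close> for \<open>G\<^sup>p\<gamma>\<^sub>3(G)\<close>, \<open>\<Phi>\<close> for the Frattini subgroup and \<open>d\<close> for the minimal number of
generators. The centre \<open>Z\<close> is cyclic; let \<open>z\<close> generate its subgroup of order \<open>p\<close>, and let \<open>E\<close> be the set
of all \<open>g\<close> whose commutators with \<open>G\<close> are powers of \<open>z\<close>. A derivation from \<open>G\<close> to an elementary abelian
subgroup of \<open>E\<close> that vanishes on \<open>N\<close> gives an automorphism of \<open>G\<close> of order \<open>p\<close> that fixes \<open>N\<close> elementwise
(\<open>derivation_is_inner\<close>). By hypothesis it is a conjugation. So the hypothesis is a source of elements
of \<open>G\<close> with prescribed commutators, and the proof consists in writing down enough derivations.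

Homomorphisms into \<open>\<langle>z\<rangle>\<close> show that commutation pairs \<open>E/Z\<close> perfectly with \<open>G/\<Phi>\<close>
(\<open>additive_is_phi\<close>). A minimal generating system therefore has a dual system in \<open>E\<close>, and because \<open>Z\<close> is
cyclic all but one of its members can be given order \<open>p\<close> (\<open>exists_dual_order_p\<close>). Derivations of rank
one show that elements of order \<open>p\<close> in \<open>E\<close> lie in \<open>\<Phi>\<close>, hence so does \<open>E\<close>, and the centralizer of
\<open>\<Phi>\<close> is contained in \<open>\<Phi>\<close>.

Next, symmetric bilinear forms on \<open>G/\<Phi>\<close> give derivations that vanish on \<open>\<Phi>\<close>. The
conjugating elements lie, together with \<open>E\<close>, in a subgroup \<open>C\<close> of the centre of \<open>\<Phi>\<close> that is contained in
the third centre and satisfies \<open>|C : Z| \<ge> p^(d(d+1)/2)\<close> (\<open>card_C_ge\<close>).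

For (i), suppose that some commutator \<open>c = [u,v]\<close> lies outside \<open>N\<close>. The quotient \<open>G/N\<close> has class at most
two and exponent \<open>p\<close>, so Baer's correction of the product yields a function on it that is nonzero at \<open>c\<close>
and additive up to half its value on commutators. Adding a quadratic form turns this alternating error
term into a triangular one, which needs only the dual elements of order \<open>p\<close>; so it is a derivation. The
resulting \<open>g\<close> centralizes \<open>N\<close>, lies in the third centre and does not commute with \<open>c \<in> \<Phi>\<close>
(\<open>exists_third_center_element\<close>). If all commutators lay in \<open>N\<close>, the power maps between the factors of
the lower \<open>p\<close>-series would be onto, and an elementary abelian subgroup would have order at most
\<open>|G : \<Phi>| = p^d\<close> (\<open>card_elementary_le\<close>). But the \<open>p\<close>-th powers of elements of \<open>C\<close> are central, so the
kernel of the power map on \<open>C\<close> has order at least \<open>|C : Z|\<close>, which is larger because \<open>d \<ge> 2\<close>.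

Part (ii) adds up orders: \<open>C\<close> contributes \<open>d(d+1)/2\<close> above \<open>Z\<close>, part (i) makes the third centre larger
than \<open>C\<close>, and the last factor of the upper central series is not cyclic (\<open>coclass_ge\<close>).\<close>

section \<open>Commutators and finite \<open>p\<close>-groups\<close>

context group
begin

definition commutator :: "'a \<Rightarrow> 'a \<Rightarrow> 'a" where
  "commutator x y = x \<otimes> y \<otimes> inv x \<otimes> inv y"

lemma commutator_closed [simp, intro]:
  "x \<in> carrier G \<Longrightarrow> y \<in> carrier G \<Longrightarrow> commutator x y \<in> carrier G"
  by (simp add: commutator_def)

lemma inv_mult_cancel [simp]:
  "x \<in> carrier G \<Longrightarrow> y \<in> carrier G \<Longrightarrow> inv x \<otimes> (x \<otimes> y) = y"
  "x \<in> carrier G \<Longrightarrow> y \<in> carrier G \<Longrightarrow> x \<otimes> (inv x \<otimes> y) = y"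
  by (simp_all flip: m_assoc)

lemma commutator_mult:
  "x \<in> carrier G \<Longrightarrow> y \<in> carrier G \<Longrightarrow> commutator x y \<otimes> y \<otimes> x = x \<otimes> y"
  by (simp add: commutator_def m_assoc)

lemma conj_eq_commutator_mult:
  "x \<in> carrier G \<Longrightarrow> y \<in> carrier G \<Longrightarrow> x \<otimes> y \<otimes> inv x = commutator x y \<otimes> y"
  by (simp add: commutator_def m_assoc)

lemma commutator_eq_one_iff:
  assumes "x \<in> carrier G" "y \<in> carrier G"
  shows "commutator x y = \<one> \<longleftrightarrow> x \<otimes> y = y \<otimes> x"
proof
  assume "commutator x y = \<one>" then show "x \<otimes> y = y \<otimes> x"
    using commutator_mult[OF assms] assms by simp
next
  assume "x \<otimes> y = y \<otimes> x" then show "commutator x y = \<one>"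
    using assms by (simp add: commutator_def m_assoc)
qed

lemma inv_commutator:
  "x \<in> carrier G \<Longrightarrow> y \<in> carrier G \<Longrightarrow> inv (commutator x y) = commutator y x"
  by (simp add: commutator_def m_assoc inv_mult_group)

lemma commutator_mult_left:
  assumes "x \<in> carrier G" "y \<in> carrier G" "w \<in> carrier G"
  shows "commutator (x \<otimes> y) w = x \<otimes> commutator y w \<otimes> inv x \<otimes> commutator x w"
  using assms by (simp add: commutator_def m_assoc inv_mult_group)

lemma commutator_mult_right:
  assumes "x \<in> carrier G" "y \<in> carrier G" "w \<in> carrier G"
  shows "commutator w (x \<otimes> y) = commutator w x \<otimes> (x \<otimes> commutator w y \<otimes> inv x)"
  using assms by (simp add: commutator_def m_assoc inv_mult_group)

lemma conjugate_one_iff: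
  assumes "x \<in> carrier G" "y \<in> carrier G"
  shows "x \<otimes> y \<otimes> inv x = \<one> \<longleftrightarrow> y = \<one>"
proof
  assume "x \<otimes> y \<otimes> inv x = \<one>"
  then have "inv x \<otimes> (x \<otimes> y \<otimes> inv x) \<otimes> x = \<one>" using assms by simp
  then show "y = \<one>" using assms by (simp add: m_assoc)
qed (use assms in simp)

lemma finite_subgroupI:
  assumes "finite (carrier G)" "H \<subseteq> carrier G" "\<one> \<in> H"
    and closed: "\<And>x y. x \<in> H \<Longrightarrow> y \<in> H \<Longrightarrow> x \<otimes> y \<in> H"
  shows "subgroup H G"
proof (rule subgroupI)
  fix x assume x: "x \<in> H"
  have pw: "x [^] (n::nat) \<in> H" for n
    by (induction n) (use x assms in auto)
  have c: "x \<in> carrier G" using x assms by auto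
  have "0 < order G" using assms(1) order_gt_0_iff_finite by blast
  then obtain k where k: "order G = Suc k" using gr0_conv_Suc by blast
  have "x [^] k \<otimes> x = \<one>" using pow_order_eq_1[OF c] k by simp
  then have "inv x = x [^] k" using c by (simp add: inv_equality)
  then show "inv x \<in> H" using pw by simp
qed (use assms in auto)

lemma commutator_conj_closed:
  assumes "H \<lhd> G" "x \<in> carrier G" "y \<in> H"
  shows "x \<otimes> y \<otimes> inv x \<in> H"
  using assms normal.inv_op_closed2 by metis

lemma normal_iff_commutator:
  assumes "subgroup H G"
  shows "H \<lhd> G \<longleftrightarrow> (\<forall>x\<in>carrier G. \<forall>h\<in>H. commutator x h \<in> H)"
proof
  assume n: "H \<lhd> G"
  show "\<forall>x\<in>carrier G. \<forall>h\<in>H. commutator x h \<in> H"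
    using n assms by (auto simp: commutator_def normal.inv_op_closed2 subgroup.m_closed subgroup.m_inv_closed)
next
  assume c: "\<forall>x\<in>carrier G. \<forall>h\<in>H. commutator x h \<in> H"
  show "H \<lhd> G" unfolding normal_inv_iff
    using assms c conj_eq_commutator_mult
    by (auto simp: subgroup.m_closed subgroup.mem_carrier)
qed

lemma normalI_commutator:
  assumes "subgroup H G" "\<And>x h. x \<in> carrier G \<Longrightarrow> h \<in> H \<Longrightarrow> commutator h x \<in> H"
  shows "H \<lhd> G"
  using assms(1,2) subgroup.m_inv_closed[OF assms(1)] inv_commutator subgroup.mem_carrier[OF assms(1)]
  unfolding normal_iff_commutator[OF assms(1)] by metis

lemma normal_commutator_closed:
  assumes "H \<lhd> G" "x \<in> carrier G" "h \<in> H"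
  shows "commutator x h \<in> H" "commutator h x \<in> H"
proof -
  have s: "subgroup H G" using assms(1) by (simp add: normal_imp_subgroup)
  show *: "commutator x h \<in> H" using assms normal_iff_commutator[OF s] by blast
  show "commutator h x \<in> H"
    using subgroup.m_inv_closed[OF s *] inv_commutator assms(2,3) subgroup.mem_carrier[OF s] by metis
qed

end

lemma (in normal) rcoset_eq_iff:
  assumes "x \<in> carrier G" "y \<in> carrier G"
  shows "H #> x = H #> y \<longleftrightarrow> x \<otimes> inv y \<in> H"
  using assms is_subgroup
  by (metis coset_mult_inv1 coset_mult_inv2 coset_join1 coset_join2 inv_closed m_closed subset r_inv repr_independence)

lemma (in normal) rcoset_eq_self_iff:
  assumes "x \<in> carrier G"
  shows "H #> x = H \<longleftrightarrow> x \<in> H"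
  using assms coset_join1 coset_join2 is_subgroup subset by blast

lemma (in normal) rcoset_commutator:
  assumes "x \<in> carrier G" "y \<in> carrier G"
  shows "group.commutator (G Mod H) (H #> x) (H #> y) = H #> commutator x y"
proof -
  interpret Q: group "G Mod H" by (rule factorgroup_is_group)
  interpret h: group_hom G "G Mod H" "\<lambda>a. H #> a"
    by unfold_locales (rule r_coset_hom_Mod)
  show ?thesis unfolding Q.commutator_def commutator_def using assms
    by (simp only: h.hom_mult h.hom_inv m_closed inv_closed)
qed

locale p_group = group G for G :: "('a, 'b) monoid_scheme" (structure) +
  fixes p :: nat
  assumes prime_p: "Factorial_Ring.prime p"
    and p_group: "finite_p_group p G"
begin

lemma finite_G [simp, intro]: "finite (carrier G)"
  using p_group by (simp add: finite_p_group_def)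

lemma p_gt_1: "1 < p" using prime_p prime_gt_1_nat by blast

lemma card_dvd_order:
  assumes "subgroup H G" shows "card H dvd order G"
  using lagrange[OF assms] by (metis dvd_triv_right)

lemma card_subgroup_power:
  assumes "subgroup H G" shows "\<exists>k. card H = p ^ k"
proof -
  obtain n where "order G = p ^ n" using p_group by (auto simp: finite_p_group_def)
  then show ?thesis using card_dvd_order[OF assms] prime_p divides_primepow_nat by metis
qed

lemma finite_subgroup: "subgroup H G \<Longrightarrow> finite H"
  using finite_subset subgroup.subset finite_G by blast

lemma finite_p_subgroupI:
  "H \<subseteq> carrier G \<Longrightarrow> \<one> \<in> H \<Longrightarrow> (\<And>x y. x \<in> H \<Longrightarrow> y \<in> H \<Longrightarrow> x \<otimes> y \<in> H) \<Longrightarrow> subgroup H G"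
  using finite_subgroupI finite_G by blast

lemma card_psubset_subgroup:
  assumes "subgroup H G" "subgroup K G" "H \<subset> K"
  shows "p * card H \<le> card K"
proof -
  obtain a b where ab: "card H = p ^ a" "card K = p ^ b" using assms card_subgroup_power by metis
  have "card H < card K" using assms finite_subgroup psubset_card_mono by blast
  then have "a < b" using ab p_gt_1 power_less_imp_less_exp by metis
  then have "p ^ Suc a \<le> p ^ b" using p_gt_1 by (intro power_increasing) auto
  then show ?thesis using ab by simp
qed

text \<open>The class equation for the conjugation action on \<open>K\<close>: apart from \<open>{\<one>}\<close>, not every class contained in
\<open>K\<close> can have size divisible by \<open>p\<close>.\<close>

lemma exists_central_in_normal:
  assumes "K \<lhd> G" "K \<noteq> {\<one>}"
  shows "\<exists>x\<in>K. x \<noteq> \<one> \<and> (\<forall>y\<in>carrier G. x \<otimes> y = y \<otimes> x)"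
proof (rule ccontr)
  assume neg: "\<not> ?thesis"
  have sK: "subgroup K G" using assms(1) by (simp add: normal_imp_subgroup)
  define conj where "conj = (\<lambda>g. \<lambda>h \<in> carrier G. g \<otimes> h \<otimes> inv g)"
  interpret act: group_action G "carrier G" conj
    unfolding conj_def by (rule action_by_conjugation)
  let ?C = "(\<lambda>x. orbit G conj x) ` (K - {\<one>})"
  have K: "x \<in> carrier G" if "x \<in> K" for x using that sK subgroup.mem_carrier by metis
  have un: "\<Union> ?C = K - {\<one>}"
  proof
    show "\<Union> ?C \<subseteq> K - {\<one>}"
    proof
      fix y assume "y \<in> \<Union> ?C"
      then obtain x g where x: "x \<in> K" "x \<noteq> \<one>" and g: "g \<in> carrier G" "y = g \<otimes> x \<otimes> inv g"
        by (auto simp: orbit_def conj_def K)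
      have "y \<in> K" using commutator_conj_closed[OF assms(1) g(1) x(1)] g by simp
      moreover have "y \<noteq> \<one>" 
        using x g K by (metis conjugate_one_iff)
      ultimately show "y \<in> K - {\<one>}" by simp
    qed
    show "K - {\<one>} \<subseteq> \<Union> ?C" using act.orbit_refl K by blast
  qed
  have "p dvd card (orbit G conj x)" if x: "x \<in> K - {\<one>}" for x
  proof -
    have xc: "x \<in> carrier G" using x K by simp
    obtain n where n: "order G = p ^ n" using p_group by (auto simp: finite_p_group_def)
    have "card (orbit G conj x) dvd p ^ n"
      unfolding n[symmetric] act.orbit_stabilizer_theorem[OF xc, symmetric] by (rule dvd_triv_left)
    then obtain k where k: "card (orbit G conj x) = p ^ k"
      unfolding divides_primepow_nat[OF prime_p] by blast
    have "k \<noteq> 0"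
    proof
      assume "k = 0"
      then have "card (orbit G conj x) = 1" using k by simp
      then obtain u where u: "orbit G conj x = {u}" using card_1_singletonE by blast
      have ux: "u = x" using act.orbit_refl[OF xc] u by simp
      have "\<forall>y\<in>carrier G. x \<otimes> y = y \<otimes> x"
      proof
        fix y assume y: "y \<in> carrier G"
        have "y \<otimes> x \<otimes> inv y \<in> orbit G conj x" using y xc by (auto simp: orbit_def conj_def intro!: exI[of _ y])
        then have "y \<otimes> x \<otimes> inv y = x" using u ux by simp
        then show "x \<otimes> y = y \<otimes> x" using y xc by (metis inv_solve_right m_closed)
      qed
      then show False using neg x by blast
    qed
    then show ?thesis using k by (simp add: dvd_power)
  qed
  moreover have "c1 \<inter> c2 = {}" if c: "c1 \<in> ?C" "c2 \<in> ?C" "c1 \<noteq> c2" for c1 c2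
  proof (rule ccontr)
    assume "c1 \<inter> c2 \<noteq> {}"
    then obtain u where u: "u \<in> c1" "u \<in> c2" by blast
    obtain x y where x: "x \<in> K" "c1 = orbit G conj x" and y: "y \<in> K" "c2 = orbit G conj y" using c by blast
    have uc: "u \<in> carrier G" using u(1) x(2) act.element_image K[OF x(1)] unfolding orbit_def by blast
    have "orbit G conj v = orbit G conj u" if v: "v \<in> K" "u \<in> orbit G conj v" for v
    proof -
      have vc: "v \<in> carrier G" using K v by blast
      have o: "orbit G conj w \<subseteq> carrier G" if "w \<in> carrier G" for w
        using that by (auto simp: orbit_def conj_def)
      have v': "v \<in> orbit G conj u" using act.orbit_sym[OF vc uc v(2)] .
      show ?thesis
      proof
        show "orbit G conj v \<subseteq> orbit G conj u"
          using act.orbit_trans[OF uc vc _ v'] o[OF vc] by blast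
        show "orbit G conj u \<subseteq> orbit G conj v"
          using act.orbit_trans[OF vc uc _ v(2)] o[OF uc] by blast
      qed
    qed
    then have "c1 = orbit G conj u" "c2 = orbit G conj u" using x y u by blast+
    then show False using c(3) by simp
  qed
  ultimately have d: "p dvd card (K - {\<one>})"
    using dvd_partition[of ?C p] un finite_subgroup[OF sK] by force
  obtain k where k: "card K = p ^ k" using card_subgroup_power[OF sK] by blast
  have one: "\<one> \<in> K" using sK subgroup.one_closed by blast
  have "card K \<noteq> 1" using assms(2) one card_1_singletonE by blast
  then have "k \<noteq> 0" using k by (metis power_0)
  then have "p dvd card K" using k by (simp add: dvd_power)
  moreover have "card K = Suc (card (K - {\<one>}))" using one finite_subgroup[OF sK] card.remove by metis
  ultimately have "p dvd 1" using d by (metis One_nat_def dvd_add_right_iff add_Suc_right add.right_neutral)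
  then show False using p_gt_1 by simp
qed

lemma FactGroup_p_group:
  assumes "H \<lhd> G"
  shows "p_group (G Mod H) p"
proof -
  interpret n: normal H G by (rule assms)
  obtain m where m: "order G = p ^ m" using p_group by (auto simp: finite_p_group_def)
  have "order (G Mod H) dvd order G"
    using lagrange[OF n.is_subgroup] by (metis FactGroup_def dvd_triv_left order_def partial_object.select_convs(1))
  then have "\<exists>k. order (G Mod H) = p ^ k" using m prime_p divides_primepow_nat by metis
  moreover have "finite (carrier (G Mod H))" by (simp add: carrier_FactGroup)
  ultimately show ?thesis
    using n.factorgroup_is_group prime_p
    by (simp add: p_group_def p_group_axioms_def finite_p_group_def)
qed

text \<open>
  The source of all inductions along central series: between two normal subgroups one can always
  insert an element whose image modulo the smaller one is central of order \<open>p\<close>. It is the class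
  equation, applied in the quotient by the smaller subgroup.
\<close>

lemma central_step:
  assumes "H \<lhd> G" "K \<lhd> G" "H \<subset> K"
  obtains x where "x \<in> K" "x \<notin> H" "x [^] p \<in> H" "\<And>y. y \<in> carrier G \<Longrightarrow> commutator x y \<in> H"
proof -
  interpret n: normal H G by (rule assms)
  interpret Q: p_group "G Mod H" p by (rule FactGroup_p_group[OF assms(1)])
  interpret h: group_hom G "G Mod H" "\<lambda>a. H #> a"
    by unfold_locales (rule n.r_coset_hom_Mod)
  have sK: "subgroup K G" using assms(2) by (simp add: normal_imp_subgroup)
  have K: "x \<in> carrier G" if "x \<in> K" for x using that sK subgroup.mem_carrier by metis
  let ?K = "(\<lambda>a. H #> a) ` K"
  have sub: "subgroup ?K (G Mod H)" using sK by (rule h.subgroup_img_is_subgroup)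
  have "?K \<lhd> G Mod H"
  proof (rule Q.normalI_commutator[OF sub])
    fix S T assume "S \<in> carrier (G Mod H)" "T \<in> ?K"
    then obtain x y where "x \<in> carrier G" "S = H #> x" "y \<in> K" "T = H #> y"
      by (auto simp: carrier_FactGroup)
    then show "Q.commutator T S \<in> ?K"
      using n.rcoset_commutator[of y x] K normal_commutator_closed(2)[OF assms(2)] by auto
  qed
  moreover have "?K \<noteq> {\<one>\<^bsub>G Mod H\<^esub>}"
  proof -
    obtain x where x: "x \<in> K" "x \<notin> H" using assms(3) by blast
    then have "H #> x \<noteq> H" using n.rcoset_eq_self_iff K by blast
    then show ?thesis using x(1) by auto
  qed
  ultimately obtain S where S: "S \<in> ?K" "S \<noteq> \<one>\<^bsub>G Mod H\<^esub>"
    "\<forall>T\<in>carrier (G Mod H). S \<otimes>\<^bsub>G Mod H\<^esub> T = T \<otimes>\<^bsub>G Mod H\<^esub> S"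
    using Q.exists_central_in_normal[of ?K] by blast
  then obtain x where x: "x \<in> K" "S = H #> x" by blast
  have xH: "x \<notin> H" using x S n.rcoset_eq_self_iff K by auto
  have cx: "commutator x y \<in> H" if "y \<in> carrier G" for y
  proof -
    have "Q.commutator (H #> x) (H #> y) = \<one>\<^bsub>G Mod H\<^esub>"
      using S(3) x that K Q.commutator_eq_one_iff[of "H #> x" "H #> y"]
      by (metis h.hom_closed)
    then show ?thesis using n.rcoset_commutator[of x y] that K x n.rcoset_eq_self_iff by simp
  qed
  have pw: "\<exists>k. x [^] (p ^ k) \<in> H"
  proof -
    obtain k where "order G = p ^ k" using p_group by (auto simp: finite_p_group_def)
    then have "x [^] (p ^ k) = \<one>" using pow_order_eq_1[of x] K x by simp
    then show ?thesis using n.one_closed by metis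
  qed
  define k where "k = (LEAST k. x [^] (p ^ k) \<in> H)"
  have k: "x [^] (p ^ k) \<in> H" unfolding k_def using LeastI_ex[OF pw] .
  have k0: "k \<noteq> 0" using k xH K[OF x(1)] by (cases k) auto
  then obtain j where j: "k = Suc j" using not0_implies_Suc by blast
  have nj: "x [^] (p ^ j) \<notin> H" using not_less_Least[of j "\<lambda>k. x [^] (p ^ k) \<in> H"] j k_def by auto
  have cpow: "commutator (x [^] m) y \<in> H" if y: "y \<in> carrier G" for y and m :: nat
  proof (induction m)
    case 0 then show ?case using y by (simp add: commutator_def)
  next
    case (Suc m)
    have "x [^] m \<otimes> commutator x y \<otimes> inv (x [^] m) \<in> H"
      using commutator_conj_closed[OF assms(1) _ cx[OF y]] K x by simp
    then show ?case using commutator_mult_left[of "x [^] m" x y] Suc y K x by simp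
  qed
  show thesis
  proof (rule that[of "x [^] (p ^ j)"])
    show "x [^] (p ^ j) \<in> K" using x sK by (metis K group.subgroup_int_pow_closed int_pow_int is_group)
    show "x [^] (p ^ j) \<notin> H" by (rule nj)
    show "(x [^] (p ^ j)) [^] p \<in> H" using k j K x by (simp add: nat_pow_pow mult.commute)
  qed (rule cpow)
qed

section \<open>Maximal subgroups and functionals modulo \<open>p\<close>\<close>

text \<open>A homomorphism to the field with \<open>p\<close> elements is represented by a function to the integers whose values
only matter modulo \<open>p\<close>.\<close>

definition additive :: "('a \<Rightarrow> int) \<Rightarrow> bool" where
  "additive f \<longleftrightarrow> (\<forall>x\<in>carrier G. \<forall>y\<in>carrier G. [f (x \<otimes> y) = f x + f y] (mod int p))"

lemma additiveD:
  "additive f \<Longrightarrow> x \<in> carrier G \<Longrightarrow> y \<in> carrier G \<Longrightarrow> [f (x \<otimes> y) = f x + f y] (mod int p)"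
  by (simp add: additive_def)

lemma additive_one:
  assumes "additive f" shows "[f \<one> = 0] (mod int p)"
proof -
  have "[f \<one> = f \<one> + f \<one>] (mod int p)" using additiveD[OF assms, of \<one> \<one>] by simp
  then show ?thesis by (simp add: cong_iff_dvd_diff)
qed

lemma additive_inv:
  assumes "additive f" "x \<in> carrier G" shows "[f (inv x) = - f x] (mod int p)"
proof -
  have "[f \<one> = f x + f (inv x)] (mod int p)" using additiveD[OF assms(1), of x "inv x"] assms by simp
  then have "[f x + f (inv x) = 0] (mod int p)"
    by (rule cong_trans[OF cong_sym]) (rule additive_one[OF assms(1)])
  then show ?thesis by (simp add: cong_iff_dvd_diff add.commute)
qed

lemma additive_commutator:
  assumes "additive f" "x \<in> carrier G" "y \<in> carrier G"
  shows "[f (commutator x y) = 0] (mod int p)"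
proof -
  have 1: "[f (commutator x y \<otimes> y \<otimes> x) = f (commutator x y) + f y + f x] (mod int p)"
    using cong_trans[OF additiveD[OF assms(1)] cong_add[OF additiveD[OF assms(1)] cong_refl]] assms by simp
  have 2: "[f (x \<otimes> y) = f x + f y] (mod int p)" by (rule additiveD[OF assms])
  have "[f (commutator x y) + f y + f x = f x + f y] (mod int p)"
    using cong_trans[OF cong_sym[OF 1]] 2 commutator_mult[OF assms(2,3)] by simp
  then show ?thesis by (simp add: cong_iff_dvd_diff)
qed

lemma additive_pow:
  assumes "additive f" "x \<in> carrier G" shows "[f (x [^] (n::nat)) = int n * f x] (mod int p)"
proof (induction n)
  case 0 then show ?case using additive_one[OF assms(1)] by simp
next
  case (Suc n)
  have "[f (x [^] n \<otimes> x) = f (x [^] n) + f x] (mod int p)" using assms by (simp add: additiveD)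
  also have "[f (x [^] n) + f x = int n * f x + f x] (mod int p)" using Suc by (simp add: cong_add_rcancel)
  finally show ?case by (simp add: algebra_simps)
qed

lemma additive_pow_p:
  assumes "additive f" "x \<in> carrier G" shows "[f (x [^] p) = 0] (mod int p)"
  using additive_pow[OF assms, of p] by (simp add: cong_def)

lemma additive_kernel_subgroup:
  assumes "additive f" shows "subgroup {x \<in> carrier G. [f x = 0] (mod int p)} G"
proof (rule finite_p_subgroupI)
  fix x y assume "x \<in> {x \<in> carrier G. [f x = 0] (mod int p)}" "y \<in> {x \<in> carrier G. [f x = 0] (mod int p)}"
  then show "x \<otimes> y \<in> {x \<in> carrier G. [f x = 0] (mod int p)}"
    using additiveD[OF assms, of x y] cong_add[of "f x" 0 "int p" "f y" 0] cong_trans by auto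
qed (use additive_one[OF assms] in auto)

lemma additive_kernel_normal:
  assumes "additive f" shows "{x \<in> carrier G. [f x = 0] (mod int p)} \<lhd> G"
  by (rule normalI_commutator[OF additive_kernel_subgroup[OF assms]])
    (use additive_commutator[OF assms] in auto)

lemma additive_vanishes_if_on_generators:
  assumes "additive f" "generate G S = carrier G" "\<And>s. s \<in> S \<Longrightarrow> s \<in> carrier G \<and> [f s = 0] (mod int p)"
    and "x \<in> carrier G"
  shows "[f x = 0] (mod int p)"
proof -
  have "generate G S \<subseteq> {x \<in> carrier G. [f x = 0] (mod int p)}"
    by (rule generate_subgroup_incl[OF _ additive_kernel_subgroup[OF assms(1)]]) (use assms(3) in auto)
  then show ?thesis using assms by auto
qed

text \<open>This is the subgroup generated by \<open>H\<close> and \<open>x\<close> whenever \<open>x\<close> normalizes \<open>H\<close>; in a finite group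
nonnegative exponents suffice.\<close>

definition adjoin :: "'a set \<Rightarrow> 'a \<Rightarrow> 'a set" where
  "adjoin H x = {y. \<exists>h\<in>H. \<exists>n::nat. y = h \<otimes> x [^] n}"

lemma pow_normalizes:
  assumes "subgroup H G" "x \<in> carrier G" "\<And>h. h \<in> H \<Longrightarrow> x \<otimes> h \<otimes> inv x \<in> H" "h \<in> H"
  shows "x [^] (n::nat) \<otimes> h \<otimes> inv (x [^] n) \<in> H"
  using assms(4)
proof (induction n arbitrary: h)
  case 0
  then have "h \<in> carrier G" using assms(1) subgroup.mem_carrier by metis
  then show ?case using 0 by simp
next
  case (Suc n)
  have h: "h \<in> carrier G" using assms(1) Suc.prems subgroup.mem_carrier by metis
  have "x [^] Suc n \<otimes> h \<otimes> inv (x [^] Suc n) = x [^] n \<otimes> (x \<otimes> h \<otimes> inv x) \<otimes> inv (x [^] n)"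
    using assms(2) h by (simp add: m_assoc inv_mult_group)
  then show ?case using Suc.IH[OF assms(3)[OF Suc.prems]] by simp
qed

lemma adjoin_subgroup:
  assumes "subgroup H G" "x \<in> carrier G" "\<And>h. h \<in> H \<Longrightarrow> x \<otimes> h \<otimes> inv x \<in> H"
  shows "subgroup (adjoin H x) G" "H \<subseteq> adjoin H x" "x \<in> adjoin H x"
proof -
  have H: "h \<in> carrier G" if "h \<in> H" for h using that assms(1) subgroup.mem_carrier by metis
  show "subgroup (adjoin H x) G"
  proof (rule finite_p_subgroupI)
    show "adjoin H x \<subseteq> carrier G" using H assms(2) by (auto simp: adjoin_def)
    show "\<one> \<in> adjoin H x" unfolding adjoin_def
      using subgroup.one_closed[OF assms(1)] by (force intro!: bexI[of _ \<one>] exI[of _ "0::nat"])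
    fix y w assume "y \<in> adjoin H x" "w \<in> adjoin H x"
    then obtain h n k m where h: "h \<in> H" "y = h \<otimes> x [^] (n::nat)" and k: "k \<in> H" "w = k \<otimes> x [^] (m::nat)"
      by (auto simp: adjoin_def)
    have "y \<otimes> w = (h \<otimes> (x [^] n \<otimes> k \<otimes> inv (x [^] n))) \<otimes> x [^] (n + m)"
      using h k H assms(2) by (simp add: m_assoc flip: nat_pow_mult)
    moreover have "h \<otimes> (x [^] n \<otimes> k \<otimes> inv (x [^] n)) \<in> H"
      using pow_normalizes[OF assms k(1)] h(1) assms(1) by (simp add: subgroup.m_closed)
    ultimately show "y \<otimes> w \<in> adjoin H x" unfolding adjoin_def by blast
  qed
  show "H \<subseteq> adjoin H x"
  proof
    fix h assume h: "h \<in> H"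
    have "h = h \<otimes> x [^] (0::nat)" using H[OF h] by simp
    then show "h \<in> adjoin H x" unfolding adjoin_def using h by blast
  qed
  have "x = \<one> \<otimes> x [^] (1::nat)" using assms(2) by simp
  then show "x \<in> adjoin H x" unfolding adjoin_def using subgroup.one_closed[OF assms(1)] by blast
qed

lemma adjoin_normal:
  assumes "H \<lhd> G" "x \<in> carrier G" "\<And>y. y \<in> carrier G \<Longrightarrow> commutator x y \<in> H"
  shows "adjoin H x \<lhd> G"
proof (rule normalI_commutator)
  have sH: "subgroup H G" using assms(1) by (simp add: normal_imp_subgroup)
  have n: "x \<otimes> h \<otimes> inv x \<in> H" if "h \<in> H" for h using commutator_conj_closed[OF assms(1,2) that] .
  show "subgroup (adjoin H x) G" using adjoin_subgroup(1)[OF sH assms(2) n] .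
  fix y w assume y: "y \<in> carrier G" and "w \<in> adjoin H x"
  then obtain h m where h: "h \<in> H" "w = h \<otimes> x [^] (m::nat)" by (auto simp: adjoin_def)
  have hc: "h \<in> carrier G" using h sH subgroup.mem_carrier by metis
  have pw: "commutator (x [^] k) y \<in> H" for k :: nat
  proof (induction k)
    case 0 then show ?case using y sH by (simp add: commutator_def subgroup.one_closed)
  next
    case (Suc k)
    then show ?case using commutator_mult_left[of "x [^] k" x y] y assms(2) sH
        commutator_conj_closed[OF assms(1) _ assms(3)[OF y], of "x [^] k"]
      by (simp add: subgroup.m_closed)
  qed
  have "h \<otimes> commutator (x [^] m) y \<otimes> inv h \<in> H" using commutator_conj_closed[OF assms(1) hc pw] .
  moreover have "commutator h y \<in> H" using normal_commutator_closed(2)[OF assms(1) y h(1)] .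
  ultimately have "commutator w y \<in> H"
    using commutator_mult_left[of h "x [^] m" y] h hc y assms(2) sH by (simp add: subgroup.m_closed)
  then show "commutator w y \<in> adjoin H x" using adjoin_subgroup(2)[OF sH assms(2) n] by blast
qed

lemma card_adjoin_le:
  assumes "subgroup H G" "x \<in> carrier G" "x [^] p \<in> H"
  shows "card (adjoin H x) \<le> p * card H"
proof -
  have "adjoin H x \<subseteq> (\<lambda>(n, h). h \<otimes> x [^] n) ` ({..<p} \<times> H)"
  proof
    fix y assume "y \<in> adjoin H x"
    then obtain h n where h: "h \<in> H" "y = h \<otimes> x [^] (n::nat)" by (auto simp: adjoin_def)
    have hc: "h \<in> carrier G" using h assms(1) subgroup.mem_carrier by metis
    have "x [^] n = x [^] (p * (n div p)) \<otimes> x [^] (n mod p)"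
      using assms(2) by (simp add: nat_pow_mult)
    also have "\<dots> = (x [^] p) [^] (n div p) \<otimes> x [^] (n mod p)" using assms(2) by (simp add: nat_pow_pow)
    finally have e: "y = h \<otimes> (x [^] p) [^] (n div p) \<otimes> x [^] (n mod p)" using h hc assms(2) by (simp add: m_assoc)
    have "h \<otimes> (x [^] p) [^] (n div p) \<in> H"
      using h assms(1,3) by (metis subgroup.m_closed subgroup_int_pow_closed int_pow_int)
    then show "y \<in> (\<lambda>(n, h). h \<otimes> x [^] n) ` ({..<p} \<times> H)"
      using e p_gt_1 by (force intro!: image_eqI[of _ _ "(n mod p, h \<otimes> (x [^] p) [^] (n div p))"])
  qed
  then have "card (adjoin H x) \<le> card ({..<p} \<times> H)"
    by (meson card_image_le card_mono finite_SigmaI finite_imageI finite_lessThan finite_subgroup[OF assms(1)] order_trans)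
  then show ?thesis by (simp add: card_cartesian_product)
qed

lemma pow_mem_iff:
  assumes "subgroup M G" "x \<in> carrier G" "x \<notin> M" "x [^] p \<in> M"
  shows "x [^] (n::nat) \<in> M \<longleftrightarrow> p dvd n"
proof
  assume n: "x [^] n \<in> M"
  show "p dvd n"
  proof (rule ccontr)
    assume "\<not> p dvd n"
    then have c: "coprime n p" using prime_p prime_imp_coprime coprime_commute by metis
    have n0: "n \<noteq> 0" using \<open>\<not> p dvd n\<close> by (cases n) auto
    obtain a b where ab: "a * n = b * p + 1" using coprime_bezout_strong[OF c] p_gt_1
      by (metis mult.commute nat_neq_iff)
    have "x [^] (a * n) = (x [^] p) [^] b \<otimes> x" unfolding ab using assms(2)
      by (simp add: nat_pow_pow mult.commute flip: nat_pow_mult)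
    moreover have "x [^] (a * n) = (x [^] n) [^] a" using assms(2) by (simp add: nat_pow_pow mult.commute)
    ultimately have e: "x = inv ((x [^] p) [^] b) \<otimes> (x [^] n) [^] a" using assms(2) by simp
    have "(x [^] p) [^] b \<in> M" "(x [^] n) [^] a \<in> M"
      using assms(1,4) n by (metis subgroup_int_pow_closed int_pow_int)+
    then have "x \<in> M" using e assms(1) by (metis subgroup.m_closed subgroup.m_inv_closed)
    then show False using assms(3) by simp
  qed
next
  assume "p dvd n"
  then obtain k where "n = p * k" by blast
  then have "x [^] n = (x [^] p) [^] k" using assms(2) by (simp add: nat_pow_pow)
  then show "x [^] n \<in> M" using assms(1,4) by (metis subgroup_int_pow_closed int_pow_int)
qed

text \<open>A normal subgroup of index \<open>p\<close> is the kernel of a functional, which can be normalised at any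
  element outside.\<close>

lemma additive_of_index_p:
  assumes "M \<lhd> G" "x \<in> carrier G" "x \<notin> M" "x [^] p \<in> M" "adjoin M x = carrier G"
  obtains f where "additive f" "\<And>y. y \<in> carrier G \<Longrightarrow> [f y = 0] (mod int p) \<longleftrightarrow> y \<in> M"
    "[f x = 1] (mod int p)"
proof -
  have sM: "subgroup M G" using assms(1) by (simp add: normal_imp_subgroup)
  have M: "h \<in> carrier G" if "h \<in> M" for h using that sM subgroup.mem_carrier by metis
  define N where "N = (\<lambda>y. SOME n::nat. \<exists>m\<in>M. y = m \<otimes> x [^] n)"
  have N: "\<exists>m\<in>M. y = m \<otimes> x [^] N y" if "y \<in> carrier G" for y
  proof -
    have "y \<in> adjoin M x" using that assms(5) by simp
    then have "\<exists>n::nat. \<exists>m\<in>M. y = m \<otimes> x [^] n" unfolding adjoin_def by blast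
    then show ?thesis unfolding N_def by (rule someI_ex)
  qed
  have uniq_le: "p dvd a - b" if "m \<in> M" "m' \<in> M" "m \<otimes> x [^] a = m' \<otimes> x [^] b" "b \<le> a" for m m' and a b :: nat
  proof -
    have "x [^] a = x [^] (a - b) \<otimes> x [^] b" using that(4) assms(2) by (simp add: nat_pow_mult)
    then have "m \<otimes> x [^] (a - b) \<otimes> x [^] b = m' \<otimes> x [^] b" using that M assms(2) by (simp add: m_assoc)
    then have "m \<otimes> x [^] (a - b) = m'" using that M assms(2) by (simp add: r_cancel)
    then have "x [^] (a - b) = inv m \<otimes> m'" using that M assms(2) by (metis inv_mult_cancel(1) nat_pow_closed)
    then have "x [^] (a - b) \<in> M" using that sM by (simp add: subgroup.m_closed subgroup.m_inv_closed)
    then show ?thesis using pow_mem_iff[OF sM assms(2-4)] by simp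
  qed
  have uniq: "[int a = int b] (mod int p)" if "m \<in> M" "m' \<in> M" "m \<otimes> x [^] a = m' \<otimes> x [^] b" for m m' and a b :: nat
  proof (cases "b \<le> a")
    case True
    then show ?thesis using uniq_le[OF that] by (metis cong_iff_dvd_diff int_dvd_int_iff of_nat_diff)
  next
    case False
    then show ?thesis using uniq_le[OF that(2,1) that(3)[symmetric]]
      by (metis cong_iff_dvd_diff cong_sym int_dvd_int_iff nat_le_linear of_nat_diff)
  qed
  let ?f = "\<lambda>y. int (N y)"
  have "additive ?f" unfolding additive_def
  proof (intro ballI)
    fix y w assume yw: "y \<in> carrier G" "w \<in> carrier G"
    obtain h where h: "h \<in> M" "y = h \<otimes> x [^] N y" using N yw by blast
    obtain k where k: "k \<in> M" "w = k \<otimes> x [^] N w" using N yw by blast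
    obtain l where l: "l \<in> M" "y \<otimes> w = l \<otimes> x [^] N (y \<otimes> w)" using N yw by blast
    have "y \<otimes> w = (h \<otimes> x [^] N y) \<otimes> (k \<otimes> x [^] N w)" using h(2) k(2) by simp
    also have "\<dots> = (h \<otimes> (x [^] N y \<otimes> k \<otimes> inv (x [^] N y))) \<otimes> x [^] (N y + N w)"
      using h(1) k(1) M assms(2) by (simp add: m_assoc flip: nat_pow_mult)
    finally have e: "y \<otimes> w = (h \<otimes> (x [^] N y \<otimes> k \<otimes> inv (x [^] N y))) \<otimes> x [^] (N y + N w)" .
    have "h \<otimes> (x [^] N y \<otimes> k \<otimes> inv (x [^] N y)) \<in> M"
      using h(1) k(1) sM commutator_conj_closed[OF assms(1)] assms(2) by (simp add: subgroup.m_closed)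
    then show "[int (N (y \<otimes> w)) = int (N y) + int (N w)] (mod int p)"
      using uniq[OF l(1)] e l(2) by (metis of_nat_add)
  qed
  moreover have "[?f y = 0] (mod int p) \<longleftrightarrow> y \<in> M" if y: "y \<in> carrier G" for y
  proof -
    obtain h where h: "h \<in> M" "y = h \<otimes> x [^] N y" using N y by blast
    have "y \<in> M \<longleftrightarrow> x [^] N y \<in> M"
    proof
      assume "y \<in> M"
      moreover have "x [^] N y = inv h \<otimes> y" using h M assms(2) by (metis inv_mult_cancel(1) nat_pow_closed)
      ultimately show "x [^] N y \<in> M" using h(1) sM by (simp add: subgroup.m_closed subgroup.m_inv_closed)
    next
      assume "x [^] N y \<in> M" then show "y \<in> M" using h sM by (metis subgroup.m_closed)
    qed
    then show ?thesis using pow_mem_iff[OF sM assms(2-4)] by (simp add: cong_0_iff)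
  qed
  moreover have "[?f x = 1] (mod int p)"
  proof -
    obtain h where h: "h \<in> M" "x = h \<otimes> x [^] N x" using N assms(2) by blast
    have "h \<otimes> x [^] N x = \<one> \<otimes> x [^] (1::nat)" using h assms(2) by simp
    from uniq[OF h(1) subgroup.one_closed[OF sM] this] show ?thesis by simp
  qed
  ultimately show thesis using that by blast
qed

text \<open>Let \<open>H\<close> be a maximal normal subgroup of \<open>G\<close> inside \<open>M\<close> and let \<open>x\<close> be central of order \<open>p\<close> modulo
\<open>H\<close>. Then \<open>x\<close> lies outside \<open>M\<close>, since otherwise \<open>H\<close> could be enlarged by \<open>x\<close>; as \<open>x\<close> normalizes \<open>M\<close>, the
two generate \<open>G\<close>.\<close>

lemma maximal_subgroupD:
  assumes "maximal_subgroup M G"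
  shows "M \<lhd> G" "\<exists>x. x \<in> carrier G \<and> x \<notin> M \<and> x [^] p \<in> M"
    "\<And>x. x \<in> carrier G \<Longrightarrow> x \<notin> M \<Longrightarrow> adjoin M x = carrier G"
proof -
  have sM: "subgroup M G" and Mne: "M \<noteq> carrier G"
    and Mmax: "\<And>H. subgroup H G \<Longrightarrow> M \<subseteq> H \<Longrightarrow> H = M \<or> H = carrier G"
    using assms by (auto simp: maximal_subgroup_def)
  have M: "h \<in> carrier G" if "h \<in> M" for h using that sM subgroup.mem_carrier by metis
  define C where "C = {H. H \<lhd> G \<and> H \<subseteq> M}"
  have fin: "finite C" unfolding C_def by (rule finite_subset[of _ "Pow M"]) (use finite_subgroup[OF sM] in auto)
  have "{\<one>} \<in> C" unfolding C_def using one_is_normal subgroup.one_closed[OF sM] by simp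
  then obtain H where H: "H \<in> C" "\<And>L. L \<in> C \<Longrightarrow> H \<subseteq> L \<Longrightarrow> H = L"
    using finite_has_maximal[OF fin] by blast
  have Hn: "H \<lhd> G" and HM: "H \<subseteq> M" using H(1) by (auto simp: C_def)
  have "H \<subset> carrier G" using HM Mne M by blast
  then obtain x where x: "x \<in> carrier G" "x \<notin> H" "x [^] p \<in> H" "\<And>y. y \<in> carrier G \<Longrightarrow> commutator x y \<in> H"
    using central_step[OF Hn normal_self] by blast
  have sH: "subgroup H G" using Hn by (simp add: normal_imp_subgroup)
  have xM: "x \<notin> M"
  proof
    assume xM: "x \<in> M"
    have nx: "x \<otimes> h \<otimes> inv x \<in> H" if "h \<in> H" for h using commutator_conj_closed[OF Hn x(1) that] .
    have "adjoin H x \<subseteq> M"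
    proof
      fix y assume "y \<in> adjoin H x"
      then obtain h n where "h \<in> H" "y = h \<otimes> x [^] (n::nat)" by (auto simp: adjoin_def)
      then show "y \<in> M" using HM xM sM by (metis subgroup.m_closed subgroup_int_pow_closed int_pow_int subsetD)
    qed
    then have "adjoin H x \<in> C" unfolding C_def using adjoin_normal[OF Hn x(1) x(4)] by blast
    moreover have "H \<subset> adjoin H x" using adjoin_subgroup(2,3)[OF sH x(1) nx] x(2) by blast
    ultimately show False using H(2) by blast
  qed
  have nM: "x \<otimes> h \<otimes> inv x \<in> M" if "h \<in> M" for h
    using conj_eq_commutator_mult[OF x(1) M[OF that]] x(4)[OF M[OF that]] HM that sM
    by (metis subgroup.m_closed subsetD)
  have "adjoin M x = carrier G"
    using Mmax[OF adjoin_subgroup(1)[OF sM x(1) nM]] adjoin_subgroup(2,3)[OF sM x(1) nM] xM by blast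
  show norm: "M \<lhd> G" unfolding normal_inv_iff
  proof (intro conjI ballI sM)
    fix g h assume g: "g \<in> carrier G" and h: "h \<in> M"
    obtain k n where k: "k \<in> M" "g = k \<otimes> x [^] (n::nat)"
      using g unfolding \<open>adjoin M x = carrier G\<close>[symmetric] by (auto simp: adjoin_def)
    have "g \<otimes> h \<otimes> inv g = k \<otimes> (x [^] n \<otimes> h \<otimes> inv (x [^] n)) \<otimes> inv k"
      using k h M x(1) by (simp add: m_assoc inv_mult_group)
    then show "g \<otimes> h \<otimes> inv g \<in> M"
      using pow_normalizes[OF sM x(1) nM h] k sM by (simp add: subgroup.m_closed subgroup.m_inv_closed)
  qed
  show "\<exists>x. x \<in> carrier G \<and> x \<notin> M \<and> x [^] p \<in> M" using x xM HM by blast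
  show "adjoin M y = carrier G" if y: "y \<in> carrier G" "y \<notin> M" for y
  proof -
    have "y \<otimes> h \<otimes> inv y \<in> M" if "h \<in> M" for h using commutator_conj_closed[OF norm y(1) that] .
    then show ?thesis using Mmax adjoin_subgroup[OF sM y(1)] y(2) by blast
  qed
qed

lemma maximal_subgroup_pow:
  assumes "maximal_subgroup M G" "x \<in> carrier G" shows "x [^] p \<in> M"
proof (cases "x \<in> M")
  case True
  have "subgroup M G" using assms(1) by (simp add: maximal_subgroup_def)
  then show ?thesis using True by (metis subgroup_int_pow_closed int_pow_int)
next
  case False
  obtain u where u: "u \<in> carrier G" "u \<notin> M" "u [^] p \<in> M" using maximal_subgroupD(2)[OF assms(1)] by blast
  obtain f where f: "additive f" "\<And>y. y \<in> carrier G \<Longrightarrow> [f y = 0] (mod int p) \<longleftrightarrow> y \<in> M"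
    using additive_of_index_p[OF maximal_subgroupD(1)[OF assms(1)] u maximal_subgroupD(3)[OF assms(1) u(1,2)]] by metis
  show ?thesis using f(2) additive_pow_p[OF f(1) assms(2)] assms(2) by blast
qed

lemma additive_of_maximal:
  assumes "maximal_subgroup M G" "x \<in> carrier G" "x \<notin> M"
  obtains f where "additive f" "\<And>y. y \<in> carrier G \<Longrightarrow> [f y = 0] (mod int p) \<longleftrightarrow> y \<in> M"
    "[f x = 1] (mod int p)"
  by (rule additive_of_index_p[OF maximal_subgroupD(1)[OF assms(1)] assms(2,3)
      maximal_subgroup_pow[OF assms(1,2)] maximal_subgroupD(3)[OF assms]]) (use that in blast)

lemma exists_inverse_mod_p:
  assumes "\<not> [a = 0] (mod int p)" obtains n :: nat where "[int n * a = 1] (mod int p)"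
proof -
  have "coprime a (int p)" using assms prime_p
    by (metis cong_0_iff coprime_commute prime_imp_coprime prime_nat_int_transfer)
  then obtain b where b: "[a * b = 1] (mod int p)" using cong_solve_coprime_int by blast
  have "int (nat (b mod int p)) = b mod int p" using p_gt_1 by simp
  then have "[int (nat (b mod int p)) * a = a * b] (mod int p)"
    by (simp add: cong_def mult.commute mod_mult_right_eq)
  then show thesis using that b cong_trans by blast
qed

lemma maximal_kernel:
  assumes "additive f" "g \<in> carrier G" "\<not> [f g = 0] (mod int p)"
  shows "maximal_subgroup {x \<in> carrier G. [f x = 0] (mod int p)} G"
  unfolding maximal_subgroup_def
proof (intro conjI allI impI)
  let ?M = "{x \<in> carrier G. [f x = 0] (mod int p)}"
  show "subgroup ?M G" by (rule additive_kernel_subgroup[OF assms(1)])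
  show "?M \<noteq> carrier G" using assms by blast
  fix H assume H: "subgroup H G" "?M \<subseteq> H"
  show "H = ?M \<or> H = carrier G"
  proof (rule disjCI)
    assume "H \<noteq> carrier G"
    show "H = ?M"
    proof (rule ccontr)
      assume "H \<noteq> ?M"
      then obtain y where y: "y \<in> H" "y \<in> carrier G" "\<not> [f y = 0] (mod int p)"
        using H subgroup.subset by blast
      obtain n :: nat where n: "[int n * f y = 1] (mod int p)" using exists_inverse_mod_p[OF y(3)] .
      have "x \<in> H" if x: "x \<in> carrier G" for x
      proof -
        obtain m :: nat where m: "[int m = f x] (mod int p)"
          using cong_mod_left[of "f x" "int p" "f x"] p_gt_1
          by (metis cong_refl int_nat_eq nat_int of_nat_0_less_iff pos_mod_sign prime_gt_0_nat prime_p)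
        let ?w = "y [^] (m * n)"
        have "[f ?w = int m * (int n * f y)] (mod int p)" using additive_pow[OF assms(1) y(2), of "m * n"] by (simp add: mult.assoc)
        also have "[int m * (int n * f y) = f x * 1] (mod int p)" using cong_mult[OF m n] .
        finally have fw: "[f ?w = f x] (mod int p)" by simp
        have "[f (x \<otimes> inv ?w) = f x + f (inv ?w)] (mod int p)" using additiveD[OF assms(1)] x y by simp
        also have "[f x + f (inv ?w) = f x + - f ?w] (mod int p)"
          by (rule cong_add[OF cong_refl additive_inv[OF assms(1)]]) (use y in simp)
        also have "[f x + - f ?w = 0] (mod int p)" using fw by (simp add: cong_iff_dvd_diff dvd_diff_commute)
        finally have "[f (x \<otimes> inv ?w) = 0] (mod int p)" .
        then have "x \<otimes> inv ?w \<in> ?M" using x y by simp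
        then have "x \<otimes> inv ?w \<in> H" by (rule subsetD[OF H(2)])
        moreover have "?w \<in> H" using H(1) y(1) by (metis subgroup_int_pow_closed int_pow_int)
        ultimately have "x \<otimes> inv ?w \<otimes> ?w \<in> H" using H(1) by (simp add: subgroup.m_closed)
        then show "x \<in> H" using x y by (simp add: m_assoc)
      qed
      then have "H = carrier G" using H(1) subgroup.subset by blast
      then show False using \<open>H \<noteq> carrier G\<close> by simp
    qed
  qed
qed

text \<open>Maximal subgroups and kernels of nonzero functionals are the same thing, so membership in the Frattini
subgroup can be tested by functionals.\<close>

lemma frattini_iff:
  "x \<in> frattini G \<longleftrightarrow> x \<in> carrier G \<and> (\<forall>f. additive f \<longrightarrow> [f x = 0] (mod int p))"
proof
  assume x: "x \<in> frattini G"
  have "[f x = 0] (mod int p)" if f: "additive f" for f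
  proof (rule ccontr)
    assume "\<not> [f x = 0] (mod int p)"
    then have "maximal_subgroup {x \<in> carrier G. [f x = 0] (mod int p)} G"
      using maximal_kernel[OF f] x by (auto simp: frattini_def)
    then show False using x \<open>\<not> [f x = 0] (mod int p)\<close> by (auto simp: frattini_def)
  qed
  then show "x \<in> carrier G \<and> (\<forall>f. additive f \<longrightarrow> [f x = 0] (mod int p))" using x by (auto simp: frattini_def)
next
  assume x: "x \<in> carrier G \<and> (\<forall>f. additive f \<longrightarrow> [f x = 0] (mod int p))"
  have "x \<in> M" if M: "maximal_subgroup M G" for M
  proof -
    obtain u where u: "u \<in> carrier G" "u \<notin> M" using maximal_subgroupD(2)[OF M] by blast
    obtain f where "additive f" "\<And>y. y \<in> carrier G \<Longrightarrow> [f y = 0] (mod int p) \<longleftrightarrow> y \<in> M"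
      using additive_of_maximal[OF M u] by blast
    then show ?thesis using x by blast
  qed
  then show "x \<in> frattini G" using x by (auto simp: frattini_def)
qed

lemma frattini_normal: "frattini G \<lhd> G"
proof (rule normalI_commutator)
  show "subgroup (frattini G) G"
  proof (rule finite_p_subgroupI)
    fix x y assume xy: "x \<in> frattini G" "y \<in> frattini G"
    show "x \<otimes> y \<in> frattini G" unfolding frattini_iff
    proof (intro conjI allI impI)
      fix f assume f: "additive f"
      show "[f (x \<otimes> y) = 0] (mod int p)"
        using xy f additive_kernel_subgroup[OF f] subgroup.m_closed unfolding frattini_iff by fastforce
    qed (use xy frattini_iff in auto)
  qed (auto simp: frattini_iff additive_one)
  show "commutator h x \<in> frattini G" if "x \<in> carrier G" "h \<in> frattini G" for x h
    using that additive_commutator by (auto simp: frattini_iff)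
qed

lemma frattini_subgroup: "subgroup (frattini G) G"
  using frattini_normal by (simp add: normal_imp_subgroup)

lemma frattini_subset: "frattini G \<subseteq> carrier G"
  by (auto simp: frattini_def)

lemma commutator_in_frattini:
  "x \<in> carrier G \<Longrightarrow> y \<in> carrier G \<Longrightarrow> commutator x y \<in> frattini G"
  by (simp add: frattini_iff additive_commutator)

lemma pow_in_frattini: "x \<in> carrier G \<Longrightarrow> x [^] p \<in> frattini G"
  by (simp add: frattini_iff additive_pow_p)

lemma proper_subgroup_in_maximal:
  assumes "subgroup H G" "H \<noteq> carrier G"
  obtains M where "maximal_subgroup M G" "H \<subseteq> M"
proof -
  define C where "C = {L. subgroup L G \<and> H \<subseteq> L \<and> L \<noteq> carrier G}"
  have fin: "finite C" unfolding C_def by (rule finite_subset[of _ "Pow (carrier G)"]) (auto dest: subgroup.subset)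
  have "H \<in> C" using assms by (simp add: C_def)
  then obtain M where M: "M \<in> C" "\<And>L. L \<in> C \<Longrightarrow> M \<subseteq> L \<Longrightarrow> L = M"
    using finite_has_maximal[OF fin] by blast
  have "maximal_subgroup M G" unfolding maximal_subgroup_def using M by (auto simp: C_def)
  then show thesis using that M(1) by (auto simp: C_def)
qed

text \<open>A minimal generating system is a basis modulo the Frattini subgroup; its dual basis is obtained
  without linear algebra, by choosing for each generator a maximal subgroup that contains all the
  others.\<close>

lemma dual_functionals_of_generators:
  obtains x f where "\<And>i. i < min_generators G \<Longrightarrow> x i \<in> carrier G"
    "generate G (x ` {..<min_generators G}) = carrier G"
    "\<And>i. i < min_generators G \<Longrightarrow> additive (f i)"
    "\<And>i j. i < min_generators G \<Longrightarrow> j < min_generators G \<Longrightarrow>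
        [f i (x j) = (if i = j then 1 else 0)] (mod int p)"
proof -
  let ?d = "min_generators G"
  let ?P = "\<lambda>k. \<exists>S. S \<subseteq> carrier G \<and> finite S \<and> card S = k \<and> generate G S = carrier G"
  have "generate G (carrier G) = carrier G"
    using generate_incl[of "carrier G"] by (auto intro: generate.incl)
  then have "?P (card (carrier G))" using finite_G by blast
  then have "?P ?d" unfolding min_generators_def by (rule LeastI)
  then obtain S where S: "S \<subseteq> carrier G" "finite S" "card S = ?d" "generate G S = carrier G" by blast
  obtain x where x: "bij_betw x {..<?d} S"
    using S(2,3) by (metis card_lessThan finite_lessThan finite_same_card_bij)
  have im: "x ` {..<?d} = S" using x by (simp add: bij_betw_def)
  have ex: "\<exists>f. additive f \<and> (\<forall>j<?d. [f (x j) = (if i = j then 1 else 0)] (mod int p))" if i: "i < ?d" for i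
  proof -
    let ?T = "S - {x i}"
    have xS: "x i \<in> S" using i im by blast
    have "card ?T < ?d" using S(2,3) xS by (metis card_Diff1_less)
    then have ne: "generate G ?T \<noteq> carrier G"
      using not_less_Least[of "card ?T" ?P] S(1,2) unfolding min_generators_def by blast
    obtain M where M: "maximal_subgroup M G" "generate G ?T \<subseteq> M"
      using proper_subgroup_in_maximal[OF generate_is_subgroup ne] S(1) by blast
    have TM: "?T \<subseteq> M"
    proof
      fix t assume "t \<in> ?T"
      then have "t \<in> generate G ?T" by (rule generate.incl)
      then show "t \<in> M" using M(2) by blast
    qed
    have "x i \<notin> M"
    proof
      assume "x i \<in> M"
      then have "S \<subseteq> M" using TM by blast
      then have "generate G S \<subseteq> M" using generate_subgroup_incl M(1) by (simp add: maximal_subgroup_def)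
      moreover have "M \<subset> carrier G"
        using M(1) subgroup.subset[of M G] unfolding maximal_subgroup_def by blast
      ultimately show False using S(4) by blast
    qed
    then obtain f where f: "additive f" "\<And>y. y \<in> carrier G \<Longrightarrow> [f y = 0] (mod int p) \<longleftrightarrow> y \<in> M"
      "[f (x i) = 1] (mod int p)"
      using additive_of_maximal[OF M(1), of "x i"] xS S(1) by blast
    have "[f (x j) = 0] (mod int p)" if j: "j < ?d" "j \<noteq> i" for j
    proof -
      have "x j \<in> ?T" using j i x im by (auto simp: bij_betw_def inj_on_def)
      then show ?thesis using f(2) TM S(1) by blast
    qed
    then show ?thesis using f by (intro exI[of _ f]) auto
  qed
  define f where "f = (\<lambda>i. SOME f. additive f \<and> (\<forall>j<?d. [f (x j) = (if i = j then 1 else 0)] (mod int p)))"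
  have f: "additive (f i) \<and> (\<forall>j<?d. [f i (x j) = (if i = j then 1 else 0)] (mod int p))" if "i < ?d" for i
    unfolding f_def using someI_ex[OF ex[OF that]] .
  show thesis
    by (rule that[of x f]) (use S im f in auto)
qed

end

section \<open>Central series, power subgroups and automorphisms\<close>

context group
begin

lemma mem_center_iff: "x \<in> center G \<longleftrightarrow> x \<in> carrier G \<and> (\<forall>y\<in>carrier G. x \<otimes> y = y \<otimes> x)"
  by (simp add: center_def centralizer_def)

lemma mem_upper_central_step:
  assumes "H \<lhd> G"
  shows "x \<in> carrier G \<and> H #> x \<in> center (G Mod H) \<longleftrightarrow>
    x \<in> carrier G \<and> (\<forall>y\<in>carrier G. commutator x y \<in> H)"
proof (cases "x \<in> carrier G")
  case True
  interpret n: normal H G by (rule assms)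
  interpret Q: group "G Mod H" by (rule n.factorgroup_is_group)
  have xQ: "H #> x \<in> carrier (G Mod H)" using True by (auto simp: carrier_FactGroup)
  have "H #> x \<in> center (G Mod H) \<longleftrightarrow>
      (\<forall>y\<in>carrier G. (H #> x) \<otimes>\<^bsub>G Mod H\<^esub> (H #> y) = (H #> y) \<otimes>\<^bsub>G Mod H\<^esub> (H #> x))"
    using xQ by (simp add: Q.mem_center_iff carrier_FactGroup)
  also have "\<dots> \<longleftrightarrow> (\<forall>y\<in>carrier G. Q.commutator (H #> x) (H #> y) = \<one>\<^bsub>G Mod H\<^esub>)"
  proof (rule ball_cong[OF refl])
    fix y assume "y \<in> carrier G"
    then have "H #> y \<in> carrier (G Mod H)" by (auto simp: carrier_FactGroup)
    then show "((H #> x) \<otimes>\<^bsub>G Mod H\<^esub> (H #> y) = (H #> y) \<otimes>\<^bsub>G Mod H\<^esub> (H #> x)) =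
      (Q.commutator (H #> x) (H #> y) = \<one>\<^bsub>G Mod H\<^esub>)"
      using Q.commutator_eq_one_iff[OF xQ] by blast
  qed
  also have "\<dots> \<longleftrightarrow> (\<forall>y\<in>carrier G. commutator x y \<in> H)"
    using True by (simp add: n.rcoset_commutator n.rcoset_eq_self_iff)
  finally show ?thesis using True by simp
qed simp

lemma upper_central_normal: "upper_central G i \<lhd> G"
proof (induction i)
  case 0 then show ?case by (simp add: one_is_normal)
next
  case (Suc i)
  let ?Z = "upper_central G i"
  have sZ: "subgroup ?Z G" using Suc by (simp add: normal_imp_subgroup)
  have e: "upper_central G (Suc i) = {x \<in> carrier G. \<forall>y\<in>carrier G. commutator x y \<in> ?Z}"
    using mem_upper_central_step[OF Suc] by auto
  have sub: "subgroup (upper_central G (Suc i)) G" unfolding e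
  proof (rule subgroupI)
    have "\<one> \<in> {x \<in> carrier G. \<forall>y\<in>carrier G. commutator x y \<in> ?Z}"
      using subgroup.one_closed[OF sZ] by (simp add: commutator_def)
    then show "{x \<in> carrier G. \<forall>y\<in>carrier G. commutator x y \<in> ?Z} \<noteq> {}" by blast
  next
    fix x assume x: "x \<in> {x \<in> carrier G. \<forall>y\<in>carrier G. commutator x y \<in> ?Z}"
    have "commutator (inv x) y \<in> ?Z" if y: "y \<in> carrier G" for y
    proof -
      have "inv x \<otimes> inv (commutator x y) \<otimes> inv (inv x) \<in> ?Z"
        using commutator_conj_closed[OF Suc, of "inv x" "inv (commutator x y)"] x y sZ
        by (simp add: subgroup.m_inv_closed)
      moreover have "inv x \<otimes> inv (commutator x y) \<otimes> inv (inv x) = commutator (inv x) y"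
        using x y by (simp add: commutator_def m_assoc inv_mult_group)
      ultimately show ?thesis by simp
    qed
    then show "inv x \<in> {x \<in> carrier G. \<forall>y\<in>carrier G. commutator x y \<in> ?Z}" using x by simp
  next
    fix x w assume xw: "x \<in> {x \<in> carrier G. \<forall>y\<in>carrier G. commutator x y \<in> ?Z}"
      "w \<in> {x \<in> carrier G. \<forall>y\<in>carrier G. commutator x y \<in> ?Z}"
    have "commutator (x \<otimes> w) y \<in> ?Z" if y: "y \<in> carrier G" for y
      using commutator_mult_left[of x w y] commutator_conj_closed[OF Suc, of x "commutator w y"] xw y sZ
      by (simp add: subgroup.m_closed)
    then show "x \<otimes> w \<in> {x \<in> carrier G. \<forall>y\<in>carrier G. commutator x y \<in> ?Z}" using xw by simp
  qed auto
  show ?case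
  proof (rule normalI_commutator[OF sub])
    fix x h assume xh: "x \<in> carrier G" "h \<in> upper_central G (Suc i)"
    have "commutator h x \<in> ?Z" using xh unfolding e by blast
    then show "commutator h x \<in> upper_central G (Suc i)" unfolding e
      using normal_commutator_closed(2)[OF Suc] subgroup.mem_carrier[OF sZ] by blast
  qed
qed

lemma upper_central_Suc_iff:
  "x \<in> upper_central G (Suc i) \<longleftrightarrow>
    x \<in> carrier G \<and> (\<forall>y\<in>carrier G. commutator x y \<in> upper_central G i)"
  using mem_upper_central_step[OF upper_central_normal, of x i] by auto

lemma upper_central_subgroup: "subgroup (upper_central G i) G"
  using upper_central_normal by (simp add: normal_imp_subgroup)

lemma upper_central_mono_Suc: "upper_central G i \<subseteq> upper_central G (Suc i)"
  using upper_central_Suc_iff normal_commutator_closed(2)[OF upper_central_normal]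
    subgroup.mem_carrier[OF upper_central_subgroup] by blast

lemma upper_central_mono: "i \<le> j \<Longrightarrow> upper_central G i \<subseteq> upper_central G j"
  using upper_central_mono_Suc by (rule lift_Suc_mono_le)

lemma commutator_subgroup_alt:
  "commutator_subgroup G H K = generate G {commutator h k | h k. h \<in> H \<and> k \<in> K}"
  by (simp add: commutator_subgroup_def commutator_def)

lemma commutator_subgroup_subgroup:
  "H \<subseteq> carrier G \<Longrightarrow> K \<subseteq> carrier G \<Longrightarrow> subgroup (commutator_subgroup G H K) G"
  unfolding commutator_subgroup_alt by (rule generate_is_subgroup) auto

lemma commutator_in_commutator_subgroup:
  "h \<in> H \<Longrightarrow> k \<in> K \<Longrightarrow> commutator h k \<in> commutator_subgroup G H K"
  unfolding commutator_subgroup_alt by (rule generate.incl) blast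

lemma commutator_subgroup_incl:
  "subgroup L G \<Longrightarrow> (\<And>h k. h \<in> H \<Longrightarrow> k \<in> K \<Longrightarrow> commutator h k \<in> L) \<Longrightarrow> commutator_subgroup G H K \<subseteq> L"
  unfolding commutator_subgroup_alt by (rule generate_subgroup_incl) auto

lemma conj_commutator:
  assumes "g \<in> carrier G" "x \<in> carrier G" "y \<in> carrier G"
  shows "g \<otimes> commutator x y \<otimes> inv g = commutator (g \<otimes> x \<otimes> inv g) (g \<otimes> y \<otimes> inv g)"
  using assms by (simp add: commutator_def m_assoc inv_mult_group)

lemma commutator_subgroup_normal:
  assumes "H \<lhd> G" "K \<lhd> G" shows "commutator_subgroup G H K \<lhd> G"
proof -
  have H: "h \<in> H \<Longrightarrow> h \<in> carrier G" and K: "k \<in> K \<Longrightarrow> k \<in> carrier G" for h k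
    using assms normal_imp_subgroup subgroup.mem_carrier by metis+
  show ?thesis unfolding commutator_subgroup_alt
  proof (rule normal_generateI)
    show "{commutator h k |h k. h \<in> H \<and> k \<in> K} \<subseteq> carrier G" using H K by auto
    fix c g assume "c \<in> {commutator h k |h k. h \<in> H \<and> k \<in> K}" and g: "g \<in> carrier G"
    then obtain h k where c: "c = commutator h k" "h \<in> H" "k \<in> K" by blast
    then have "g \<otimes> c \<otimes> inv g = commutator (g \<otimes> h \<otimes> inv g) (g \<otimes> k \<otimes> inv g)"
      using conj_commutator[OF g] H K by simp
    moreover have "g \<otimes> h \<otimes> inv g \<in> H" "g \<otimes> k \<otimes> inv g \<in> K"
      using c commutator_conj_closed assms g by auto
    ultimately show "g \<otimes> c \<otimes> inv g \<in> {commutator h k |h k. h \<in> H \<and> k \<in> K}" by blast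
  qed
qed

lemma lower_central_normal: "lower_central G (Suc i) \<lhd> G"
proof (induction i)
  case 0 then show ?case by (simp add: normal_self)
next
  case (Suc i) then show ?case using commutator_subgroup_normal normal_self by simp
qed

lemma conj_nat_pow:
  assumes "g \<in> carrier G" "x \<in> carrier G"
  shows "g \<otimes> x [^] (n::nat) \<otimes> inv g = (g \<otimes> x \<otimes> inv g) [^] n"
proof (induction n)
  case 0 then show ?case using assms by simp
next
  case (Suc n)
  have "(g \<otimes> x \<otimes> inv g) [^] Suc n = (g \<otimes> x [^] n \<otimes> inv g) \<otimes> (g \<otimes> x \<otimes> inv g)" by (simp add: Suc)
  also have "\<dots> = g \<otimes> x [^] Suc n \<otimes> inv g" using assms by (simp add: m_assoc)
  finally show ?case by simp
qed

lemma power_subgroup_normal: "power_subgroup G n \<lhd> G"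
  unfolding power_subgroup_def
proof (rule normal_generateI)
  fix c g assume "c \<in> {x [^] n |x. x \<in> carrier G}" and g: "g \<in> carrier G"
  then obtain x where x: "x \<in> carrier G" "c = x [^] n" by blast
  have "g \<otimes> c \<otimes> inv g = (g \<otimes> x \<otimes> inv g) [^] n" using conj_nat_pow g x by simp
  moreover have "g \<otimes> x \<otimes> inv g \<in> carrier G" using g x by simp
  ultimately show "g \<otimes> c \<otimes> inv g \<in> {x [^] n |x. x \<in> carrier G}" by blast
qed auto

text \<open>For \<open>n = p\<close> odd the exponent of the commutator is divisible by \<open>p\<close>; this makes the power map
  multiplicative when the commutators are central of order dividing \<open>p\<close>.\<close>

lemma class2_power:
  assumes a: "a \<in> carrier G" and b: "b \<in> carrier G" and c: "c \<in> carrier G"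
    and ba: "b \<otimes> a = c \<otimes> (a \<otimes> b)" and ca: "c \<otimes> a = a \<otimes> c" and cb: "c \<otimes> b = b \<otimes> c"
  shows "(a \<otimes> b) [^] (n::nat) = a [^] n \<otimes> b [^] n \<otimes> c [^] (\<Sum>i<n. i)"
proof -
  have ca': "c [^] (k::nat) \<otimes> a = a \<otimes> c [^] k" and cb': "c [^] k \<otimes> b = b \<otimes> c [^] k" for k
    using a b c ca cb by (simp_all add: pow_mult_distrib group_commutes_pow)
  have cbn: "c [^] (k::nat) \<otimes> b [^] (m::nat) = b [^] m \<otimes> c [^] k" for k m
    using group_commutes_pow[of b "c [^] k" m] cb' b c by simp
  have bna: "b [^] (k::nat) \<otimes> a = c [^] k \<otimes> (a \<otimes> b [^] k)" for k
  proof (induction k)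
    case 0 then show ?case using a by simp
  next
    case (Suc k)
    have "b [^] Suc k \<otimes> a = b [^] k \<otimes> (c \<otimes> (a \<otimes> b))" using a b ba by (simp add: m_assoc)
    also have "\<dots> = c \<otimes> (b [^] k \<otimes> a) \<otimes> b"
      using a b c cbn[of 1 k] by (simp add: m_assoc[symmetric])
    also have "\<dots> = c [^] Suc k \<otimes> (a \<otimes> b [^] Suc k)"
    proof -
      have sc: "c [^] Suc k = c \<otimes> c [^] k" using c by (rule nat_pow_Suc2)
      show ?thesis unfolding Suc sc using a b c by (simp add: m_assoc)
    qed
    finally show ?case .
  qed
  show ?thesis
  proof (induction n)
    case 0 then show ?case by simp
  next
    case (Suc n)
    let ?t = "\<Sum>i<n. i"
    have "(a \<otimes> b) [^] Suc n = a [^] n \<otimes> b [^] n \<otimes> (c [^] ?t \<otimes> a) \<otimes> b" using a b c Suc by (simp add: m_assoc)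
    also have "\<dots> = a [^] n \<otimes> (b [^] n \<otimes> a) \<otimes> (c [^] ?t \<otimes> b)" unfolding ca' using a b c by (simp add: m_assoc)
    also have "\<dots> = a [^] n \<otimes> (c [^] n \<otimes> a) \<otimes> (b [^] n \<otimes> b) \<otimes> c [^] ?t"
      unfolding bna cb' using a b c by (simp add: m_assoc)
    also have "\<dots> = a [^] Suc n \<otimes> (c [^] n \<otimes> b [^] Suc n) \<otimes> c [^] ?t" unfolding ca' using a b c by (simp add: m_assoc)
    also have "\<dots> = a [^] Suc n \<otimes> b [^] Suc n \<otimes> c [^] (\<Sum>i<Suc n. i)"
      unfolding cbn using a b c by (simp add: m_assoc nat_pow_mult add.commute del: nat_pow_Suc)
    finally show ?case .
  qed
qed

end

context p_group
begin

lemma centralizer_subgroup: "subgroup {g \<in> carrier G. \<forall>h\<in>H. g \<otimes> h = h \<otimes> g} G" if "H \<subseteq> carrier G"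
proof (rule finite_p_subgroupI)
  fix a b assume ab: "a \<in> {g \<in> carrier G. \<forall>h\<in>H. g \<otimes> h = h \<otimes> g}" "b \<in> {g \<in> carrier G. \<forall>h\<in>H. g \<otimes> h = h \<otimes> g}"
  have "a \<otimes> b \<otimes> h = h \<otimes> (a \<otimes> b)" if h: "h \<in> H" for h
  proof -
    have hc: "h \<in> carrier G" using h that \<open>H \<subseteq> carrier G\<close> by blast
    have "a \<otimes> b \<otimes> h = a \<otimes> (b \<otimes> h)" using ab hc by (simp add: m_assoc)
    also have "\<dots> = a \<otimes> (h \<otimes> b)" using ab h by simp
    also have "\<dots> = (a \<otimes> h) \<otimes> b" using ab hc by (simp add: m_assoc)
    also have "\<dots> = (h \<otimes> a) \<otimes> b" using ab h by simp
    also have "\<dots> = h \<otimes> (a \<otimes> b)" using ab hc by (simp add: m_assoc)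
    finally show ?thesis .
  qed
  then show "a \<otimes> b \<in> {g \<in> carrier G. \<forall>h\<in>H. g \<otimes> h = h \<otimes> g}" using ab by simp
qed (use that in auto)

lemma center_subgroup: "subgroup (center G) G"
  using centralizer_subgroup[of "carrier G"] by (simp add: center_def centralizer_def)

text \<open>The subgroup that the automorphisms of the theorem fix elementwise.\<close>

definition N :: "'a set" where
  "N = power_subgroup G p <#> lower_central G 3"

lemma lower_central_3: "lower_central G 3 = commutator_subgroup G (commutator_subgroup G (carrier G) (carrier G)) (carrier G)"
  by (simp add: numeral_3_eq_3)

lemma lower_central_3_normal: "lower_central G 3 \<lhd> G"
  using lower_central_normal[of 2] by (simp add: numeral_3_eq_3)

lemma N_normal: "N \<lhd> G"
  unfolding N_def by (rule normal_subgroup_set_mult_closed[OF power_subgroup_normal lower_central_3_normal])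

lemma N_subgroup: "subgroup N G" using N_normal by (simp add: normal_imp_subgroup)

lemma power_subgroup_subset_N: "power_subgroup G p \<subseteq> N"
proof
  fix x assume x: "x \<in> power_subgroup G p"
  have "\<one> \<in> lower_central G 3" using lower_central_3_normal normal_imp_subgroup subgroup.one_closed by metis
  moreover have "x \<in> carrier G" using x power_subgroup_normal normal_imp_subgroup subgroup.mem_carrier by metis
  ultimately show "x \<in> N" unfolding N_def set_mult_def using x by force
qed

lemma gamma3_subset_N: "lower_central G 3 \<subseteq> N"
proof
  fix x assume x: "x \<in> lower_central G 3"
  have "\<one> \<in> power_subgroup G p" using power_subgroup_normal normal_imp_subgroup subgroup.one_closed by metis
  moreover have "x \<in> carrier G" using x lower_central_3_normal normal_imp_subgroup subgroup.mem_carrier by metis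
  ultimately show "x \<in> N" unfolding N_def set_mult_def using x by force
qed

lemma pow_in_N: "x \<in> carrier G \<Longrightarrow> x [^] p \<in> N"
  using power_subgroup_subset_N unfolding power_subgroup_def by (blast intro: generate.incl)

lemma commutator_in_N:
  "x \<in> carrier G \<Longrightarrow> y \<in> carrier G \<Longrightarrow> w \<in> carrier G \<Longrightarrow> commutator (commutator x y) w \<in> N"
  using gamma3_subset_N unfolding lower_central_3
  using commutator_in_commutator_subgroup by (meson subsetD)

lemma N_subset_if:
  assumes "subgroup L G" "\<And>x. x \<in> carrier G \<Longrightarrow> x [^] p \<in> L"
    and "\<And>c y. c \<in> commutator_subgroup G (carrier G) (carrier G) \<Longrightarrow> y \<in> carrier G \<Longrightarrow> commutator c y \<in> L"
  shows "N \<subseteq> L"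
proof -
  have "power_subgroup G p \<subseteq> L" unfolding power_subgroup_def
    by (rule generate_subgroup_incl[OF _ assms(1)]) (use assms(2) in auto)
  moreover have "lower_central G 3 \<subseteq> L" unfolding lower_central_3
    by (rule commutator_subgroup_incl[OF assms(1)]) (use assms(3) in auto)
  ultimately show ?thesis unfolding N_def set_mult_def using subgroup.m_closed[OF assms(1)] by blast
qed

lemma N_subset_frattini: "N \<subseteq> frattini G"
proof (rule N_subset_if[OF frattini_subgroup])
  fix c y assume c: "c \<in> commutator_subgroup G (carrier G) (carrier G)" and y: "y \<in> carrier G"
  have "c \<in> carrier G"
    using c commutator_subgroup_subgroup[of "carrier G" "carrier G"] subgroup.mem_carrier by force
  then show "commutator c y \<in> frattini G" using y by (simp add: commutator_in_frattini)
qed (rule pow_in_frattini)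

lemma additive_vanishes_on_N: "additive f \<Longrightarrow> x \<in> N \<Longrightarrow> [f x = 0] (mod int p)"
  using N_subset_frattini frattini_iff by blast

text \<open>A counting principle that replaces dimension counts: each separating subgroup costs at least
  one factor \<open>p\<close>.\<close>

lemma card_ge_of_separating_subgroups:
  assumes "finite J" "subgroup C G" "subgroup K G" "K \<subseteq> C"
    and "\<And>k. k \<in> J \<Longrightarrow> subgroup (H k) G" "\<And>k. k \<in> J \<Longrightarrow> K \<subseteq> H k"
    and "\<And>k. k \<in> J \<Longrightarrow> g k \<in> C" "\<And>k. k \<in> J \<Longrightarrow> g k \<notin> H k"
    and "\<And>k l. k \<in> J \<Longrightarrow> l \<in> J \<Longrightarrow> k \<noteq> l \<Longrightarrow> g k \<in> H l"
  shows "p ^ card J * card K \<le> card C"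
  using assms
proof (induction J arbitrary: C rule: finite_induct)
  case empty then show ?case using finite_subgroup by (simp add: card_mono)
next
  case (insert j J)
  have s: "subgroup (C \<inter> H j) G" using insert.prems by (simp add: subgroups_Inter_pair)
  have "p ^ card J * card K \<le> card (C \<inter> H j)"
  proof (rule insert.IH[OF s])
    show "g k \<in> C \<inter> H j" if "k \<in> J" for k
      using that insert.prems(6) insert.prems(8)[of k j] insert.hyps(2) by blast
  qed (use insert.prems in auto)
  moreover have "p * card (C \<inter> H j) \<le> card C"
  proof (rule card_psubset_subgroup[OF s insert.prems(1)])
    show "C \<inter> H j \<subset> C" using insert.prems(6,7) by blast
  qed
  ultimately have "p * (p ^ card J * card K) \<le> card C" by (meson le_trans mult_le_mono2)
  then show ?case using insert.hyps by simp
qed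

lemma AutoGroup_pow:
  assumes "f \<in> auto G"
  shows "f [^]\<^bsub>AutoGroup G\<^esub> (n::nat) = (\<lambda>x\<in>carrier G. (f ^^ n) x)"
proof (induction n)
  case 0 then show ?case by (simp add: AutoGroup_def BijGroup_def)
next
  case (Suc n)
  interpret A: group "AutoGroup G" by (rule AutoGroup)
  have fB: "f \<in> Bij (carrier G)" using assms by (simp add: auto_def)
  have fA: "f \<in> carrier (AutoGroup G)" using assms by (simp add: AutoGroup_def)
  have pB: "f [^]\<^bsub>AutoGroup G\<^esub> n \<in> Bij (carrier G)"
    using A.nat_pow_closed[OF fA, of n] by (simp add: AutoGroup_def auto_def)
  have cl: "f x \<in> carrier G" if "x \<in> carrier G" for x using fB Bij_imp_funcset that by blast
  have "f [^]\<^bsub>AutoGroup G\<^esub> Suc n = compose (carrier G) (f [^]\<^bsub>AutoGroup G\<^esub> n) f"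
    using fB pB by (simp add: AutoGroup_def BijGroup_def)
  also have "\<dots> = (\<lambda>x\<in>carrier G. (f ^^ Suc n) x)"
    unfolding compose_def Suc using cl by (auto simp: funpow_swap1 intro!: restrict_ext)
  finally show ?case .
qed

text \<open>The form in which automorphisms are used below: \<open>t\<close> need not be extensional, it may be trivial, and
bijectivity comes from its \<open>p\<close>-th iterate.\<close>

lemma inner_of_hypothesis:
  assumes hyp: "\<forall>f \<in> auto G. group.ord (AutoGroup G) f = p \<longrightarrow> (\<forall>x \<in> N. f x = x) \<longrightarrow> f \<in> inner_autos G"
    and cl: "\<And>x. x \<in> carrier G \<Longrightarrow> t x \<in> carrier G"
    and hom: "\<And>x y. x \<in> carrier G \<Longrightarrow> y \<in> carrier G \<Longrightarrow> t (x \<otimes> y) = t x \<otimes> t y"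
    and pow: "\<And>x. x \<in> carrier G \<Longrightarrow> (t ^^ p) x = x"
    and fixN: "\<And>x. x \<in> N \<Longrightarrow> t x = x"
  shows "\<exists>g\<in>carrier G. \<forall>x\<in>carrier G. t x = g \<otimes> x \<otimes> inv g"
proof -
  let ?f = "\<lambda>x\<in>carrier G. t x"
  interpret A: group "AutoGroup G" by (rule AutoGroup)
  obtain q where q: "p = Suc q" using p_gt_1 by (cases p) auto
  have cln: "(t ^^ n) x \<in> carrier G" if "x \<in> carrier G" for n x
    using that cl by (induction n) auto
  have "bij_betw ?f (carrier G) (carrier G)"
  proof (rule bij_betw_byWitness[where f' = "t ^^ q"])
    show "\<forall>x\<in>carrier G. (t ^^ q) (?f x) = x" using pow q by (simp add: funpow_swap1)
    show "\<forall>x\<in>carrier G. ?f ((t ^^ q) x) = x" using pow q cln by simp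
  qed (use cl cln in auto)
  then have fA: "?f \<in> auto G" unfolding auto_def Bij_def using cl hom by (auto simp: hom_def)
  have fn: "(?f ^^ n) x = (t ^^ n) x" if "x \<in> carrier G" for n x
    using that cln by (induction n) auto
  have "?f [^]\<^bsub>AutoGroup G\<^esub> p = \<one>\<^bsub>AutoGroup G\<^esub>"
    unfolding AutoGroup_pow[OF fA] using fn pow by (auto simp: AutoGroup_def BijGroup_def intro!: restrict_ext)
  then have "A.ord ?f dvd p" using A.pow_eq_id[of ?f p] fA by (simp add: AutoGroup_def)
  then have o: "A.ord ?f = 1 \<or> A.ord ?f = p" using prime_p prime_nat_iff by blast
  show ?thesis
  proof (cases "A.ord ?f = p")
    case True
    have "\<forall>x\<in>N. ?f x = x" using fixN subgroup.mem_carrier[OF N_subgroup] by auto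
    then have "?f \<in> inner_autos G" using hyp fA True by blast
    then obtain g where g: "g \<in> carrier G" "?f = (\<lambda>x\<in>carrier G. g \<otimes> x \<otimes> inv g)"
      by (auto simp: inner_autos_def)
    have "t x = g \<otimes> x \<otimes> inv g" if "x \<in> carrier G" for x using fun_cong[OF g(2), of x] that by simp
    then show ?thesis using g(1) by blast
  next
    case False
    then have "A.ord ?f = 1" using o by simp
    then have "?f = \<one>\<^bsub>AutoGroup G\<^esub>" using A.ord_eq_1[of ?f] fA by (simp add: AutoGroup_def)
    then have e: "?f = (\<lambda>x\<in>carrier G. x)" by (simp add: AutoGroup_def BijGroup_def)
    have "t x = x" if "x \<in> carrier G" for x using fun_cong[OF e, of x] that by simp
    then show ?thesis by (intro bexI[of _ \<one>]) auto
  qed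
qed

end

locale odd_p_group = p_group +
  assumes odd_p: "odd p"
begin

lemma two_not_cong_0: "\<not> [2 = 0] (mod int p)"
  using odd_p p_gt_1
  by (simp add: cong_0_iff) (metis dvd_refl int_dvd_int_iff of_nat_numeral prime_p primes_dvd_imp_eq two_is_prime_nat)

lemma p_dvd_sum: "p dvd (\<Sum>i<p. i)"
proof -
  obtain k where k: "p = Suc (2 * k)" using odd_p oddE by (metis Suc_eq_plus1)
  have "(\<Sum>i<Suc (2 * k). i) = Suc (2 * k) * k" by (induction k) auto
  then show ?thesis using k by (metis dvd_triv_left)
qed

lemma pow_mult_mod:
  assumes "H \<lhd> G" "a \<in> carrier G" "b \<in> carrier G"
    and "commutator (commutator b a) a \<in> H" "commutator (commutator b a) b \<in> H" "commutator b a [^] p \<in> H"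
  shows "(a \<otimes> b) [^] p \<otimes> inv (a [^] p \<otimes> b [^] p) \<in> H"
proof -
  interpret n: normal H G by (rule assms)
  interpret Q: group "G Mod H" by (rule n.factorgroup_is_group)
  interpret h: group_hom G "G Mod H" "\<lambda>a. H #> a"
    by unfold_locales (rule n.r_coset_hom_Mod)
  let ?c = "commutator b a"
  have c: "?c \<in> carrier G" using assms by simp
  have com: "(H #> x) \<otimes>\<^bsub>G Mod H\<^esub> (H #> y) = (H #> y) \<otimes>\<^bsub>G Mod H\<^esub> (H #> x)"
    if "x \<in> carrier G" "y \<in> carrier G" "commutator x y \<in> H" for x y
    using Q.commutator_eq_one_iff[of "H #> x" "H #> y"] n.rcoset_commutator[of x y] n.rcoset_eq_self_iff[of "commutator x y"] that
    by (metis commutator_closed h.hom_closed one_FactGroup)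
  have e: "b \<otimes> a = ?c \<otimes> (a \<otimes> b)" using commutator_mult[of b a] assms by (simp add: m_assoc)
  have "(H #> b) \<otimes>\<^bsub>G Mod H\<^esub> (H #> a) = (H #> ?c) \<otimes>\<^bsub>G Mod H\<^esub> ((H #> a) \<otimes>\<^bsub>G Mod H\<^esub> (H #> b))"
    using e assms c by (metis h.hom_mult m_closed)
  from Q.class2_power[OF _ _ _ this com[OF c assms(2,4)] com[OF c assms(3,5)], of p]
  have "((H #> a) \<otimes>\<^bsub>G Mod H\<^esub> (H #> b)) [^]\<^bsub>G Mod H\<^esub> p =
    (H #> a) [^]\<^bsub>G Mod H\<^esub> p \<otimes>\<^bsub>G Mod H\<^esub> (H #> b) [^]\<^bsub>G Mod H\<^esub> p \<otimes>\<^bsub>G Mod H\<^esub> (H #> ?c) [^]\<^bsub>G Mod H\<^esub> (\<Sum>i<p. i)"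
    using assms(2,3) c h.hom_closed by blast
  moreover have "(H #> ?c) [^]\<^bsub>G Mod H\<^esub> (\<Sum>i<p. i) = \<one>\<^bsub>G Mod H\<^esub>"
  proof -
    obtain k where k: "(\<Sum>i<p. i) = p * k" using p_dvd_sum by blast
    have "(H #> ?c) [^]\<^bsub>G Mod H\<^esub> p = H #> (?c [^] p)" using h.hom_nat_pow[OF c, of p] by simp
    also have "\<dots> = \<one>\<^bsub>G Mod H\<^esub>" using n.rcoset_eq_self_iff[of "?c [^] p"] assms(6) c by simp
    finally have "((H #> ?c) [^]\<^bsub>G Mod H\<^esub> p) [^]\<^bsub>G Mod H\<^esub> k = \<one>\<^bsub>G Mod H\<^esub>" by (simp only: Q.nat_pow_one)
    then show ?thesis unfolding k using Q.nat_pow_pow[OF h.hom_closed[OF c], of p k] by simp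
  qed
  ultimately have "H #> ((a \<otimes> b) [^] p) = H #> (a [^] p \<otimes> b [^] p)"
    using assms(2,3) h.hom_closed Q.r_one Q.nat_pow_closed Q.m_closed
    by (simp only: h.hom_mult h.hom_nat_pow m_closed nat_pow_closed)
  then show ?thesis using assms(2,3) by (subst (asm) n.rcoset_eq_iff) auto
qed

end

context group
begin

lemma inv_commute:
  assumes "g \<in> carrier G" "h \<in> carrier G" "g \<otimes> h = h \<otimes> g"
  shows "inv g \<otimes> h = h \<otimes> inv g"
proof -
  have "inv g \<otimes> h = inv g \<otimes> (h \<otimes> g) \<otimes> inv g" using assms(1,2) by (simp add: m_assoc)
  also have "\<dots> = h \<otimes> inv g" unfolding assms(3)[symmetric] using assms(1,2) by (simp add: m_assoc)
  finally show ?thesis .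
qed

lemma int_pow_commute:
  assumes "g \<in> carrier G" "h \<in> carrier G" "g \<otimes> h = h \<otimes> g"
  shows "g [^] (k::int) \<otimes> h = h \<otimes> g [^] k"
proof (cases k rule: int_cases2)
  case (nonneg j) then show ?thesis using group_commutes_pow[OF assms(3,1,2), of j] by (simp add: int_pow_int)
next
  case (nonpos j)
  have "g [^] k = inv (g [^] j)" using nonpos assms by (simp add: int_pow_neg_int)
  then show ?thesis
    using inv_commute[of "g [^] j" h] group_commutes_pow[OF assms(3,1,2), of j] assms(1,2) by simp
qed

end

context p_group
begin

lemma additive_sum:
  assumes "\<And>i. i < (n::nat) \<Longrightarrow> additive (f i)" shows "additive (\<lambda>x. \<Sum>i<n. c i * f i x)"
  unfolding additive_def
proof (intro ballI)
  fix x y assume xy: "x \<in> carrier G" "y \<in> carrier G"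
  have "[(\<Sum>i<n. c i * f i (x \<otimes> y)) = (\<Sum>i<n. c i * (f i x + f i y))] (mod int p)"
    by (rule cong_sum) (use assms xy in \<open>auto intro!: cong_scalar_left simp: additiveD\<close>)
  then show "[(\<Sum>i<n. c i * f i (x \<otimes> y)) = (\<Sum>i<n. c i * f i x) + (\<Sum>i<n. c i * f i y)] (mod int p)"
    by (simp add: distrib_left sum.distrib)
qed

lemma additive_diff:
  assumes "additive f" "additive g" shows "additive (\<lambda>x. f x - g x)"
  unfolding additive_def
proof (intro ballI)
  fix x y assume "x \<in> carrier G" "y \<in> carrier G"
  then have "[f (x \<otimes> y) - g (x \<otimes> y) = (f x + f y) - (g x + g y)] (mod int p)"
    using assms by (intro cong_diff) (auto simp: additiveD)
  then show "[f (x \<otimes> y) - g (x \<otimes> y) = f x - g x + (f y - g y)] (mod int p)" by (simp add: algebra_simps)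
qed

lemma additive_scale: "additive f \<Longrightarrow> additive (\<lambda>x. c * f x)"
  using additive_sum[of 1 "\<lambda>_. f" "\<lambda>_. c"] by simp

lemma additive_add:
  assumes "additive f" "additive g" shows "additive (\<lambda>x. f x + g x)"
  using additive_diff[OF assms(1) additive_scale[OF assms(2), of "-1"]] by simp

lemma additive_int_pow:
  assumes "additive f" "x \<in> carrier G" shows "[f (x [^] (k::int)) = k * f x] (mod int p)"
proof (cases k rule: int_cases2)
  case (nonneg n) then show ?thesis using additive_pow[OF assms] by (simp add: int_pow_int)
next
  case (nonpos n)
  have "x [^] k = inv (x [^] n)" using nonpos assms(2) by (simp add: int_pow_neg_int)
  then have "[f (x [^] k) = - f (x [^] n)] (mod int p)" using additive_inv[OF assms(1), of "x [^] n"] assms(2) by simp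
  also have "[- f (x [^] n) = - (int n * f x)] (mod int p)"
    using additive_pow[OF assms, of n] by (simp add: cong_minus_minus_iff)
  finally show ?thesis using nonpos by simp
qed

lemma mult_cong_0_iff: "[a * b = 0] (mod int p) \<longleftrightarrow> [a = 0] (mod int p) \<or> [b = 0] (mod int p)"
  using prime_p by (simp add: cong_0_iff prime_dvd_mult_iff prime_nat_int_transfer)

end

text \<open>The standing situation: \<open>z\<close> generates the elements of order \<open>p\<close> in the centre. Cyclicity of the centre
enters through its two consequences \<open>z_root\<close> and \<open>center_pow_or_generates\<close>.\<close>

locale inner_p_group = odd_p_group +
  fixes z :: 'a
  assumes z_carrier [simp, intro]: "z \<in> carrier G"
    and z_comm: "\<And>x. x \<in> carrier G \<Longrightarrow> z \<otimes> x = x \<otimes> z"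
    and z_pow: "z [^] p = \<one>"
    and z_ne_one: "z \<noteq> \<one>"
    and z_root: "\<And>y. y \<in> center G \<Longrightarrow> y [^] p = \<one> \<Longrightarrow> \<exists>k::int. y = z [^] k"
    and center_pow_or_generates: "\<And>u. u \<in> center G \<Longrightarrow>
        (\<exists>v\<in>center G. u = v [^] p) \<or> (\<forall>y\<in>center G. \<exists>k::int. y = u [^] k)"
    and noncomm: "\<not> comm_group G"
    and inner_if_order_p: "\<forall>f \<in> auto G. group.ord (AutoGroup G) f = p \<longrightarrow> (\<forall>x \<in> N. f x = x) \<longrightarrow> f \<in> inner_autos G"
begin

lemma zpow_comm:
  assumes "x \<in> carrier G" shows "z [^] (k::int) \<otimes> x = x \<otimes> z [^] k"
  using int_pow_commute[OF z_carrier assms z_comm[OF assms]] .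

lemma zpow_conj:
  assumes "x \<in> carrier G" shows "x \<otimes> z [^] (k::int) \<otimes> inv x = z [^] k"
  unfolding zpow_comm[OF assms, symmetric] using assms by (simp add: m_assoc)

lemma zpow_central: "z [^] (k::int) \<in> center G"
  using zpow_comm by (simp add: mem_center_iff)

lemma zpow_eq_iff: "z [^] (a::int) = z [^] (b::int) \<longleftrightarrow> [a = b] (mod int p)"
proof -
  have "ord z dvd p" using pow_eq_id[of z p] z_pow by simp
  moreover have "ord z \<noteq> 1" using ord_eq_1[of z] z_ne_one by simp
  ultimately have "ord z = p" using prime_p unfolding prime_nat_iff by blast
  then show ?thesis using int_pow_eq[of z a b] by (simp add: cong_iff_dvd_diff dvd_diff_commute)
qed

lemma zpow_eq_one_iff: "z [^] (a::int) = \<one> \<longleftrightarrow> [a = 0] (mod int p)"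
  using zpow_eq_iff[of a 0] by simp

lemma zpow_pow_p: "(z [^] (k::int)) [^] p = \<one>"
  using zpow_eq_one_iff[of "k * int p"] by (simp add: int_pow_pow cong_0_iff flip: int_pow_int)

lemma zpow_add: "z [^] (a::int) \<otimes> z [^] (b::int) = z [^] (a + b)"
  by (simp add: int_pow_mult)

lemma exists_noncommuting: "\<exists>x\<in>carrier G. \<exists>y\<in>carrier G. commutator x y \<noteq> \<one>"
proof (rule ccontr)
  assume "\<not> ?thesis"
  then have "comm_group G" by (intro group_comm_groupI) (auto simp: commutator_eq_one_iff)
  then show False using noncomm by simp
qed

lemma z_in_normal_subgroup:
  assumes "K \<lhd> G" "K \<noteq> {\<one>}" shows "z \<in> K"
proof -
  have sK: "subgroup K G" using assms(1) by (simp add: normal_imp_subgroup)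
  have "{\<one>} \<subset> K" using assms(2) subgroup.one_closed[OF sK] by blast
  then obtain x where "x \<in> K" "x \<notin> {\<one>}" "x [^] p \<in> {\<one>}"
    "\<And>y. y \<in> carrier G \<Longrightarrow> commutator x y \<in> {\<one>}"
    using central_step[OF one_is_normal assms(1)] by metis
  then have x: "x \<in> K" "x \<noteq> \<one>" "x [^] p = \<one>" "\<And>y. y \<in> carrier G \<Longrightarrow> commutator x y = \<one>"
    by auto
  have xc: "x \<in> carrier G" using x(1) sK subgroup.mem_carrier by metis
  have "x \<in> center G" using x(4) xc by (simp add: mem_center_iff commutator_eq_one_iff)
  then obtain k :: int where k: "x = z [^] k" using z_root x(3) by blast
  have "\<not> [k = 0] (mod int p)" using x(2) k zpow_eq_one_iff by blast
  then obtain n where n: "[int n * k = 1] (mod int p)" using exists_inverse_mod_p by blast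
  have "x [^] n = z [^] (k * int n)" unfolding k by (simp add: int_pow_pow flip: int_pow_int)
  also have "\<dots> = z [^] (1::int)" unfolding zpow_eq_iff using n by (simp add: mult.commute)
  finally have "z = x [^] n" by simp
  then show ?thesis using x(1) sK by (metis subgroup_int_pow_closed int_pow_int)
qed

text \<open>If \<open>f z\<close> were nonzero, the kernel of \<open>f\<close> would be a normal subgroup without \<open>z\<close>, hence trivial, although it
contains all commutators.\<close>

lemma additive_z:
  assumes "additive f" shows "[f z = 0] (mod int p)"
proof (rule ccontr)
  assume "\<not> [f z = 0] (mod int p)"
  then have "{x \<in> carrier G. [f x = 0] (mod int p)} = {\<one>}"
    using z_in_normal_subgroup[OF additive_kernel_normal[OF assms]] by blast
  then have "commutator x y = \<one>" if "x \<in> carrier G" "y \<in> carrier G" for x y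
    using that additive_commutator[OF assms that] by blast
  then show False using exists_noncommuting by blast
qed

lemma z_in_frattini: "z \<in> frattini G"
  by (simp add: frattini_iff additive_z)

lemma zpow_in_frattini: "z [^] (k::int) \<in> frattini G"
  using z_in_frattini frattini_subgroup subgroup_int_pow_closed by blast

section \<open>The elements with commutators in the socle of the centre\<close>

definition E :: "'a set" where
  "E = {g \<in> carrier G. \<forall>x\<in>carrier G. \<exists>k::int. commutator g x = z [^] k}"

text \<open>The commutator of \<open>g \<in> E\<close> with \<open>x\<close> as an exponent of \<open>z\<close>, determined modulo \<open>p\<close>.\<close>

definition phi :: "'a \<Rightarrow> 'a \<Rightarrow> int" where
  "phi g x = (SOME k. commutator g x = z [^] k)"

lemma E_carrier: "g \<in> E \<Longrightarrow> g \<in> carrier G"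
  by (simp add: E_def)

lemma E_I: "g \<in> carrier G \<Longrightarrow> (\<And>x. x \<in> carrier G \<Longrightarrow> \<exists>k::int. commutator g x = z [^] k) \<Longrightarrow> g \<in> E"
  by (simp add: E_def)

lemma commutator_E:
  assumes "g \<in> E" "x \<in> carrier G" shows "commutator g x = z [^] phi g x"
proof -
  have "\<exists>k::int. commutator g x = z [^] k" using assms by (simp add: E_def)
  then show ?thesis unfolding phi_def by (rule someI_ex)
qed

lemma phi_cong:
  assumes "g \<in> E" "x \<in> carrier G" "commutator g x = z [^] (k::int)"
  shows "[phi g x = k] (mod int p)"
  using assms commutator_E zpow_eq_iff by metis

lemma E_conj:
  assumes "g \<in> E" "x \<in> carrier G" shows "x \<otimes> g \<otimes> inv x = z [^] (- phi g x) \<otimes> g"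
proof -
  have g: "g \<in> carrier G" using assms(1) by (rule E_carrier)
  have "commutator x g = z [^] (- phi g x)"
    using inv_commutator[OF g assms(2)] commutator_E[OF assms] by (simp add: int_pow_neg)
  then show ?thesis using conj_eq_commutator_mult[OF assms(2) g] by simp
qed

lemma additive_phi:
  assumes "g \<in> E" shows "additive (phi g)"
  unfolding additive_def
proof (intro ballI)
  fix x y assume xy: "x \<in> carrier G" "y \<in> carrier G"
  have g: "g \<in> carrier G" using assms by (rule E_carrier)
  have "commutator g (x \<otimes> y) = z [^] phi g x \<otimes> (x \<otimes> z [^] phi g y \<otimes> inv x)"
    using commutator_mult_right[OF xy g] commutator_E[OF assms] xy by simp
  also have "x \<otimes> z [^] phi g y \<otimes> inv x = z [^] phi g y"
    using zpow_conj xy by blast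
  finally show "[phi g (x \<otimes> y) = phi g x + phi g y] (mod int p)"
    using phi_cong[OF assms, of "x \<otimes> y"] xy zpow_add by simp
qed

lemma commutator_E_mult:
  assumes "g \<in> E" "h \<in> E" "x \<in> carrier G"
  shows "commutator (g \<otimes> h) x = z [^] (phi g x + phi h x)"
proof -
  have gh: "g \<in> carrier G" "h \<in> carrier G" using assms E_carrier by auto
  have "commutator (g \<otimes> h) x = g \<otimes> z [^] phi h x \<otimes> inv g \<otimes> z [^] phi g x"
    using commutator_mult_left[OF gh assms(3)] commutator_E assms by simp
  also have "g \<otimes> z [^] phi h x \<otimes> inv g = z [^] phi h x"
    using zpow_conj gh by blast
  finally show ?thesis by (simp add: zpow_add add.commute)
qed

lemma center_subset_E: "center G \<subseteq> E"
proof
  fix g assume "g \<in> center G"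
  then have "g \<in> carrier G" "\<forall>x\<in>carrier G. commutator g x = z [^] (0::int)"
    by (auto simp: mem_center_iff commutator_eq_one_iff)
  then show "g \<in> E" unfolding E_def by blast
qed

lemma zpow_E: "z [^] (k::int) \<in> E"
  using zpow_central center_subset_E by blast

lemma E_subgroup: "subgroup E G"
proof (rule finite_p_subgroupI)
  show "E \<subseteq> carrier G" by (auto simp: E_def)
  show "\<one> \<in> E" using center_subset_E by (auto simp: mem_center_iff)
  fix g h assume gh: "g \<in> E" "h \<in> E"
  show "g \<otimes> h \<in> E"
  proof (rule E_I)
    show "g \<otimes> h \<in> carrier G" using gh E_carrier by simp
  qed (rule exI, rule commutator_E_mult[OF gh])
qed

lemma E_mult: "g \<in> E \<Longrightarrow> h \<in> E \<Longrightarrow> g \<otimes> h \<in> E"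
  by (rule subgroup.m_closed[OF E_subgroup])

lemma E_int_pow: "g \<in> E \<Longrightarrow> g [^] (k::int) \<in> E"
  by (rule subgroup_int_pow_closed[OF E_subgroup])

lemma phi_mult:
  assumes "g \<in> E" "h \<in> E" "x \<in> carrier G"
  shows "[phi (g \<otimes> h) x = phi g x + phi h x] (mod int p)"
  using phi_cong[OF E_mult[OF assms(1,2)] assms(3) commutator_E_mult[OF assms]] .

lemma phi_center:
  assumes "g \<in> E" shows "g \<in> center G \<longleftrightarrow> (\<forall>x\<in>carrier G. [phi g x = 0] (mod int p))"
  using assms E_carrier[OF assms] commutator_E[OF assms]
  by (simp add: mem_center_iff zpow_eq_one_iff flip: commutator_eq_one_iff)

lemma phi_commute_iff:
  assumes "g \<in> E" "x \<in> carrier G" shows "g \<otimes> x = x \<otimes> g \<longleftrightarrow> [phi g x = 0] (mod int p)"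
  using assms E_carrier[OF assms(1)] commutator_E[OF assms]
  by (simp add: zpow_eq_one_iff flip: commutator_eq_one_iff)

lemma phi_self: "g \<in> E \<Longrightarrow> [phi g g = 0] (mod int p)"
  using phi_commute_iff[of g g] E_carrier by blast

lemma phi_one: "x \<in> carrier G \<Longrightarrow> [phi \<one> x = 0] (mod int p)"
  using phi_commute_iff[of \<one> x] subgroup.one_closed[OF E_subgroup] by simp

lemma phi_inv:
  assumes "g \<in> E" "x \<in> carrier G" shows "[phi (inv g) x = - phi g x] (mod int p)"
proof -
  have i: "inv g \<in> E" using subgroup.m_inv_closed[OF E_subgroup assms(1)] .
  have "[phi (g \<otimes> inv g) x = phi g x + phi (inv g) x] (mod int p)" using phi_mult[OF assms(1) i assms(2)] .
  then have "[0 = phi g x + phi (inv g) x] (mod int p)"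
    using phi_one[OF assms(2)] E_carrier[OF assms(1)] by (metis cong_sym cong_trans r_inv)
  then show ?thesis by (simp add: cong_iff_dvd_diff algebra_simps) (metis add.commute dvd_minus_iff minus_add_distrib uminus_add_conv_diff)
qed

lemma phi_nat_pow:
  assumes "g \<in> E" "x \<in> carrier G" shows "[phi (g [^] (n::nat)) x = int n * phi g x] (mod int p)"
proof (induction n)
  case 0 then show ?case using phi_one[OF assms(2)] by simp
next
  case (Suc n)
  have gn: "g [^] n \<in> E" using E_int_pow[OF assms(1), of "int n"] by (simp add: int_pow_int)
  have "[phi (g [^] n \<otimes> g) x = phi (g [^] n) x + phi g x] (mod int p)" using phi_mult[OF gn assms] .
  also have "[phi (g [^] n) x + phi g x = int n * phi g x + phi g x] (mod int p)" using Suc by (simp add: cong_add_rcancel)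
  finally show ?case by (simp add: algebra_simps)
qed

lemma phi_int_pow:
  assumes "g \<in> E" "x \<in> carrier G" shows "[phi (g [^] (k::int)) x = k * phi g x] (mod int p)"
proof (cases k rule: int_cases2)
  case (nonneg n) then show ?thesis using phi_nat_pow[OF assms] by (simp add: int_pow_int)
next
  case (nonpos n)
  have gn: "g [^] n \<in> E" using E_int_pow[OF assms(1), of "int n"] by (simp add: int_pow_int)
  have "g [^] k = inv (g [^] n)" using nonpos E_carrier[OF assms(1)] by (simp add: int_pow_neg_int)
  then have "[phi (g [^] k) x = - phi (g [^] n) x] (mod int p)" using phi_inv[OF gn assms(2)] by simp
  also have "[- phi (g [^] n) x = - (int n * phi g x)] (mod int p)"
    using phi_nat_pow[OF assms, of n] by (simp add: cong_minus_minus_iff)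
  finally show ?thesis using nonpos by simp
qed

lemma E_pow_p_central:
  assumes "g \<in> E" shows "g [^] p \<in> center G"
proof -
  have gp: "g [^] p \<in> E" using E_int_pow[OF assms, of "int p"] by (simp add: int_pow_int)
  show ?thesis unfolding phi_center[OF gp] using phi_nat_pow[OF assms, of _ p] by (auto simp: cong_def)
qed

lemma E_pow_p_mult:
  assumes "g \<in> E" "h \<in> E" shows "(g \<otimes> h) [^] p = g [^] p \<otimes> h [^] p"
proof -
  have gh: "g \<in> carrier G" "h \<in> carrier G" using assms E_carrier by auto
  have c: "commutator h g = z [^] phi h g" using commutator_E[OF assms(2) gh(1)] .
  have "commutator (commutator h g) x = \<one>" if "x \<in> carrier G" for x
    unfolding c using zpow_comm[OF that] that by (simp add: commutator_eq_one_iff)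
  moreover have "commutator h g [^] p = \<one>"
    unfolding c by (rule zpow_pow_p)
  ultimately have "(g \<otimes> h) [^] p \<otimes> inv (g [^] p \<otimes> h [^] p) \<in> {\<one>}"
    using pow_mult_mod[OF one_is_normal gh] gh by simp
  then show ?thesis using gh by (metis inv_equality inv_inv m_closed nat_pow_closed singletonD inv_closed)
qed

text \<open>The product of the \<open>e i [^] a i\<close> for \<open>i < n\<close>, taken in increasing order because \<open>G\<close> is not commutative.\<close>

primrec eprod :: "(nat \<Rightarrow> 'a) \<Rightarrow> nat \<Rightarrow> (nat \<Rightarrow> int) \<Rightarrow> 'a" where
  "eprod e 0 a = \<one>"
| "eprod e (Suc n) a = eprod e n a \<otimes> e n [^] a n"

lemma eprod_E: "(\<And>i. i < n \<Longrightarrow> e i \<in> E) \<Longrightarrow> eprod e n a \<in> E"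
  by (induction n) (auto simp: subgroup.one_closed[OF E_subgroup] E_mult E_int_pow)

lemma phi_eprod:
  assumes "\<And>i. i < n \<Longrightarrow> e i \<in> E" "x \<in> carrier G"
  shows "[phi (eprod e n a) x = (\<Sum>i<n. a i * phi (e i) x)] (mod int p)"
  using assms(1)
proof (induction n)
  case 0 then show ?case using phi_one[OF assms(2)] by simp
next
  case (Suc n)
  have "[phi (eprod e n a \<otimes> e n [^] a n) x = phi (eprod e n a) x + phi (e n [^] a n) x] (mod int p)"
    by (rule phi_mult) (use Suc.prems eprod_E E_int_pow assms(2) in auto)
  also have "[phi (eprod e n a) x + phi (e n [^] a n) x = (\<Sum>i<n. a i * phi (e i) x) + a n * phi (e n) x] (mod int p)"
    by (rule cong_add) (use Suc phi_int_pow assms(2) in auto)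
  finally show ?case by simp
qed

lemma eprod_commute:
  assumes "\<And>i. i < n \<Longrightarrow> e i \<in> E" "x \<in> carrier G" "\<And>i. i < n \<Longrightarrow> e i \<otimes> x = x \<otimes> e i"
  shows "eprod e n a \<otimes> x = x \<otimes> eprod e n a"
proof -
  have "[phi (eprod e n a) x = 0] (mod int p)"
  proof -
    have "[(\<Sum>i<n. a i * phi (e i) x) = (\<Sum>i<n. 0)] (mod int p)"
      by (rule cong_sum) (use assms phi_commute_iff mult_cong_0_iff in auto)
    then show ?thesis using phi_eprod[of n e x a] assms by (auto intro: cong_trans)
  qed
  then show ?thesis using phi_commute_iff[OF eprod_E assms(2)] assms(1) by blast
qed

text \<open>On pairwise commuting elements of order \<open>p\<close> the exponent vector may be read modulo \<open>p\<close>.\<close>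

lemma eprod_add:
  assumes "\<And>i. i < n \<Longrightarrow> e i \<in> E" "\<And>i j. i < n \<Longrightarrow> j < n \<Longrightarrow> e i \<otimes> e j = e j \<otimes> e i"
    "\<And>i. i < n \<Longrightarrow> e i [^] p = \<one>"
    "\<And>i. i < n \<Longrightarrow> [c i = a i + b i] (mod int p)"
  shows "eprod e n c = eprod e n a \<otimes> eprod e n b"
  using assms
proof (induction n)
  case 0 then show ?case by simp
next
  case (Suc n)
  have en: "e n \<in> carrier G" using Suc.prems(1) E_carrier by blast
  have ec: "eprod e n a \<in> carrier G" for a by (rule E_carrier, rule eprod_E) (use Suc.prems in auto)
  have "ord (e n) dvd p" using pow_eq_id[OF en, of p] Suc.prems(3) by blast
  then have "e n [^] c n = e n [^] (a n + b n)"
    using int_pow_eq[OF en] Suc.prems(4)[of n]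
    by (metis cong_iff_dvd_diff cong_sym dvd_trans int_dvd_int_iff lessI)
  then have c: "e n [^] c n = e n [^] a n \<otimes> e n [^] b n" using en by (simp add: int_pow_mult)
  have "e n [^] a n \<otimes> eprod e n b = eprod e n b \<otimes> e n [^] a n"
  proof (rule int_pow_commute[OF en ec])
    show "e n \<otimes> eprod e n b = eprod e n b \<otimes> e n"
      by (rule eprod_commute[symmetric]) (use Suc.prems en in auto)
  qed
  moreover have "eprod e n c = eprod e n a \<otimes> eprod e n b"
    by (rule Suc.IH) (use Suc.prems in auto)
  ultimately show ?case unfolding eprod.simps c using ec en
    by (simp add: m_assoc) (simp add: m_assoc[symmetric])
qed

lemma eprod_eq_one:
  assumes "\<And>i. i < n \<Longrightarrow> f i \<in> E" "\<And>i. i < n \<Longrightarrow> f i [^] p = \<one>" "\<And>i. i < n \<Longrightarrow> [a i = 0] (mod int p)"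
  shows "eprod f n a = \<one>"
  using assms
proof (induction n)
  case (Suc n)
  have c: "f n \<in> carrier G" using Suc.prems(1) E_carrier by blast
  obtain k where "a n = int p * k" using Suc.prems(3)[of n] by (auto simp: cong_0_iff)
  then have "f n [^] a n = (f n [^] p) [^] k" using c by (simp add: int_pow_pow flip: int_pow_int)
  then have "f n [^] a n = \<one>" using Suc.prems(2) by simp
  then show ?case using Suc by simp
qed simp

lemma eprod_pow_p:
  assumes "\<And>i. i < n \<Longrightarrow> e i \<in> E" "\<And>i. i < n \<Longrightarrow> e i [^] p = \<one>"
  shows "eprod e n a [^] p = \<one>"
  using assms
proof (induction n)
  case 0 then show ?case by simp
next
  case (Suc n)
  have "eprod e (Suc n) a [^] p = eprod e n a [^] p \<otimes> (e n [^] a n) [^] p"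
    unfolding eprod.simps by (rule E_pow_p_mult) (use Suc.prems eprod_E E_int_pow in auto)
  also have "(e n [^] a n) [^] p = (e n [^] p) [^] a n"
    using Suc.prems(1)[of n] E_carrier by (simp add: int_pow_pow mult.commute flip: int_pow_int)
  finally show ?case using Suc by simp
qed

lemma eprod_in_subgroup:
  "subgroup H G \<Longrightarrow> (\<And>i. i < n \<Longrightarrow> e i \<in> H) \<Longrightarrow> eprod e n a \<in> H"
  by (induction n) (auto simp: subgroup.one_closed subgroup.m_closed subgroup_int_pow_closed)

section \<open>Automorphisms from derivations\<close>

text \<open>Put \<open>D x = eprod e n (\<lambda>i. al i x) \<otimes> z [^] s x\<close>. Since \<open>x\<close> conjugates an element \<open>u\<close> of \<open>E\<close> to
\<open>z [^] (- phi u x) \<otimes> u\<close>, the condition on \<open>s\<close> says exactly that \<open>D\<close> is a derivation, so that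
\<open>x \<mapsto> D x \<otimes> x\<close> is an endomorphism. It moves \<open>D x\<close> only by a power of \<open>z\<close>, and its \<open>p\<close>-th iterate is
the identity because \<open>p\<close> divides \<open>p(p-1)/2\<close>.\<close>

lemma derivation_is_inner:
  fixes al :: "nat \<Rightarrow> 'a \<Rightarrow> int" and s :: "'a \<Rightarrow> int"
  assumes e: "\<And>i. i < n \<Longrightarrow> e i \<in> E" "\<And>i j. i < n \<Longrightarrow> j < n \<Longrightarrow> e i \<otimes> e j = e j \<otimes> e i"
      "\<And>i. i < n \<Longrightarrow> e i [^] p = \<one>"
    and al: "\<And>i. i < n \<Longrightarrow> additive (al i)"
    and s: "\<And>x y. x \<in> carrier G \<Longrightarrow> y \<in> carrier G \<Longrightarrow>
      [s (x \<otimes> y) = s x + s y - (\<Sum>i<n. al i y * phi (e i) x)] (mod int p)"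
    and al_e: "\<And>i j. i < n \<Longrightarrow> j < n \<Longrightarrow> [al i (e j) = 0] (mod int p)"
    and s_z: "[s z = 0] (mod int p)"
    and s_N: "\<And>x. x \<in> N \<Longrightarrow> [s x = 0] (mod int p)"
  shows "\<exists>g\<in>carrier G. \<forall>x\<in>carrier G. commutator g x = eprod e n (\<lambda>i. al i x) \<otimes> z [^] s x"
proof -
  define D where "D = (\<lambda>x. eprod e n (\<lambda>i. al i x) \<otimes> z [^] s x)"
  define t where "t = (\<lambda>x. D x \<otimes> x)"
  have ec: "eprod e n a \<in> carrier G" for a using e eprod_E E_carrier by blast
  have eadd: "eprod e n c = eprod e n a \<otimes> eprod e n b" if "\<And>i. i < n \<Longrightarrow> [c i = a i + b i] (mod int p)" for a b c
    by (rule eprod_add) (use e that in auto)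
  have Dc: "D x \<in> carrier G" for x unfolding D_def using ec by simp
  have D_vanish: "D x = z [^] s x" if "\<And>i. i < n \<Longrightarrow> [al i x = 0] (mod int p)" for x
  proof -
    have "eprod e n (\<lambda>i. al i x) = eprod e n (\<lambda>i. al i x) \<otimes> eprod e n (\<lambda>i. al i x)"
    proof (rule eadd)
      fix i assume "i < n"
      then show "[al i x = al i x + al i x] (mod int p)" using that[of i] by (simp add: cong_iff_dvd_diff)
    qed
    then have "eprod e n (\<lambda>i. al i x) = \<one>" using ec by (metis r_cancel_one')
    then show ?thesis by (simp add: D_def)
  qed
  have D_mult: "D (x \<otimes> y) = D x \<otimes> (x \<otimes> D y \<otimes> inv x)" if xy: "x \<in> carrier G" "y \<in> carrier G" for x y
  proof -
    let ?ay = "eprod e n (\<lambda>i. al i y)" let ?ax = "eprod e n (\<lambda>i. al i x)"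
    have ayE: "?ay \<in> E" using e eprod_E by blast
    have "x \<otimes> D y \<otimes> inv x = (x \<otimes> ?ay \<otimes> inv x) \<otimes> (x \<otimes> z [^] s y \<otimes> inv x)"
      unfolding D_def using xy ec by (simp add: m_assoc)
    also have "x \<otimes> z [^] s y \<otimes> inv x = z [^] s y"
      using zpow_conj xy by blast
    also have "x \<otimes> ?ay \<otimes> inv x = ?ay \<otimes> z [^] (- phi ?ay x)" using E_conj[OF ayE xy(1)] zpow_comm[OF ec] by simp
    finally have "D x \<otimes> (x \<otimes> D y \<otimes> inv x) = ?ax \<otimes> (z [^] s x \<otimes> ?ay) \<otimes> (z [^] (- phi ?ay x) \<otimes> z [^] s y)"
      unfolding D_def using xy ec by (simp add: m_assoc)
    also have "\<dots> = (?ax \<otimes> ?ay) \<otimes> (z [^] s x \<otimes> (z [^] (- phi ?ay x) \<otimes> z [^] s y))"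
      unfolding zpow_comm[OF ec] using ec by (simp add: m_assoc)
    also have "z [^] s x \<otimes> (z [^] (- phi ?ay x) \<otimes> z [^] s y) = z [^] (s x + (- phi ?ay x + s y))"
      by (simp add: zpow_add)
    also have "\<dots> = z [^] s (x \<otimes> y)" unfolding zpow_eq_iff
    proof -
      have "[phi ?ay x = (\<Sum>i<n. al i y * phi (e i) x)] (mod int p)" by (rule phi_eprod) (use e xy in auto)
      then have "[s x + s y - phi ?ay x = s x + s y - (\<Sum>i<n. al i y * phi (e i) x)] (mod int p)"
        by (rule cong_diff[OF cong_refl])
      also have "[s x + s y - (\<Sum>i<n. al i y * phi (e i) x) = s (x \<otimes> y)] (mod int p)" using s[OF xy] by (rule cong_sym)
      finally show "[s x + (- phi ?ay x + s y) = s (x \<otimes> y)] (mod int p)" by (simp add: algebra_simps)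
    qed
    also have "?ax \<otimes> ?ay = eprod e n (\<lambda>i. al i (x \<otimes> y))"
      by (rule eadd[symmetric]) (use al additiveD xy in auto)
    finally show ?thesis by (simp add: D_def)
  qed
  have t_closed: "t x \<in> carrier G" if "x \<in> carrier G" for x using that Dc by (simp add: t_def)
  have t_mult: "t (x \<otimes> y) = t x \<otimes> t y" if xy: "x \<in> carrier G" "y \<in> carrier G" for x y
    unfolding t_def D_mult[OF xy] using xy Dc by (simp add: m_assoc)
  have t_pow: "t (x [^] (k::nat)) = t x [^] k" if "x \<in> carrier G" for x k
  proof (induction k)
    case 0
    have "t \<one> = t \<one> \<otimes> t \<one>" using t_mult[of \<one> \<one>] by simp
    then show ?case using t_closed[of \<one>] by (simp add: r_cancel_one')
  next
    case (Suc k) then show ?case using t_mult that by simp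
  qed
  have tz: "t z = z" unfolding t_def
    using D_vanish[of z] additive_z al s_z zpow_eq_one_iff by simp
  have D_pow_p: "D x [^] p = \<one>" for x
  proof -
    have "D x [^] p = eprod e n (\<lambda>i. al i x) [^] p \<otimes> (z [^] s x) [^] p"
      unfolding D_def by (rule E_pow_p_mult) (use e eprod_E center_subset_E zpow_central in auto)
    also have "(z [^] s x) [^] p = \<one>" by (rule zpow_pow_p)
    finally show ?thesis using eprod_pow_p[of n e] e by simp
  qed
  have tD: "\<exists>k::int. t (D x) = z [^] k \<otimes> D x" for x
  proof -
    have "D (D x) = z [^] s (D x)"
    proof (rule D_vanish)
      fix i assume i: "i < n"
      have "D x \<in> {x \<in> carrier G. [al i x = 0] (mod int p)}"
        unfolding D_def
      proof (rule subgroup.m_closed[OF additive_kernel_subgroup[OF al[OF i]]])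
        show "eprod e n (\<lambda>i. al i x) \<in> {x \<in> carrier G. [al i x = 0] (mod int p)}"
          by (rule eprod_in_subgroup[OF additive_kernel_subgroup[OF al[OF i]]]) (use e(1) E_carrier al_e i in auto)
        show "z [^] s x \<in> {x \<in> carrier G. [al i x = 0] (mod int p)}"
          using zpow_in_frattini al[OF i] by (simp add: frattini_iff)
      qed
      then show "[al i (D x) = 0] (mod int p)" by simp
    qed
    then show ?thesis unfolding t_def by (intro exI[of _ "s (D x)"]) simp
  qed
  have "(t ^^ p) x = x" if x: "x \<in> carrier G" for x
  proof -
    obtain k :: int where k: "t (D x) = z [^] k \<otimes> D x" using tD by blast
    have tzk: "t (z [^] (j::int)) = z [^] j" for j
      unfolding t_def using D_vanish[of "z [^] j"] zpow_in_frattini al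
    proof -
      obtain n :: nat where "[int n = j] (mod int p)"
        using p_gt_1 by (metis cong_mod_left cong_refl int_nat_eq of_nat_0_less_iff pos_mod_sign prime_gt_0_nat prime_p)
      then have "z [^] j = z [^] n" using zpow_eq_iff[of "int n" j] by (simp add: int_pow_int)
      then show "D (z [^] j) \<otimes> z [^] j = z [^] j" using t_pow[OF z_carrier, of n] tz by (simp add: t_def)
    qed
    \<comment> \<open>each application of \<open>t\<close> multiplies every earlier factor \<open>D x\<close> by \<open>z [^] k\<close>\<close>
    have "(t ^^ q) x = z [^] (int (\<Sum>i<q. i) * k) \<otimes> D x [^] q \<otimes> x" for q
    proof (induction q)
      case 0 then show ?case using x by simp
    next
      case (Suc q)
      let ?j = "int (\<Sum>i<q. i) * k"
      have "(t ^^ Suc q) x = t (z [^] ?j \<otimes> D x [^] q \<otimes> x)" using Suc by simp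
      also have "\<dots> = z [^] ?j \<otimes> (z [^] k \<otimes> D x) [^] q \<otimes> (D x \<otimes> x)"
        using t_mult Dc x tzk t_pow k by (simp add: t_def)
      also have "(z [^] k \<otimes> D x) [^] q = z [^] (k * int q) \<otimes> D x [^] q"
        using pow_mult_distrib[OF zpow_comm[OF Dc]] Dc by (simp add: int_pow_pow flip: int_pow_int)
      also have "z [^] ?j \<otimes> (z [^] (k * int q) \<otimes> D x [^] q) \<otimes> (D x \<otimes> x)
          = (z [^] ?j \<otimes> z [^] (k * int q)) \<otimes> D x [^] Suc q \<otimes> x" using Dc x by (simp add: m_assoc)
      finally show ?case by (simp add: zpow_add algebra_simps)
    qed
    moreover have "z [^] (int (\<Sum>i<p. i) * k) = \<one>" unfolding zpow_eq_one_iff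
      using p_dvd_sum by (simp add: cong_0_iff del: of_nat_sum)
    ultimately show ?thesis using D_pow_p x by simp
  qed
  moreover have "t x = x" if x: "x \<in> N" for x
  proof -
    have "D x = z [^] s x" by (rule D_vanish) (use al additive_vanishes_on_N x in auto)
    then have "D x = \<one>" using s_N[OF x] zpow_eq_one_iff by simp
    then show ?thesis using x subgroup.mem_carrier[OF N_subgroup] by (simp add: t_def)
  qed
  ultimately obtain g where g: "g \<in> carrier G" "\<And>x. x \<in> carrier G \<Longrightarrow> t x = g \<otimes> x \<otimes> inv g"
    using inner_of_hypothesis[OF inner_if_order_p t_closed t_mult] by blast
  have "commutator g x = D x" if x: "x \<in> carrier G" for x
    using g(2)[OF x] conj_eq_commutator_mult[OF g(1) x] g(1) x Dc by (simp add: t_def)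
  then show ?thesis using g(1) unfolding D_def by blast
qed

section \<open>A generating system and its dual basis\<close>

text \<open>The case of an empty family of \<open>e i\<close>: a derivation into \<open>\<langle>z\<rangle>\<close> is a homomorphism.\<close>

lemma additive_is_phi:
  assumes "additive f" obtains g where "g \<in> E" "\<And>x. x \<in> carrier G \<Longrightarrow> [phi g x = f x] (mod int p)"
proof -
  have "\<exists>g\<in>carrier G. \<forall>x\<in>carrier G. commutator g x = eprod (\<lambda>_. \<one>) 0 (\<lambda>i. 0) \<otimes> z [^] f x"
    by (rule derivation_is_inner[where al = "\<lambda>_ _. 0"])
      (use assms additiveD additive_z additive_vanishes_on_N in auto)
  then obtain g where g: "g \<in> carrier G" "\<And>x. x \<in> carrier G \<Longrightarrow> commutator g x = z [^] f x" by auto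
  have gE: "g \<in> E" using g by (intro E_I) auto
  show thesis using that[OF gE] phi_cong[OF gE _ g(2)] by blast
qed

text \<open>The rank one derivation \<open>x \<mapsto> e [^] (2 * phi e x) \<otimes> z [^] (- (phi e x)\<^sup>2)\<close> is inner, so its values are
commutators; this puts a power of \<open>e\<close> with exponent prime to \<open>p\<close> into the Frattini subgroup.\<close>

lemma E_order_p_in_frattini:
  assumes e: "e \<in> E" and ep: "e [^] p = \<one>" shows "e \<in> frattini G"
proof (cases "e \<in> center G")
  case True
  then show ?thesis using z_root ep zpow_in_frattini by metis
next
  case False
  then obtain x where x: "x \<in> carrier G" "\<not> [phi e x = 0] (mod int p)" using phi_center[OF e] by blast
  have ec: "e \<in> carrier G" using e by (rule E_carrier)
  let ?f = "phi e"
  have f: "additive ?f" using e by (rule additive_phi)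
  have "\<exists>g\<in>carrier G. \<forall>x\<in>carrier G. commutator g x = eprod (\<lambda>_. e) 1 (\<lambda>i. 2 * ?f x) \<otimes> z [^] (- (?f x * ?f x))"
  proof (rule derivation_is_inner[where al = "\<lambda>_ x. 2 * ?f x" and s = "\<lambda>x. - (?f x * ?f x)"])
    show "additive (\<lambda>x. 2 * ?f x)" using f by (rule additive_scale)
    show "[- (?f (x \<otimes> y) * ?f (x \<otimes> y)) =
        - (?f x * ?f x) + - (?f y * ?f y) - (\<Sum>i<1::nat. 2 * ?f y * ?f x)] (mod int p)"
      if "x \<in> carrier G" "y \<in> carrier G" for x y
    proof -
      have "[?f (x \<otimes> y) * ?f (x \<otimes> y) = (?f x + ?f y) * (?f x + ?f y)] (mod int p)"
        using additiveD[OF f that] by (intro cong_mult)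
      then have "[- (?f (x \<otimes> y) * ?f (x \<otimes> y)) = - ((?f x + ?f y) * (?f x + ?f y))] (mod int p)"
        by (simp add: cong_minus_minus_iff)
      then show ?thesis by (simp add: algebra_simps)
    qed
    show "[2 * ?f e = 0] (mod int p)" using phi_self[OF e] by (simp add: mult_cong_0_iff)
    show "[- (?f z * ?f z) = 0] (mod int p)" using additive_z[OF f] mult_cong_0_iff[of "?f z" "?f z"]
      by (simp add: cong_0_iff)
    show "[- (?f x * ?f x) = 0] (mod int p)" if "x \<in> N" for x
      using additive_vanishes_on_N[OF f that] mult_cong_0_iff[of "?f x" "?f x"] by (simp add: cong_0_iff)
  qed (use e ep in auto)
  then obtain g where g: "g \<in> carrier G"
    "\<And>x. x \<in> carrier G \<Longrightarrow> commutator g x = e [^] (2 * ?f x) \<otimes> z [^] (- (?f x * ?f x))"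
    using ec by auto
  let ?k = "2 * ?f x"
  have "[h e = 0] (mod int p)" if h: "additive h" for h
  proof -
    have "[h (commutator g x) = 0] (mod int p)" using additive_commutator[OF h g(1) x(1)] .
    moreover have "[h (e [^] ?k \<otimes> z [^] (- (?f x * ?f x))) = ?k * h e + 0] (mod int p)"
    proof (rule cong_trans[OF additiveD[OF h] cong_add])
      show "[h (z [^] (- (?f x * ?f x))) = 0] (mod int p)" using zpow_in_frattini h by (simp add: frattini_iff)
    qed (use ec additive_int_pow[OF h ec] in auto)
    ultimately have "[?k * h e = 0] (mod int p)" using g(2)[OF x(1)] by (metis add.right_neutral cong_sym cong_trans)
    then show ?thesis using x(2) two_not_cong_0 by (simp add: mult_cong_0_iff)
  qed
  then show ?thesis using ec by (simp add: frattini_iff)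
qed

definition dual :: "nat \<Rightarrow> (nat \<Rightarrow> 'a) \<Rightarrow> (nat \<Rightarrow> 'a) \<Rightarrow> bool" where
  "dual d x e \<longleftrightarrow> (\<forall>i<d. x i \<in> carrier G \<and> e i \<in> E) \<and> generate G (x ` {..<d}) = carrier G \<and>
     (\<forall>i<d. \<forall>j<d. [phi (e i) (x j) = (if i = j then 1 else 0)] (mod int p))"

lemma exists_dual: "\<exists>x e. dual (min_generators G) x e"
proof -
  let ?d = "min_generators G"
  obtain x f where x: "\<And>i. i < ?d \<Longrightarrow> x i \<in> carrier G" "generate G (x ` {..<?d}) = carrier G"
    and f: "\<And>i. i < ?d \<Longrightarrow> additive (f i)"
    and xf: "\<And>i j. i < ?d \<Longrightarrow> j < ?d \<Longrightarrow> [f i (x j) = (if i = j then 1 else 0)] (mod int p)"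
    by (rule dual_functionals_of_generators) (use that in blast)
  have "\<exists>g. g \<in> E \<and> (\<forall>y\<in>carrier G. [phi g y = f i y] (mod int p))" if "i < ?d" for i
    using additive_is_phi[OF f[OF that]] by metis
  then obtain e where e: "\<And>i. i < ?d \<Longrightarrow> e i \<in> E"
    "\<And>i y. i < ?d \<Longrightarrow> y \<in> carrier G \<Longrightarrow> [phi (e i) y = f i y] (mod int p)" by metis
  have "dual ?d x e" unfolding dual_def using x e xf by (meson cong_trans)
  then show ?thesis by blast
qed

lemma dual_permute:
  assumes "dual d x e" "bij_betw q {..<d} {..<d}" shows "dual d (x \<circ> q) (e \<circ> q)"
proof -
  have q: "q i < d" if "i < d" for i using assms(2) that by (auto simp: bij_betw_def)
  have inj: "q i = q j \<longleftrightarrow> i = j" if "i < d" "j < d" for i j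
    using assms(2) that by (auto simp: bij_betw_def inj_on_def)
  have im: "(x \<circ> q) ` {..<d} = x ` {..<d}" using assms(2) by (simp only: bij_betw_def image_comp[symmetric])
  have ph: "[phi (e (q i)) (x (q j)) = (if i = j then 1 else 0)] (mod int p)" if "i < d" "j < d" for i j
  proof -
    have "[phi (e (q i)) (x (q j)) = (if q i = q j then 1 else 0)] (mod int p)"
      using assms(1) q[OF that(1)] q[OF that(2)] by (simp add: dual_def)
    then show ?thesis by (simp only: inj[OF that])
  qed
  show ?thesis unfolding dual_def im using assms(1) q ph by (simp add: dual_def)
qed

lemma dual_central_adjust:
  assumes D: "dual d x e" and v: "\<And>i. i < d \<Longrightarrow> v i \<in> center G"
  shows "dual d x (\<lambda>i. e i \<otimes> v i)"
proof -
  have vE: "v i \<in> E" if "i < d" for i using v[OF that] center_subset_E by blast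
  have "[phi (e i \<otimes> v i) (x j) = (if i = j then 1 else 0)] (mod int p)" if i: "i < d" and j: "j < d" for i j
  proof -
    have ei: "e i \<in> E" and xj: "x j \<in> carrier G" using D i j by (auto simp: dual_def)
    have "[phi (e i \<otimes> v i) (x j) = phi (e i) (x j) + phi (v i) (x j)] (mod int p)"
      using phi_mult[OF ei vE[OF i] xj] .
    also have "[phi (e i) (x j) + phi (v i) (x j) = (if i = j then 1 else 0) + 0] (mod int p)"
      using D i j phi_center[OF vE[OF i]] v[OF i] xj by (intro cong_add) (auto simp: dual_def)
    finally show ?thesis by simp
  qed
  then show ?thesis using D E_mult vE by (simp add: dual_def)
qed

text \<open>The change of generators that compensates replacing \<open>e r\<close> by \<open>e r \<otimes> e m [^] (- k)\<close>.\<close>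

lemma dual_shear:
  assumes D: "dual d x e" and r: "r < d" and m: "m < d" and rm: "r \<noteq> m"
  shows "dual d (x(m := x m \<otimes> x r [^] (k::int))) (e(r := e r \<otimes> e m [^] (- k)))"
proof -
  let ?x = "x(m := x m \<otimes> x r [^] k)" let ?e = "e(r := e r \<otimes> e m [^] (- k))"
  have xc: "x i \<in> carrier G" and eE: "e i \<in> E" if "i < d" for i using D that by (auto simp: dual_def)
  have ph: "[phi (e i) (x j) = (if i = j then 1 else 0)] (mod int p)" if "i < d" "j < d" for i j
    using D that by (simp add: dual_def)
  have x': "?x i \<in> carrier G" if "i < d" for i using xc m r that by simp
  have xs: "?x ` {..<d} \<subseteq> carrier G" using x' by blast
  have e': "?e i \<in> E" if "i < d" for i using eE m r that E_mult E_int_pow by simp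
  have old: "[phi (e i) (?x j) = (if i = j then 1 else 0) + (if j = m then k * (if i = r then 1 else 0) else 0)] (mod int p)"
    if i: "i < d" and j: "j < d" for i j
  proof (cases "j = m")
    case True
    have f: "additive (phi (e i))" using eE[OF i] by (rule additive_phi)
    have "[phi (e i) (x m \<otimes> x r [^] k) = phi (e i) (x m) + phi (e i) (x r [^] k)] (mod int p)"
      using additiveD[OF f] xc m r by simp
    also have "[phi (e i) (x m) + phi (e i) (x r [^] k) = (if i = m then 1 else 0) + k * (if i = r then 1 else 0)] (mod int p)"
      by (intro cong_add ph i m cong_trans[OF additive_int_pow[OF f] cong_scalar_left] xc r)
    finally show ?thesis using True by simp
  next
    case False then show ?thesis using ph[OF i j] by simp
  qed
  have new: "[phi (?e i) (?x j) = (if i = j then 1 else 0)] (mod int p)" if i: "i < d" and j: "j < d" for i j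
  proof (cases "i = r")
    case False then show ?thesis using old[OF i j] by (simp split: if_splits)
  next
    case True
    have "[phi (e r \<otimes> e m [^] (- k)) (?x j) = phi (e r) (?x j) + phi (e m [^] (- k)) (?x j)] (mod int p)"
      by (rule phi_mult) (use eE r m E_int_pow x' j in auto)
    also have "[phi (e r) (?x j) + phi (e m [^] (- k)) (?x j) =
        ((if r = j then 1 else 0) + (if j = m then k * (if r = r then 1 else 0) else 0)) +
        (- k) * ((if m = j then 1 else 0) + (if j = m then k * (if m = r then 1 else 0) else 0))] (mod int p)"
      by (intro cong_add old r j m cong_trans[OF phi_int_pow[OF eE[OF m] x'[OF j]] cong_scalar_left])
    finally show ?thesis using True rm by (auto split: if_splits)
  qed
  have "x i \<in> generate G (?x ` {..<d})" if i: "i < d" for i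
  proof -
    have sg: "subgroup (generate G (?x ` {..<d})) G" by (rule generate_is_subgroup[OF xs])
    have g: "?x j \<in> generate G (?x ` {..<d})" if "j < d" for j by (rule generate.incl) (use that in blast)
    show ?thesis
    proof (cases "i = m")
      case False then show ?thesis using g[OF i] by simp
    next
      case True
      have "x m = ?x m \<otimes> ?x r [^] (- k)" using xc r m rm by (simp add: m_assoc int_pow_neg)
      then show ?thesis unfolding True
        using subgroup.m_closed[OF sg g[OF m] subgroup_int_pow_closed[OF sg g[OF r], of "- k"]] by (simp only:)
    qed
  qed
  then have "generate G (x ` {..<d}) \<subseteq> generate G (?x ` {..<d})"
    by (intro generate_subgroup_incl generate_is_subgroup[OF xs]) auto
  moreover have "generate G (x ` {..<d}) = carrier G" using D by (simp add: dual_def)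
  moreover have "generate G (?x ` {..<d}) \<subseteq> carrier G" by (rule generate_incl[OF xs])
  ultimately have "generate G (?x ` {..<d}) = carrier G" by blast
  then show ?thesis unfolding dual_def using x' e' new by blast
qed

text \<open>All but one of the dual elements can be taken of order \<open>p\<close>: their \<open>p\<close>-th powers lie in the cyclic
  centre, so each is either a \<open>p\<close>-th power there, and removed by a central factor, or one of them
  generates the centre and can be used to cancel the others.\<close>

lemma exists_dual_order_p:
  assumes "dual (Suc m) x0 e0"
  shows "\<exists>x e. dual (Suc m) x e \<and> (\<forall>i<m. e i [^] p = \<one>)"
proof (cases "\<forall>i<Suc m. \<exists>v\<in>center G. e0 i [^] p = v [^] p")
  case True
  then obtain v where v: "\<And>i. i < Suc m \<Longrightarrow> v i \<in> center G" "\<And>i. i < Suc m \<Longrightarrow> e0 i [^] p = v i [^] p"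
    by metis
  have iv: "inv (v i) \<in> center G" if "i < Suc m" for i
    using v(1)[OF that] inv_commute by (auto simp: mem_center_iff)
  have "(e0 i \<otimes> inv (v i)) [^] p = \<one>" if i: "i < Suc m" for i
  proof -
    have "e0 i \<in> E" using assms i by (simp add: dual_def)
    then have "(e0 i \<otimes> inv (v i)) [^] p = e0 i [^] p \<otimes> inv (v i) [^] p"
      using iv[OF i] center_subset_E by (intro E_pow_p_mult) auto
    then show ?thesis using v[OF i] by (simp add: nat_pow_inv mem_center_iff)
  qed
  then show ?thesis using dual_central_adjust[OF assms iv]
    by - (rule exI[of _ x0], rule exI[of _ "\<lambda>i. e0 i \<otimes> inv (v i)"], simp)
next
  case False
  then obtain k where k: "k < Suc m" "\<not> (\<exists>v\<in>center G. e0 k [^] p = v [^] p)" by blast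
  let ?q = "Transposition.transpose k m"
  have "bij_betw ?q {..<Suc m} {..<Suc m}"
    by (rule bij_betw_byWitness[where f' = ?q]) (use k in \<open>auto simp: Transposition.transpose_def\<close>)
  then have D1: "dual (Suc m) (x0 \<circ> ?q) (e0 \<circ> ?q)" by (rule dual_permute[OF assms])
  let ?em = "e0 k"
  have emE: "?em \<in> E" using assms k by (simp add: dual_def)
  have gen: "\<exists>j::int. y = (?em [^] p) [^] j" if "y \<in> center G" for y
    using center_pow_or_generates[OF E_pow_p_central[OF emE]] k(2) that by blast
  have "\<exists>x e. dual (Suc m) x e \<and> e m = ?em \<and> (\<forall>i<r. e i [^] p = \<one>)" if "r \<le> m" for r
    using that
  proof (induction r)
    case 0
    have "(e0 \<circ> ?q) m = ?em" by simp
    then show ?case using D1 by blast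
  next
    case (Suc r)
    then obtain x e where D: "dual (Suc m) x e" "e m = ?em" "\<forall>i<r. e i [^] p = \<one>" by auto
    have er: "e r \<in> E" using D(1) Suc.prems by (simp add: dual_def)
    obtain j :: int where j: "e r [^] p = (?em [^] p) [^] j" using gen[OF E_pow_p_central[OF er]] by blast
    let ?e = "e(r := e r \<otimes> e m [^] (- j))"
    have "(e r \<otimes> e m [^] (- j)) [^] p = e r [^] p \<otimes> (e m [^] (- j)) [^] p"
      by (rule E_pow_p_mult[OF er E_int_pow]) (use D(2) emE in simp)
    also have "(e m [^] (- j)) [^] p = (?em [^] p) [^] (- j)"
      using D(2) E_carrier[OF emE] by (simp add: int_pow_pow mult.commute flip: int_pow_int)
    also have "e r [^] p \<otimes> (?em [^] p) [^] (- j) = \<one>" unfolding j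
      using E_carrier[OF emE] by (simp add: int_pow_neg)
    finally have "?e r [^] p = \<one>" by simp
    then have "\<forall>i<Suc r. ?e i [^] p = \<one>" using D(3) by (simp add: less_Suc_eq)
    moreover have "?e m = ?em" using D(2) Suc.prems by simp
    ultimately show ?case using dual_shear[OF D(1), of r m j] Suc.prems by fastforce
  qed
  from this[of m] show ?thesis by blast
qed

end

text \<open>The number of generators is written \<open>Suc m\<close>, with the dual element that may have larger order in the last
place.\<close>

locale dual_inner_p_group = inner_p_group +
  fixes m :: nat and x e :: "nat \<Rightarrow> 'a"
  assumes dual: "dual (Suc m) x e"
    and e_pow: "\<And>i. i < m \<Longrightarrow> e i [^] p = \<one>"
begin

lemma x_carrier [simp]: "i < Suc m \<Longrightarrow> x i \<in> carrier G"
  and e_E [simp]: "i < Suc m \<Longrightarrow> e i \<in> E"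
  and x_generate: "generate G (x ` {..<Suc m}) = carrier G"
  and phi_dual: "i < Suc m \<Longrightarrow> j < Suc m \<Longrightarrow> [phi (e i) (x j) = (if i = j then 1 else 0)] (mod int p)"
  using dual by (auto simp: dual_def)

lemma additive_eq_0_if:
  assumes "additive f" "\<And>j. j < Suc m \<Longrightarrow> [f (x j) = 0] (mod int p)" "y \<in> carrier G"
  shows "[f y = 0] (mod int p)"
  by (rule additive_vanishes_if_on_generators[OF assms(1) x_generate _ assms(3)]) (use assms(2) in auto)

lemma additive_expansion:
  assumes f: "additive f" and y: "y \<in> carrier G"
  shows "[f y = (\<Sum>i<Suc m. f (x i) * phi (e i) y)] (mod int p)"
proof -
  let ?h = "\<lambda>y. \<Sum>i<Suc m. f (x i) * phi (e i) y"
  have h: "additive ?h" by (rule additive_sum) (simp add: additive_phi)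
  have "[f y - ?h y = 0] (mod int p)"
  proof (rule additive_eq_0_if[OF additive_diff[OF f h] _ y])
    fix j assume j: "j < Suc m"
    have "[?h (x j) = (\<Sum>i<Suc m. f (x i) * (if i = j then 1 else 0))] (mod int p)"
      by (rule cong_sum, rule cong_scalar_left, rule phi_dual) (use j in auto)
    also have "(\<Sum>i<Suc m. f (x i) * (if i = j then 1 else 0)) = f (x j)"
      using j by (simp add: sum.delta' if_distrib[of "\<lambda>t. _ * t"] cong: if_cong del: sum.lessThan_Suc)
    finally have "[?h (x j) = f (x j)] (mod int p)" .
    then show "[f (x j) - ?h (x j) = 0] (mod int p)"
      using cong_diff[OF cong_refl, of "?h (x j)" "f (x j)" "int p" "f (x j)"] by simp
  qed
  then show ?thesis by (simp add: cong_iff_dvd_diff)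
qed

lemma frattini_iff_dual:
  "y \<in> frattini G \<longleftrightarrow> y \<in> carrier G \<and> (\<forall>i<Suc m. [phi (e i) y = 0] (mod int p))"
proof
  assume "y \<in> frattini G" then show "y \<in> carrier G \<and> (\<forall>i<Suc m. [phi (e i) y = 0] (mod int p))"
    using additive_phi e_E by (simp add: frattini_iff)
next
  assume y: "y \<in> carrier G \<and> (\<forall>i<Suc m. [phi (e i) y = 0] (mod int p))"
  have "[f y = 0] (mod int p)" if f: "additive f" for f
  proof -
    have "[f y = (\<Sum>i<Suc m. f (x i) * phi (e i) y)] (mod int p)" using additive_expansion[OF f] y by blast
    also have "[(\<Sum>i<Suc m. f (x i) * phi (e i) y) = (\<Sum>i<Suc m. 0)] (mod int p)"
      by (rule cong_sum) (use y mult_cong_0_iff in auto)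
    finally show ?thesis by simp
  qed
  then show "y \<in> frattini G" using y by (simp add: frattini_iff)
qed

lemma E_centralizes_frattini:
  assumes "g \<in> E" "h \<in> frattini G" shows "g \<otimes> h = h \<otimes> g"
  using phi_commute_iff[OF assms(1)] assms(2) additive_phi[OF assms(1)] by (simp add: frattini_iff)

text \<open>The elements \<open>e i\<close> of order \<open>p\<close> are in the Frattini subgroup, which \<open>E\<close> centralizes. So \<open>e m\<close> commutes with
all of them and with itself, and this characterizes elements of the Frattini subgroup.\<close>

lemma e_frattini: "i < Suc m \<Longrightarrow> e i \<in> frattini G"
proof -
  have small: "e i \<in> frattini G" if "i < m" for i
    using E_order_p_in_frattini[OF e_E e_pow] that by simp
  have "e m \<in> frattini G" unfolding frattini_iff_dual
  proof (intro conjI allI impI)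
    show "e m \<in> carrier G" using E_carrier by simp
    fix i assume i: "i < Suc m"
    show "[phi (e i) (e m) = 0] (mod int p)"
    proof (cases "i = m")
      case True then show ?thesis using phi_self by simp
    next
      case False
      then have "e m \<otimes> e i = e i \<otimes> e m" using E_centralizes_frattini[of "e m" "e i"] small i by simp
      then show ?thesis using phi_commute_iff[of "e i" "e m"] i E_carrier by simp
    qed
  qed
  then show "i < Suc m \<Longrightarrow> e i \<in> frattini G" using small by (auto simp: less_Suc_eq)
qed

lemma e_commute: "i < Suc m \<Longrightarrow> j < Suc m \<Longrightarrow> e i \<otimes> e j = e j \<otimes> e i"
  using E_centralizes_frattini e_frattini by simp

lemma centralizer_frattini_subset:
  assumes "g \<in> carrier G" "\<And>h. h \<in> frattini G \<Longrightarrow> g \<otimes> h = h \<otimes> g" shows "g \<in> frattini G"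
  unfolding frattini_iff_dual
proof (intro conjI allI impI)
  fix i assume i: "i < Suc m"
  have "e i \<otimes> g = g \<otimes> e i" using assms(2)[OF e_frattini[OF i]] by simp
  then show "[phi (e i) g = 0] (mod int p)" using phi_commute_iff[of "e i" g] i assms(1) by simp
qed (rule assms(1))

lemma E_subset_frattini: "E \<subseteq> frattini G"
  using centralizer_frattini_subset E_centralizes_frattini E_carrier by blast

section \<open>Counting in the third centre\<close>

lemma card_E_ge: "p ^ Suc m * card (center G) \<le> card E"
proof -
  have "p ^ card {..<Suc m} * card (center G) \<le> card E"
  proof (rule card_ge_of_separating_subgroups[where H = "\<lambda>j. {g \<in> carrier G. \<forall>h\<in>{x j}. g \<otimes> h = h \<otimes> g}" and g = e])
    show "subgroup {g \<in> carrier G. \<forall>h\<in>{x k}. g \<otimes> h = h \<otimes> g} G" if "k \<in> {..<Suc m}" for k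
      by (rule centralizer_subgroup) (use that in auto)
    show "center G \<subseteq> {g \<in> carrier G. \<forall>h\<in>{x k}. g \<otimes> h = h \<otimes> g}" if "k \<in> {..<Suc m}" for k
      using that by (auto simp: mem_center_iff)
    show "e k \<notin> {g \<in> carrier G. \<forall>h\<in>{x k}. g \<otimes> h = h \<otimes> g}" if "k \<in> {..<Suc m}" for k
    proof
      assume "e k \<in> {g \<in> carrier G. \<forall>h\<in>{x k}. g \<otimes> h = h \<otimes> g}"
      then have "[phi (e k) (x k) = 0] (mod int p)" using that phi_commute_iff[of "e k" "x k"] by simp
      moreover have "[phi (e k) (x k) = 1] (mod int p)" using phi_dual[of k k] that by simp
      ultimately have "[(0::int) = 1] (mod int p)" using cong_sym cong_trans by blast
      then show False using p_gt_1 by (simp add: cong_def)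
    qed
    show "e k \<in> {g \<in> carrier G. \<forall>h\<in>{x l}. g \<otimes> h = h \<otimes> g}" if "k \<in> {..<Suc m}" "l \<in> {..<Suc m}" "k \<noteq> l" for k l
      using that phi_commute_iff[of "e k" "x l"] phi_dual[of k l] E_carrier[of "e k"] by simp
  qed (use E_subgroup center_subgroup center_subset_E in auto)
  then show ?thesis by simp
qed

text \<open>The elements whose conjugations are given by derivations that vanish on the Frattini subgroup and have
values of order \<open>p\<close> in \<open>E\<close>.\<close>

definition C :: "'a set" where
  "C = {g \<in> carrier G. (\<forall>h\<in>frattini G. g \<otimes> h = h \<otimes> g) \<and>
     (\<forall>y\<in>carrier G. commutator g y \<in> E \<and> commutator g y [^] p = \<one>)}"

lemma CD:
  assumes "g \<in> C"
  shows "g \<in> carrier G" "\<And>h. h \<in> frattini G \<Longrightarrow> g \<otimes> h = h \<otimes> g"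
    "\<And>y. y \<in> carrier G \<Longrightarrow> commutator g y \<in> E" "\<And>y. y \<in> carrier G \<Longrightarrow> commutator g y [^] p = \<one>"
  using assms by (auto simp: C_def)

lemma C_subset_frattini: "C \<subseteq> frattini G"
proof
  fix g assume "g \<in> C" then show "g \<in> frattini G" using centralizer_frattini_subset[of g] CD by metis
qed

lemma commutator_C_mult:
  assumes "g \<in> C" "h \<in> C" "y \<in> carrier G"
  shows "commutator (g \<otimes> h) y = commutator h y \<otimes> commutator g y"
proof -
  have gh: "g \<in> carrier G" "h \<in> carrier G" using assms CD by auto
  have "g \<otimes> commutator h y = commutator h y \<otimes> g"
    using CD(2)[OF assms(1)] commutator_in_frattini[OF gh(2) assms(3)] by blast
  then have "g \<otimes> commutator h y \<otimes> inv g = commutator h y"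
    using gh assms(3) by (simp add: m_assoc)
  then show ?thesis using commutator_mult_left[OF gh assms(3)] by simp
qed

lemma C_subgroup: "subgroup C G"
proof (rule finite_p_subgroupI)
  show "C \<subseteq> carrier G" using CD(1) by blast
  show "\<one> \<in> C" using subgroup.one_closed[OF E_subgroup] frattini_subset
    by (auto simp: C_def commutator_def)
  fix g h assume gh: "g \<in> C" "h \<in> C"
  have "g \<otimes> h \<in> {a \<in> carrier G. \<forall>b\<in>frattini G. a \<otimes> b = b \<otimes> a}"
    by (rule subgroup.m_closed[OF centralizer_subgroup[OF frattini_subset]]) (use gh CD in auto)
  moreover have "commutator (g \<otimes> h) y \<in> E \<and> commutator (g \<otimes> h) y [^] p = \<one>" if y: "y \<in> carrier G" for y
    using commutator_C_mult[OF gh y] CD(3,4)[OF gh(1) y] CD(3,4)[OF gh(2) y] E_mult E_pow_p_mult by simp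
  ultimately show "g \<otimes> h \<in> C" by (simp add: C_def)
qed

lemma E_subset_C: "E \<subseteq> C"
proof
  fix g assume g: "g \<in> E"
  then show "g \<in> C" unfolding C_def
    using E_carrier E_centralizes_frattini commutator_E zpow_E zpow_pow_p by simp
qed

lemma C_pow_p_central:
  assumes "g \<in> C" shows "g [^] p \<in> center G"
proof -
  have g: "g \<in> carrier G" using CD(1)[OF assms] .
  have "g [^] p \<otimes> y = y \<otimes> g [^] p" if y: "y \<in> carrier G" for y
  proof -
    let ?a = "commutator g y"
    have a: "?a \<in> carrier G" using g y by simp
    have ga: "?a [^] (n::nat) \<otimes> g = g \<otimes> ?a [^] n" for n
      using group_commutes_pow[of ?a g n] CD(2)[OF assms commutator_in_frattini[OF g y]] g a by simp
    have gy: "g \<otimes> y = ?a \<otimes> y \<otimes> g" using commutator_mult[OF g y] by simp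
    have "g [^] (n::nat) \<otimes> y = ?a [^] n \<otimes> y \<otimes> g [^] n" for n
    proof (induction n)
      case 0 then show ?case using y by simp
    next
      case (Suc n)
      have "g [^] Suc n \<otimes> y = g \<otimes> (g [^] n \<otimes> y)" unfolding nat_pow_Suc2[OF g] using g y by (simp add: m_assoc)
      also have "\<dots> = (g \<otimes> ?a [^] n) \<otimes> y \<otimes> g [^] n" unfolding Suc using g y a by (simp add: m_assoc)
      also have "\<dots> = ?a [^] n \<otimes> (g \<otimes> y) \<otimes> g [^] n" unfolding ga[symmetric] using g y a by (simp add: m_assoc)
      also have "\<dots> = ?a [^] n \<otimes> ?a \<otimes> y \<otimes> (g \<otimes> g [^] n)" unfolding gy using g y a by (simp add: m_assoc)
      also have "\<dots> = ?a [^] Suc n \<otimes> y \<otimes> g [^] Suc n" unfolding nat_pow_Suc2[OF g] by simp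
      finally show ?case .
    qed
    from this[of p] show ?thesis using CD(4)[OF assms y] y by simp
  qed
  then show ?thesis using g by (simp add: mem_center_iff)
qed

text \<open>A symmetric bilinear form \<open>b\<close> gives a derivation by taking \<open>s y = - b(y,y)/2\<close>. For the form
  \<open>b(y,w) = phi (e i) y * phi (e j) w + phi (e j) y * phi (e i) w\<close> no division is needed, and the
  commutators of the resulting \<open>g\<close> with the generators tell \<open>g\<close> apart from those for other pairs.\<close>

lemma exists_symmetric_element:
  assumes i: "i < m" and j: "j < m"
  shows "\<exists>g\<in>C. \<forall>k<m. \<forall>l<m. commutator g (x l) \<otimes> x k = x k \<otimes> commutator g (x l) \<longleftrightarrow>
    [(if i = k \<and> j = l then 1 else 0) + (if j = k \<and> i = l then 1 else 0) = 0] (mod int p)"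
proof -
  let ?fi = "phi (e i)" and ?fj = "phi (e j)"
  let ?al = "\<lambda>k y. (if k = i then ?fj y else 0) + (if k = j then ?fi y else 0)"
  let ?s = "\<lambda>y. - (?fi y * ?fj y)"
  have fi: "additive ?fi" and fj: "additive ?fj" using additive_phi i j by simp_all
  have al: "additive (?al k)" for k
  proof -
    have "?al k = (\<lambda>y. (if k = i then 1 else 0) * ?fj y + (if k = j then 1 else 0) * ?fi y)" by auto
    then show ?thesis using additive_add[OF additive_scale[OF fj] additive_scale[OF fi]] by simp
  qed
  have sum: "(\<Sum>k<m. ?al k y * f k) = ?fj y * f i + ?fi y * f j" for y f
    using i j by (simp add: distrib_right sum.distrib if_distrib[of "\<lambda>t. t * _"] sum.delta cong: if_cong)
  have fr: "[?al k y = 0] (mod int p)" if "y \<in> frattini G" for k y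
    using al[of k] that unfolding frattini_iff by blast
  have frs: "[?s y = 0] (mod int p)" if "y \<in> frattini G" for y
    using fi that mult_cong_0_iff[of "?fi y" "?fj y"] by (simp add: frattini_iff cong_0_iff)
  have "\<exists>g\<in>carrier G. \<forall>y\<in>carrier G. commutator g y = eprod e m (\<lambda>k. ?al k y) \<otimes> z [^] ?s y"
  proof (rule derivation_is_inner)
    show "[?s (y \<otimes> w) = ?s y + ?s w - (\<Sum>k<m. ?al k w * phi (e k) y)] (mod int p)"
      if "y \<in> carrier G" "w \<in> carrier G" for y w
    proof -
      have "[?fi (y \<otimes> w) * ?fj (y \<otimes> w) = (?fi y + ?fi w) * (?fj y + ?fj w)] (mod int p)"
        using additiveD[OF fi that] additiveD[OF fj that] by (rule cong_mult)
      then have "[?s (y \<otimes> w) = - ((?fi y + ?fi w) * (?fj y + ?fj w))] (mod int p)"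
        by (simp add: cong_minus_minus_iff)
      then show ?thesis unfolding sum by (simp add: algebra_simps)
    qed
    show "[?s y = 0] (mod int p)" if "y \<in> N" for y using that N_subset_frattini frs by blast
    show "[?s z = 0] (mod int p)" by (rule frs[OF z_in_frattini])
  qed (use e_commute e_pow al fr e_frattini in auto)
  then obtain g where g: "g \<in> carrier G"
    "\<And>y. y \<in> carrier G \<Longrightarrow> commutator g y = eprod e m (\<lambda>k. ?al k y) \<otimes> z [^] ?s y" by blast
  have eE: "eprod e m a \<in> E" for a by (rule eprod_E) simp
  have "g \<in> C" unfolding C_def
  proof (intro CollectI conjI ballI g(1))
    fix y assume y: "y \<in> carrier G"
    show "commutator g y \<in> E" unfolding g(2)[OF y] using eE zpow_E by (rule E_mult)
    show "commutator g y [^] p = \<one>" unfolding g(2)[OF y] E_pow_p_mult[OF eE zpow_E] zpow_pow_p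
      using eprod_pow_p[of m e] e_pow by simp
  next
    fix h assume h: "h \<in> frattini G"
    then have hc: "h \<in> carrier G" using frattini_subset by blast
    have "eprod e m (\<lambda>k. ?al k h) = \<one>" by (rule eprod_eq_one) (use e_pow fr[OF h] in auto)
    then have "commutator g h = \<one>" using g(2)[OF hc] frs[OF h] zpow_eq_one_iff by simp
    then show "g \<otimes> h = h \<otimes> g" using commutator_eq_one_iff[OF g(1) hc] by simp
  qed
  moreover have "commutator g (x l) \<otimes> x k = x k \<otimes> commutator g (x l) \<longleftrightarrow>
    [(if i = k \<and> j = l then 1 else 0) + (if j = k \<and> i = l then 1 else 0) = 0] (mod int p)"
    if k: "k < m" and l: "l < m" for k l
  proof -
    have xl: "x l \<in> carrier G" and xk: "x k \<in> carrier G" using k l by simp_all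
    let ?u = "eprod e m (\<lambda>t. ?al t (x l))"
    let ?r' = "(if i = k \<and> j = l then 1 else 0) + (if j = k \<and> i = l then 1 else (0::int))"
    let ?r = "(if j = l then 1 else 0) * (if i = k then 1 else 0) + (if i = l then 1 else 0) * (if j = k then 1 else (0::int))"
    have "[phi ?u (x k) = (\<Sum>t<m. ?al t (x l) * phi (e t) (x k))] (mod int p)"
      by (rule phi_eprod) (use xk in auto)
    then have "[phi ?u (x k) = ?fj (x l) * ?fi (x k) + ?fi (x l) * ?fj (x k)] (mod int p)"
      by (simp only: sum)
    moreover have "[?fj (x l) * ?fi (x k) + ?fi (x l) * ?fj (x k) = ?r] (mod int p)"
      by (rule cong_add; rule cong_mult; rule phi_dual) (use i j k l in auto)
    ultimately have "[phi ?u (x k) = ?r] (mod int p)" by (rule cong_trans)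
    moreover have "[phi (z [^] ?s (x l)) (x k) = 0] (mod int p)"
      using phi_center[OF zpow_E] zpow_central xk by blast
    ultimately have "[phi ?u (x k) + phi (z [^] ?s (x l)) (x k) = ?r + 0] (mod int p)" by (rule cong_add)
    with phi_mult[OF eE zpow_E xk] have "[phi (?u \<otimes> z [^] ?s (x l)) (x k) = ?r + 0] (mod int p)"
      by (rule cong_trans)
    then have "[phi (commutator g (x l)) (x k) = ?r] (mod int p)" unfolding g(2)[OF xl] add_0_right .
    moreover have "?r = ?r'"
      by (cases "j = l"; cases "i = k"; cases "i = l"; cases "j = k") simp_all
    ultimately have "[phi (commutator g (x l)) (x k) = ?r'] (mod int p)" by (simp only:)
    moreover have "commutator g (x l) \<in> E" unfolding g(2)[OF xl] using eE zpow_E by (rule E_mult)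
    ultimately show ?thesis using phi_commute_iff[of "commutator g (x l)" "x k"] xk
      by (simp only: cong_def)
  qed
  ultimately show ?thesis by blast
qed

lemma card_pairs: "card {(i, j). i \<le> j \<and> j < (n::nat)} = (n + 1) choose 2"
proof -
  have "{(i, j). i \<le> j \<and> j < n} = (\<lambda>(j, i). (i, j)) ` (SIGMA j:{..<n}. {..j})" by auto
  moreover have "inj_on (\<lambda>(j, i). (i, j)) (SIGMA j:{..<n}. {..j})" by (auto simp: inj_on_def)
  ultimately have "card {(i, j). i \<le> j \<and> j < n} = (\<Sum>j<n. Suc j)" by (simp add: card_image)
  also have "\<dots> = (n + 1) choose 2" by (induction n) (auto simp: numeral_2_eq_2)
  finally show ?thesis .
qed

lemma card_C_ge_E: "p ^ ((m + 1) choose 2) * card E \<le> card C"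
proof -
  let ?J = "{(i, j). i \<le> j \<and> j < m}"
  let ?H = "\<lambda>(k, l). {g \<in> C. commutator g (x l) \<otimes> x k = x k \<otimes> commutator g (x l)}"
  let ?val = "\<lambda>i j k l. (if i = k \<and> j = l then 1 else 0) + (if j = k \<and> i = l then 1 else (0::int))"
  let ?P = "\<lambda>q g. g \<in> C \<and> (\<forall>k<m. \<forall>l<m. commutator g (x l) \<otimes> x k = x k \<otimes> commutator g (x l) \<longleftrightarrow>
    [?val (fst q) (snd q) k l = 0] (mod int p))"
  have "\<forall>q\<in>?J. \<exists>g. ?P q g"
  proof
    fix q assume "q \<in> ?J"
    then have "fst q < m" "snd q < m" by auto
    from exists_symmetric_element[OF this] show "\<exists>g. ?P q g" by blast
  qed
  from bchoice[OF this] obtain g where gP: "\<forall>q\<in>?J. ?P q (g q)" ..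
  have g: "\<And>q. q \<in> ?J \<Longrightarrow> g q \<in> C"
    "\<And>q k l. q \<in> ?J \<Longrightarrow> k < m \<Longrightarrow> l < m \<Longrightarrow> commutator (g q) (x l) \<otimes> x k = x k \<otimes> commutator (g q) (x l) \<longleftrightarrow>
    [?val (fst q) (snd q) k l = 0] (mod int p)"
    using gP by blast+
  have "p ^ card ?J * card E \<le> card C"
  proof (rule card_ge_of_separating_subgroups[where H = ?H and g = g])
    show "finite ?J" by (rule finite_subset[of _ "{..<m} \<times> {..<m}"]) auto
    show "subgroup (?H q) G" if "q \<in> ?J" for q
    proof -
      obtain k l where q: "q = (k, l)" by (cases q)
      have kl: "k < m" "l < m" using that q by auto
      have xk: "x k \<in> carrier G" and xl: "x l \<in> carrier G" using kl by simp_all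
      have "subgroup {g \<in> C. commutator g (x l) \<otimes> x k = x k \<otimes> commutator g (x l)} G"
      proof (rule finite_p_subgroupI)
        show "{g \<in> C. commutator g (x l) \<otimes> x k = x k \<otimes> commutator g (x l)} \<subseteq> carrier G" using CD(1) by blast
        show "\<one> \<in> {g \<in> C. commutator g (x l) \<otimes> x k = x k \<otimes> commutator g (x l)}"
          using subgroup.one_closed[OF C_subgroup] xk xl by (simp add: commutator_def)
        fix a b assume ab: "a \<in> {g \<in> C. commutator g (x l) \<otimes> x k = x k \<otimes> commutator g (x l)}"
          "b \<in> {g \<in> C. commutator g (x l) \<otimes> x k = x k \<otimes> commutator g (x l)}"
        have c: "commutator a (x l) \<in> carrier G" "commutator b (x l) \<in> carrier G" using ab CD(1) xl by auto
        have "commutator (a \<otimes> b) (x l) \<otimes> x k = commutator b (x l) \<otimes> (commutator a (x l) \<otimes> x k)"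
          using commutator_C_mult[of a b "x l"] ab xl xk c by (simp add: m_assoc)
        also have "\<dots> = commutator b (x l) \<otimes> (x k \<otimes> commutator a (x l))" using ab by simp
        also have "\<dots> = (commutator b (x l) \<otimes> x k) \<otimes> commutator a (x l)" using c xk by (simp add: m_assoc)
        also have "\<dots> = (x k \<otimes> commutator b (x l)) \<otimes> commutator a (x l)" using ab by simp
        also have "\<dots> = x k \<otimes> commutator (a \<otimes> b) (x l)"
          using commutator_C_mult[of a b "x l"] ab xl xk c by (simp add: m_assoc)
        finally show "a \<otimes> b \<in> {g \<in> C. commutator g (x l) \<otimes> x k = x k \<otimes> commutator g (x l)}"
          using ab subgroup.m_closed[OF C_subgroup] by simp
      qed
      then show ?thesis using q by simp
    qed
    show "E \<subseteq> ?H q" if "q \<in> ?J" for q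
      using that E_subset_C commutator_E zpow_comm by auto
    show "g q \<in> C" if "q \<in> ?J" for q using g(1)[OF that] .
    show "g q \<notin> ?H q" if "q \<in> ?J" for q
    proof -
      obtain k l where q: "q = (k, l)" by (cases q)
      have kl: "k < m" "l < m" using that q by auto
      have "\<not> [?val k l k l = 0] (mod int p)" using p_gt_1 two_not_cong_0 by (auto simp: cong_def)
      then show ?thesis using g(2)[OF that kl] q by simp
    qed
    show "g q \<in> ?H r" if "q \<in> ?J" "r \<in> ?J" "q \<noteq> r" for q r
    proof -
      obtain i j k l where q: "q = (i, j)" "r = (k, l)" by (cases q, cases r)
      have kl: "k < m" "l < m" using that q by auto
      have "?val i j k l = 0" using that q by auto
      then have "[?val (fst q) (snd q) k l = 0] (mod int p)" using q by simp
      then show ?thesis using g(2)[OF that(1) kl] g(1)[OF that(1)] q by simp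
    qed
  qed (use E_subset_C E_subgroup C_subgroup in auto)
  then show ?thesis unfolding card_pairs .
qed

lemma card_C_ge: "p ^ ((Suc m + 1) choose 2) * card (center G) \<le> card C"
proof -
  have c: "(Suc m + 1) choose 2 = ((m + 1) choose 2) + Suc m" by (simp add: numeral_2_eq_2)
  have "p ^ ((m + 1) choose 2) * (p ^ Suc m * card (center G)) \<le> p ^ ((m + 1) choose 2) * card E"
    using card_E_ge by (rule mult_le_mono2)
  also have "\<dots> \<le> card C" by (rule card_C_ge_E)
  finally show ?thesis unfolding c by (simp add: power_add mult_ac)
qed

lemma C_subset_upper_central: "C \<subseteq> upper_central G 3"
proof
  fix g assume g: "g \<in> C"
  have "commutator (commutator (commutator g y) w) v = \<one>" if "y \<in> carrier G" "w \<in> carrier G" "v \<in> carrier G" for y w v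
    unfolding commutator_E[OF CD(3)[OF g that(1)] that(2)] using that zpow_comm by (simp add: commutator_eq_one_iff)
  then show "g \<in> upper_central G 3" using CD(1)[OF g]
    by (simp add: numeral_3_eq_3 upper_central_Suc_iff del: upper_central.simps(2))
qed

end

section \<open>Quadratic functionals on groups of class two and exponent \<open>p\<close>\<close>

context p_group
begin

text \<open>A subgroup that is maximal among those avoiding \<open>c\<close> has index \<open>p\<close>.\<close>

lemma exists_additive_nonzero:
  assumes comm: "comm_group G" and ex: "\<And>x. x \<in> carrier G \<Longrightarrow> x [^] p = \<one>"
    and c: "c \<in> carrier G" "c \<noteq> \<one>"
  obtains f where "additive f" "[f c = 1] (mod int p)"
proof -
  interpret cg: comm_group G by (rule comm)
  have nrm: "L \<lhd> G" if "subgroup L G" for L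
    using cg.subgroup_imp_normal[OF that] .
  define S where "S = {L. subgroup L G \<and> c \<notin> L}"
  have fin: "finite S" unfolding S_def by (rule finite_subset[of _ "Pow (carrier G)"]) (auto dest: subgroup.subset)
  have "{\<one>} \<in> S" using c(2) triv_subgroup by (simp add: S_def)
  then obtain M where M: "M \<in> S" "\<And>L. L \<in> S \<Longrightarrow> M \<subseteq> L \<Longrightarrow> M = L"
    using finite_has_maximal[OF fin] by blast
  have sM: "subgroup M G" and cM: "c \<notin> M" using M(1) by (auto simp: S_def)
  have nM: "u \<otimes> h \<otimes> inv u \<in> M" if "u \<in> carrier G" "h \<in> M" for u h
    using commutator_conj_closed[OF nrm[OF sM] that] .
  have cp: "c [^] p \<in> M" using ex[OF c(1)] subgroup.one_closed[OF sM] by simp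
  have ac: "subgroup (adjoin M c) G" "M \<subseteq> adjoin M c" "c \<in> adjoin M c"
    using adjoin_subgroup[OF sM c(1) nM[OF c(1)]] by auto
  have "y \<in> adjoin M c" if y: "y \<in> carrier G" for y
  proof (cases "y \<in> M")
    case True then show ?thesis using ac(2) by blast
  next
    case False
    have ay: "subgroup (adjoin M y) G" "M \<subseteq> adjoin M y" "y \<in> adjoin M y"
      using adjoin_subgroup[OF sM y nM[OF y]] by auto
    have "c \<in> adjoin M y"
    proof (rule ccontr)
      assume "c \<notin> adjoin M y"
      then have "adjoin M y \<in> S" using ay(1) by (simp add: S_def)
      then show False using M(2)[OF _ ay(2)] ay(3) False by blast
    qed
    then obtain h n where h: "h \<in> M" "c = h \<otimes> y [^] (n::nat)" by (auto simp: adjoin_def)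
    have hc: "h \<in> carrier G" using h(1) subgroup.mem_carrier[OF sM] by blast
    have yp: "y [^] p \<in> M" using ex[OF y] subgroup.one_closed[OF sM] by simp
    have "\<not> p dvd n"
    proof
      assume "p dvd n"
      then have "y [^] n \<in> M" using pow_mem_iff[OF sM y False yp] by simp
      then show False using cM h subgroup.m_closed[OF sM] by simp
    qed
    then have "\<not> [int n = 0] (mod int p)" by (simp add: cong_0_iff)
    then obtain k where k: "[int k * int n = 1] (mod int p)" using exists_inverse_mod_p by blast
    have "ord y dvd p" using pow_eq_id[OF y, of p] ex[OF y] by simp
    then have "int (ord y) dvd int p" by simp
    moreover have "int p dvd 1 - int k * int n"
      using cong_sym[OF k] by (simp only: cong_iff_dvd_diff)
    ultimately have "int (ord y) dvd 1 - int k * int n" by (rule dvd_trans)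
    then have "y [^] (int k * int n) = y [^] (1::int)" using int_pow_eq[OF y] by simp
    then have "y [^] (n * k) = y" using y by (simp add: int_pow_int mult.commute flip: of_nat_mult)
    then have yk: "y = (y [^] n) [^] k" using y by (simp add: nat_pow_pow)
    have "y [^] n = inv h \<otimes> c" using h(2) hc y by simp
    then have "y [^] n \<in> adjoin M c"
      using subgroup.m_closed[OF ac(1) subgroup.m_inv_closed[OF ac(1)] ac(3), of h] h(1) ac(2) by auto
    then have "(y [^] n) [^] k \<in> adjoin M c" using subgroup_int_pow_closed[OF ac(1), of _ "int k"] by (simp add: int_pow_int)
    then show ?thesis using yk by simp
  qed
  then have "adjoin M c = carrier G" using subgroup.subset[OF ac(1)] by blast
  from additive_of_index_p[OF nrm[OF sM] c(1) cM cp this] show thesis using that by metis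
qed

end

context odd_p_group
begin

text \<open>The inverse of \<open>2\<close> modulo \<open>p\<close>.\<close>

definition half :: nat where "half = (p + 1) div 2"

lemma two_half: "2 * half = p + 1"
  using odd_p by (simp add: half_def)

text \<open>The Baer correction \<open>x \<otimes> y \<otimes> [y,x]^(1/2)\<close> turns a group of class two and odd exponent \<open>p\<close> into an elementary
  abelian one on the same set; a functional for the corrected product has the stated defect for the
  original one.\<close>

lemma exists_baer_functional:
  assumes ex: "\<And>x. x \<in> carrier G \<Longrightarrow> x [^] p = \<one>"
    and cl2: "\<And>x y w. x \<in> carrier G \<Longrightarrow> y \<in> carrier G \<Longrightarrow> w \<in> carrier G \<Longrightarrow> commutator (commutator x y) w = \<one>"
    and c: "c \<in> carrier G" "c \<noteq> \<one>"
  obtains f where "[f \<one> = 0] (mod int p)" "\<not> [f c = 0] (mod int p)"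
    "\<And>x y. x \<in> carrier G \<Longrightarrow> y \<in> carrier G \<Longrightarrow>
      [f (x \<otimes> y) = f x + f y + int half * f (commutator x y)] (mod int p)"
proof -
  define b where "b = (\<lambda>x y. commutator y x [^] half)"
  have comc: "commutator x y \<otimes> w = w \<otimes> commutator x y"
    if "x \<in> carrier G" "y \<in> carrier G" "w \<in> carrier G" for x y w
    using cl2[OF that] that commutator_eq_one_iff by simp
  have bc [simp]: "b x y \<in> carrier G" if "x \<in> carrier G" "y \<in> carrier G" for x y using that by (simp add: b_def)
  have bz: "b x y \<otimes> w = w \<otimes> b x y" if "x \<in> carrier G" "y \<in> carrier G" "w \<in> carrier G" for x y w
    unfolding b_def using group_commutes_pow[OF comc] that by simp
  have com_l: "commutator (x \<otimes> y) w = commutator x w \<otimes> commutator y w"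
    if "x \<in> carrier G" "y \<in> carrier G" "w \<in> carrier G" for x y w
  proof -
    have "x \<otimes> commutator y w \<otimes> inv x = commutator y w"
      using comc[OF that(2,3,1), symmetric] that by (simp add: m_assoc)
    then have "commutator (x \<otimes> y) w = commutator y w \<otimes> commutator x w"
      using commutator_mult_left[OF that] by simp
    also have "\<dots> = commutator x w \<otimes> commutator y w"
      by (rule comc) (use that in auto)
    finally show ?thesis .
  qed
  have com_r: "commutator w (x \<otimes> y) = commutator w x \<otimes> commutator w y"
    if "x \<in> carrier G" "y \<in> carrier G" "w \<in> carrier G" for x y w
  proof -
    have "x \<otimes> commutator w y \<otimes> inv x = commutator w y"
      using comc[OF that(3,2,1), symmetric] that by (simp add: m_assoc)
    then show ?thesis using commutator_mult_right[OF that] by simp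
  qed
  have b_l: "b (x \<otimes> y) w = b x w \<otimes> b y w" and b_r: "b w (x \<otimes> y) = b w x \<otimes> b w y"
    if "x \<in> carrier G" "y \<in> carrier G" "w \<in> carrier G" for x y w
    unfolding b_def using com_l[OF that] com_r[OF that] pow_mult_distrib[OF comc] that by simp_all
  have b_com: "b u w = \<one>" if "u \<in> carrier G" "w \<in> carrier G" "u \<otimes> w = w \<otimes> u" for u w
    using that commutator_eq_one_iff[of w u] by (simp add: b_def)
  have b_bl: "b (b x y) w = \<one>" and b_br: "b w (b x y) = \<one>"
    if "x \<in> carrier G" "y \<in> carrier G" "w \<in> carrier G" for x y w
    using b_com bz that by simp_all
  define B where "B = \<lparr>carrier = carrier G, monoid.mult = (\<lambda>x y. x \<otimes> y \<otimes> b x y), one = \<one>\<rparr>"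
  have Bs [simp]: "carrier B = carrier G" "x \<otimes>\<^bsub>B\<^esub> y = x \<otimes> y \<otimes> b x y" "\<one>\<^bsub>B\<^esub> = \<one>" for x y
    by (simp_all add: B_def)
  have assoc: "(x \<otimes> y \<otimes> b x y) \<otimes> w \<otimes> b (x \<otimes> y \<otimes> b x y) w = x \<otimes> (y \<otimes> w \<otimes> b y w) \<otimes> b x (y \<otimes> w \<otimes> b y w)"
    if xyw: "x \<in> carrier G" "y \<in> carrier G" "w \<in> carrier G" for x y w
  proof -
    have "(x \<otimes> y \<otimes> b x y) \<otimes> w \<otimes> b (x \<otimes> y \<otimes> b x y) w = x \<otimes> y \<otimes> (b x y \<otimes> w) \<otimes> (b x w \<otimes> b y w)"
      using xyw by (simp add: b_l b_bl m_assoc)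
    also have "\<dots> = x \<otimes> y \<otimes> (w \<otimes> b x y) \<otimes> (b x w \<otimes> b y w)" using bz[OF xyw] by simp
    also have "\<dots> = x \<otimes> y \<otimes> w \<otimes> ((b x y \<otimes> b x w) \<otimes> b y w)" using xyw by (simp add: m_assoc)
    also have "(b x y \<otimes> b x w) \<otimes> b y w = b y w \<otimes> (b x y \<otimes> b x w)" using bz[of y w "b x y \<otimes> b x w"] xyw by simp
    also have "x \<otimes> y \<otimes> w \<otimes> (b y w \<otimes> (b x y \<otimes> b x w)) = x \<otimes> (y \<otimes> w \<otimes> b y w) \<otimes> b x (y \<otimes> w \<otimes> b y w)"
      using xyw by (simp add: b_r b_br m_assoc)
    finally show ?thesis .
  qed
  have b_one: "b \<one> x = \<one>" "b x \<one> = \<one>" if "x \<in> carrier G" for x using b_com that by simp_all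
  have Bgroup: "group B"
  proof (rule groupI)
    fix x y w assume "x \<in> carrier B" "y \<in> carrier B" "w \<in> carrier B"
    then show "x \<otimes>\<^bsub>B\<^esub> y \<otimes>\<^bsub>B\<^esub> w = x \<otimes>\<^bsub>B\<^esub> (y \<otimes>\<^bsub>B\<^esub> w)" using assoc by simp
  next
    fix x assume x: "x \<in> carrier B"
    have "b (inv x) x = \<one>" by (rule b_com) (use x in auto)
    then show "\<exists>y\<in>carrier B. y \<otimes>\<^bsub>B\<^esub> x = \<one>\<^bsub>B\<^esub>" using x by (intro bexI[of _ "inv x"]) auto
  qed (use b_one in auto)
  have "comm_group B"
  proof (rule group.group_comm_groupI[OF Bgroup])
    fix x y assume "x \<in> carrier B" "y \<in> carrier B"
    then have xy: "x \<in> carrier G" "y \<in> carrier G" by auto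
    let ?u = "commutator x y"
    have u: "?u \<in> carrier G" using xy by simp
    have "?u [^] half \<otimes> ?u [^] half = ?u [^] (p + 1)" using u by (simp only: nat_pow_mult mult_2[symmetric] two_half)
    also have "\<dots> = ?u" using ex[OF u] u by simp
    finally have h2: "?u [^] half \<otimes> ?u [^] half = ?u" .
    have inv: "commutator y x = inv ?u" using inv_commutator[OF xy] by simp
    have "x \<otimes> y \<otimes> b x y = ?u \<otimes> (y \<otimes> x) \<otimes> inv (?u [^] half)"
      unfolding b_def inv using commutator_mult[OF xy] xy u by (simp add: nat_pow_inv m_assoc)
    also have "\<dots> = (y \<otimes> x) \<otimes> (?u \<otimes> inv (?u [^] half))" using comc[OF xy, of "y \<otimes> x"] xy u by (simp add: m_assoc)
    also have "?u \<otimes> inv (?u [^] half) = ?u [^] half" using h2 u by (metis inv_solve_right nat_pow_closed)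
    finally show "x \<otimes>\<^bsub>B\<^esub> y = y \<otimes>\<^bsub>B\<^esub> x" by (simp add: b_def)
  qed
  have Bp: "p_group B p"
    using Bgroup p_group prime_p by (simp add: p_group_def p_group_axioms_def finite_p_group_def order_def)
  interpret B: p_group B p by (rule Bp)
  have Bpow: "x [^]\<^bsub>B\<^esub> (n::nat) = x [^] n" if x: "x \<in> carrier G" for x n
  proof (induction n)
    case (Suc n)
    have "b (x [^] n) x = \<one>" by (rule b_com) (use x in \<open>simp_all add: group_commutes_pow\<close>)
    then show ?case using Suc x by simp
  qed simp
  obtain f where f: "B.additive f" "[f c = 1] (mod int p)"
    using B.exists_additive_nonzero[OF \<open>comm_group B\<close>, of c] ex c Bpow by auto
  have fB: "[f (x \<otimes> y \<otimes> b x y) = f x + f y] (mod int p)" if "x \<in> carrier G" "y \<in> carrier G" for x y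
    using B.additiveD[OF f(1), of x y] that by simp
  show thesis
  proof (rule that[of f])
    show "[f \<one> = 0] (mod int p)" using B.additive_one[OF f(1)] by simp
    show "\<not> [f c = 0] (mod int p)" using f(2) p_gt_1 by (auto simp: cong_def)
    fix x y assume xy: "x \<in> carrier G" "y \<in> carrier G"
    let ?d = "commutator x y [^] half"
    have d: "?d = b y x" by (simp add: b_def)
    have "b x y \<otimes> b y x = \<one>" unfolding b_def
      using inv_commutator[OF xy] xy by (simp add: nat_pow_inv flip: inv_commutator[OF xy])
    then have e: "x \<otimes> y \<otimes> b x y \<otimes> b y x = x \<otimes> y" using xy by (simp add: m_assoc)
    have "b (x \<otimes> y \<otimes> b x y) (b y x) = \<one>" by (rule b_br) (use xy in auto)
    then have "[f (x \<otimes> y) = f (x \<otimes> y \<otimes> b x y) + f (b y x)] (mod int p)"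
      using fB[of "x \<otimes> y \<otimes> b x y" "b y x"] e xy by simp
    also have "[f (x \<otimes> y \<otimes> b x y) + f (b y x) = (f x + f y) + int half * f (commutator x y)] (mod int p)"
    proof (rule cong_add[OF fB[OF xy]])
      show "[f (b y x) = int half * f (commutator x y)] (mod int p)"
        using B.additive_pow[OF f(1), of "commutator x y" half] Bpow[of "commutator x y" half] xy d by simp
    qed
    finally show "[f (x \<otimes> y) = f x + f y + int half * f (commutator x y)] (mod int p)" .
  qed
qed

lemma exists_quadratic_functional:
  assumes c: "c \<in> carrier G" "c \<notin> N"
  obtains f where "\<And>y. y \<in> N \<Longrightarrow> [f y = 0] (mod int p)" "\<not> [f c = 0] (mod int p)"
    "\<And>x y. x \<in> carrier G \<Longrightarrow> y \<in> carrier G \<Longrightarrow>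
      [f (x \<otimes> y) = f x + f y + int half * f (commutator x y)] (mod int p)"
proof -
  interpret n: normal N G by (rule N_normal)
  interpret Q0: p_group "G Mod N" p by (rule FactGroup_p_group[OF N_normal])
  interpret Q: odd_p_group "G Mod N" p by unfold_locales (rule odd_p)
  interpret h: group_hom G "G Mod N" "\<lambda>a. N #> a" by unfold_locales (rule n.r_coset_hom_Mod)
  have Qc: "\<exists>x\<in>carrier G. S = N #> x" if "S \<in> carrier (G Mod N)" for S using that by (auto simp: carrier_FactGroup)
  have q1: "S [^]\<^bsub>G Mod N\<^esub> p = \<one>\<^bsub>G Mod N\<^esub>" if "S \<in> carrier (G Mod N)" for S
  proof -
    from Qc[OF that] obtain x where x: "x \<in> carrier G" "S = N #> x" ..
    have "S [^]\<^bsub>G Mod N\<^esub> p = N #> (x [^] p)" unfolding x(2) by (rule h.hom_nat_pow[OF x(1), symmetric])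
    also have "\<dots> = N" using n.rcoset_eq_self_iff[OF nat_pow_closed[OF x(1)]] pow_in_N[OF x(1)] by blast
    finally show ?thesis by simp
  qed
  have q2: "Q0.commutator (Q0.commutator S T) U = \<one>\<^bsub>G Mod N\<^esub>"
    if STU: "S \<in> carrier (G Mod N)" "T \<in> carrier (G Mod N)" "U \<in> carrier (G Mod N)" for S T U
  proof -
    obtain x y w where x: "x \<in> carrier G" "S = N #> x" and y: "y \<in> carrier G" "T = N #> y"
      and w: "w \<in> carrier G" "U = N #> w" using Qc[OF STU(1)] Qc[OF STU(2)] Qc[OF STU(3)] by blast
    have "Q0.commutator (Q0.commutator S T) U = N #> commutator (commutator x y) w"
      unfolding x(2) y(2) w(2) n.rcoset_commutator[OF x(1) y(1)]
      by (rule n.rcoset_commutator[OF commutator_closed[OF x(1) y(1)] w(1)])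
    also have "\<dots> = N"
      using n.rcoset_eq_self_iff[OF commutator_closed[OF commutator_closed[OF x(1) y(1)] w(1)]]
        commutator_in_N[OF x(1) y(1) w(1)] by blast
    finally show ?thesis by simp
  qed
  have "N #> c \<in> carrier (G Mod N)" "N #> c \<noteq> \<one>\<^bsub>G Mod N\<^esub>"
    using c h.hom_closed n.rcoset_eq_self_iff[OF c(1)] by simp_all
  from Q.exists_baer_functional[OF q1 q2 this] obtain f where f: "[f \<one>\<^bsub>G Mod N\<^esub> = 0] (mod int p)"
    "\<not> [f (N #> c) = 0] (mod int p)"
    "\<And>S T. S \<in> carrier (G Mod N) \<Longrightarrow> T \<in> carrier (G Mod N) \<Longrightarrow>
      [f (S \<otimes>\<^bsub>G Mod N\<^esub> T) = f S + f T + int Q.half * f (Q0.commutator S T)] (mod int p)" by blast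
  show thesis
  proof (rule that[of "\<lambda>y. f (N #> y)"])
    show "[f (N #> y) = 0] (mod int p)" if "y \<in> N" for y
      using f(1) n.rcoset_eq_self_iff[of y] that subgroup.mem_carrier[OF N_subgroup that] by simp
    show "\<not> [f (N #> c) = 0] (mod int p)" by (rule f(2))
    show "[f (N #> (x \<otimes> y)) = f (N #> x) + f (N #> y) + int half * f (N #> commutator x y)] (mod int p)"
      if "x \<in> carrier G" "y \<in> carrier G" for x y
      using f(3)[OF h.hom_closed[OF that(1)] h.hom_closed[OF that(2)]]
      unfolding h.hom_mult[OF that, symmetric] n.rcoset_commutator[OF that]
      by (simp add: half_def Q.half_def)
  qed
qed

end

section \<open>The lower \<open>p\<close>-series when the derived subgroup lies in \<open>N\<close>\<close>

context group
begin

text \<open>This is \<open>|A| |B| = |A B| |A \<inter> B|\<close> with the product set bounded by \<open>K\<close>.\<close>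

lemma card_subgroups_le:
  assumes "subgroup A G" "subgroup B G" "subgroup K G" "finite K" "A \<subseteq> K" "B \<subseteq> K"
  shows "card A * card B \<le> card K * card (A \<inter> B)"
proof -
  have Ac: "a \<in> carrier G" if "a \<in> A" for a using that subgroup.mem_carrier[OF assms(1)] by blast
  have Bc: "b \<in> carrier G" if "b \<in> B" for b using that subgroup.mem_carrier[OF assms(2)] by blast
  define R where "R = (\<lambda>y. SOME a. a \<in> A \<and> (\<exists>b\<in>B. y = a \<otimes> b))"
  have R: "R (a \<otimes> b) \<in> A \<and> (\<exists>b'\<in>B. a \<otimes> b = R (a \<otimes> b) \<otimes> b')" if "a \<in> A" "b \<in> B" for a b
    unfolding R_def by (rule someI_ex) (use that in blast)
  let ?f = "\<lambda>(a, b). (a \<otimes> b, inv (R (a \<otimes> b)) \<otimes> a)"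
  have "card (A \<times> B) \<le> card (K \<times> (A \<inter> B))"
  proof (rule card_inj_on_le)
    show "inj_on ?f (A \<times> B)"
    proof (rule inj_onI, clarify)
      fix a b a' b' assume ab: "a \<in> A" "b \<in> B" "a' \<in> A" "b' \<in> B" and 1: "a \<otimes> b = a' \<otimes> b'"
        and 2: "inv (R (a \<otimes> b)) \<otimes> a = inv (R (a' \<otimes> b')) \<otimes> a'"
      have "a = a'" using 2 R[OF ab(3,4)] ab Ac unfolding 1 by (simp add: l_cancel)
      then show "a = a' \<and> b = b'" using 1 ab Ac Bc by simp
    qed
    show "?f ` (A \<times> B) \<subseteq> K \<times> (A \<inter> B)"
    proof clarify
      fix a b assume ab: "a \<in> A" "b \<in> B"
      obtain b' where b': "b' \<in> B" "a \<otimes> b = R (a \<otimes> b) \<otimes> b'" and RA: "R (a \<otimes> b) \<in> A" using R[OF ab] by blast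
      have c: "R (a \<otimes> b) \<in> carrier G" "a \<in> carrier G" "b \<in> carrier G" "b' \<in> carrier G"
        using RA ab b'(1) Ac Bc by auto
      have "a = R (a \<otimes> b) \<otimes> b' \<otimes> inv b" using b'(2) c by (metis inv_solve_right m_closed)
      then have "inv (R (a \<otimes> b)) \<otimes> a = inv (R (a \<otimes> b)) \<otimes> (R (a \<otimes> b) \<otimes> b' \<otimes> inv b)" by simp
      also have "\<dots> = b' \<otimes> inv b" using c by (simp add: m_assoc)
      finally have e: "inv (R (a \<otimes> b)) \<otimes> a = b' \<otimes> inv b" .
      have "a \<otimes> b \<in> K" using ab assms(5,6) subgroup.m_closed[OF assms(3)] by blast
      moreover have "inv (R (a \<otimes> b)) \<otimes> a \<in> A"
        using subgroup.m_closed[OF assms(1) subgroup.m_inv_closed[OF assms(1) RA] ab(1)] .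
      moreover have "b' \<otimes> inv b \<in> B"
        using subgroup.m_closed[OF assms(2) b'(1) subgroup.m_inv_closed[OF assms(2) ab(2)]] .
      ultimately show "a \<otimes> b \<in> K \<and> inv (R (a \<otimes> b)) \<otimes> a \<in> A \<inter> B" using e by simp
    qed
    show "finite (K \<times> (A \<inter> B))" using assms(4,5) finite_subset by blast
  qed
  then show ?thesis by (simp add: card_cartesian_product)
qed

end

context odd_p_group
begin

text \<open>The lower exponent-\<open>p\<close> central series, numbered from \<open>0\<close>.\<close>

primrec lower_p :: "nat \<Rightarrow> 'a set" where
  "lower_p 0 = carrier G"
| "lower_p (Suc i) = generate G ({x [^] p | x. x \<in> lower_p i} \<union> {commutator x y | x y. x \<in> lower_p i \<and> y \<in> carrier G})"

declare lower_p.simps(2) [simp del]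

lemma lower_p_normal: "lower_p i \<lhd> G"
proof (induction i)
  case 0 then show ?case by (simp add: normal_self)
next
  case (Suc i)
  have c: "x \<in> carrier G" if "x \<in> lower_p i" for x
    using that normal_imp_subgroup[OF Suc] subgroup.mem_carrier by metis
  show ?case unfolding lower_p.simps
  proof (rule normal_generateI)
    show "{x [^] p | x. x \<in> lower_p i} \<union> {commutator x y | x y. x \<in> lower_p i \<and> y \<in> carrier G} \<subseteq> carrier G"
      using c by auto
    fix h g assume h: "h \<in> {x [^] p | x. x \<in> lower_p i} \<union> {commutator x y | x y. x \<in> lower_p i \<and> y \<in> carrier G}"
      and g: "g \<in> carrier G"
    from h show "g \<otimes> h \<otimes> inv g \<in> {x [^] p | x. x \<in> lower_p i} \<union> {commutator x y | x y. x \<in> lower_p i \<and> y \<in> carrier G}"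
    proof
      assume "h \<in> {x [^] p | x. x \<in> lower_p i}"
      then obtain x where x: "x \<in> lower_p i" "h = x [^] p" by blast
      have "g \<otimes> h \<otimes> inv g = (g \<otimes> x \<otimes> inv g) [^] p" unfolding x(2) by (rule conj_nat_pow[OF g c[OF x(1)]])
      moreover have "g \<otimes> x \<otimes> inv g \<in> lower_p i" by (rule commutator_conj_closed[OF Suc g x(1)])
      ultimately show ?thesis by blast
    next
      assume "h \<in> {commutator x y | x y. x \<in> lower_p i \<and> y \<in> carrier G}"
      then obtain x y where x: "x \<in> lower_p i" "y \<in> carrier G" "h = commutator x y" by blast
      have "g \<otimes> h \<otimes> inv g = commutator (g \<otimes> x \<otimes> inv g) (g \<otimes> y \<otimes> inv g)"
        unfolding x(3) by (rule conj_commutator[OF g c[OF x(1)] x(2)])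
      moreover have "g \<otimes> x \<otimes> inv g \<in> lower_p i" by (rule commutator_conj_closed[OF Suc g x(1)])
      moreover have "g \<otimes> y \<otimes> inv g \<in> carrier G" using g x(2) by simp
      ultimately show ?thesis by blast
    qed
  qed
qed

lemma lower_p_subgroup: "subgroup (lower_p i) G"
  using lower_p_normal by (simp add: normal_imp_subgroup)

lemma lower_p_carrier: "x \<in> lower_p i \<Longrightarrow> x \<in> carrier G"
  using subgroup.mem_carrier[OF lower_p_subgroup] by blast

lemma lower_p_pow: "x \<in> lower_p i \<Longrightarrow> x [^] p \<in> lower_p (Suc i)"
  unfolding lower_p.simps by (rule generate.incl) blast

lemma lower_p_commutator: "x \<in> lower_p i \<Longrightarrow> y \<in> carrier G \<Longrightarrow> commutator x y \<in> lower_p (Suc i)"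
  unfolding lower_p.simps by (rule generate.incl) blast

lemma lower_p_incl:
  assumes "subgroup L G" "\<And>x. x \<in> lower_p i \<Longrightarrow> x [^] p \<in> L"
    "\<And>x y. x \<in> lower_p i \<Longrightarrow> y \<in> carrier G \<Longrightarrow> commutator x y \<in> L"
  shows "lower_p (Suc i) \<subseteq> L"
  unfolding lower_p.simps by (rule generate_subgroup_incl[OF _ assms(1)]) (use assms(2,3) in blast)

lemma lower_p_antimono_Suc: "lower_p (Suc i) \<subseteq> lower_p i"
proof (rule lower_p_incl[OF lower_p_subgroup])
  show "x [^] p \<in> lower_p i" if "x \<in> lower_p i" for x
    using subgroup_int_pow_closed[OF lower_p_subgroup that, of "int p"] by (simp add: int_pow_int)
  show "commutator x y \<in> lower_p i" if "x \<in> lower_p i" "y \<in> carrier G" for x y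
    by (rule normal_commutator_closed(2)[OF lower_p_normal that(2,1)])
qed

text \<open>With \<open>S = lower_p k\<close> this shows that the lower \<open>p\<close>-series descends strictly until it is trivial: the
generators of the next term all lie in \<open>K\<close>.\<close>

lemma exists_normal_below:
  assumes S: "S \<lhd> G" "S \<noteq> {\<one>}"
  obtains K where "subgroup K G" "K \<subset> S" "\<And>x. x \<in> S \<Longrightarrow> x [^] p \<in> K"
    "\<And>x y. x \<in> S \<Longrightarrow> y \<in> carrier G \<Longrightarrow> commutator x y \<in> K"
proof -
  have sS: "subgroup S G" using S(1) by (simp add: normal_imp_subgroup)
  define D where "D = {K. K \<lhd> G \<and> K \<subset> S}"
  have fin: "finite D" unfolding D_def by (rule finite_subset[of _ "Pow S"]) (use finite_subgroup[OF sS] in auto)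
  have "{\<one>} \<in> D" unfolding D_def using one_is_normal subgroup.one_closed[OF sS] S(2) by blast
  then obtain K where K: "K \<in> D" "\<And>L. L \<in> D \<Longrightarrow> K \<subseteq> L \<Longrightarrow> K = L"
    using finite_has_maximal[OF fin] by blast
  have Kn: "K \<lhd> G" and KS: "K \<subset> S" using K(1) by (auto simp: D_def)
  have sK: "subgroup K G" using Kn by (simp add: normal_imp_subgroup)
  have Kc: "k \<in> carrier G" if "k \<in> K" for k using subgroup.mem_carrier[OF sK that] .
  obtain x where x: "x \<in> S" "x \<notin> K" "x [^] p \<in> K" "\<And>y. y \<in> carrier G \<Longrightarrow> commutator x y \<in> K"
    using central_step[OF Kn S(1) KS] by metis
  have xc: "x \<in> carrier G" using subgroup.mem_carrier[OF sS x(1)] .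
  have nx: "x \<otimes> h \<otimes> inv x \<in> K" if "h \<in> K" for h using commutator_conj_closed[OF Kn xc that] .
  note ad = adjoin_subgroup[OF sK xc nx]
  have powS: "x [^] (n::nat) \<in> S" for n
    using subgroup_int_pow_closed[OF sS x(1), of "int n"] by (simp add: int_pow_int)
  have "adjoin K x \<subseteq> S"
  proof
    fix y assume "y \<in> adjoin K x"
    then obtain k n where "k \<in> K" "y = k \<otimes> x [^] (n::nat)" by (auto simp: adjoin_def)
    then show "y \<in> S" using subgroup.m_closed[OF sS _ powS, of k n] KS by blast
  qed
  moreover have "adjoin K x \<noteq> K" using ad x(2) by blast
  ultimately have aS: "adjoin K x = S"
    using K(2)[OF _ ad(2)] adjoin_normal[OF Kn xc x(4)] unfolding D_def by blast
  have xn: "commutator (x [^] (n::nat)) y \<in> K" if y: "y \<in> carrier G" for n y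
  proof (induction n)
    case 0 then show ?case using y subgroup.one_closed[OF sK] by (simp add: commutator_def)
  next
    case (Suc n)
    have "x [^] n \<otimes> commutator x y \<otimes> inv (x [^] n) \<in> K"
      by (rule commutator_conj_closed[OF Kn]) (use xc x(4) y in auto)
    then show ?case using commutator_mult_left[of "x [^] n" x y] Suc subgroup.m_closed[OF sK] xc y by simp
  qed
  show thesis
  proof (rule that[OF sK KS])
    fix s assume "s \<in> S"
    then obtain k n where k: "k \<in> K" "s = k \<otimes> x [^] (n::nat)" unfolding aS[symmetric] adjoin_def by blast
    have xnc: "x [^] n \<in> carrier G" using xc by simp
    have c: "commutator (x [^] n) k \<in> K" using xn Kc k(1) by blast
    have cK: "commutator c y \<in> K" if "c \<in> K" "y \<in> carrier G" for c y
      by (rule normal_commutator_closed(2)[OF Kn that(2,1)])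
    have Kp: "h [^] j \<in> K" if "h \<in> K" for h and j :: nat
      using subgroup_int_pow_closed[OF sK that, of "int j"] by (simp add: int_pow_int)
    let ?q = "k [^] p \<otimes> (x [^] n) [^] p"
    have "(x [^] n) [^] p = (x [^] p) [^] n" using xc by (simp add: nat_pow_pow mult.commute)
    then have q: "?q \<in> K" using subgroup.m_closed[OF sK Kp[OF k(1)]] Kp[OF x(3)] by simp
    have r: "s [^] p \<otimes> inv ?q \<in> K" unfolding k(2)
      by (rule pow_mult_mod[OF Kn Kc[OF k(1)] xnc cK[OF c Kc[OF k(1)]] cK[OF c xnc] Kp[OF c]])
    have sc: "s \<in> carrier G" using k Kc xc by simp
    have "s [^] p = (s [^] p \<otimes> inv ?q) \<otimes> ?q" using sc q Kc by (simp add: m_assoc)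
    then show "s [^] p \<in> K" using subgroup.m_closed[OF sK r q] by simp
    fix y assume y: "y \<in> carrier G"
    have "k \<otimes> commutator (x [^] n) y \<otimes> inv k \<in> K" by (rule commutator_conj_closed[OF Kn Kc[OF k(1)] xn[OF y]])
    then show "commutator s y \<in> K" unfolding k(2) commutator_mult_left[OF Kc[OF k(1)] xnc y]
      by (rule subgroup.m_closed[OF sK _ cK[OF k(1) y]])
  qed
qed

lemma lower_p_terminates: "\<exists>k. lower_p k = {\<one>}"
proof (rule ccontr)
  assume ne: "\<not> ?thesis"
  have "card (lower_p k) + k \<le> card (carrier G)" for k
  proof (induction k)
    case (Suc k)
    have "lower_p k \<noteq> {\<one>}" using ne by blast
    then obtain K where K: "subgroup K G" "K \<subset> lower_p k" "\<And>x. x \<in> lower_p k \<Longrightarrow> x [^] p \<in> K"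
      "\<And>x y. x \<in> lower_p k \<Longrightarrow> y \<in> carrier G \<Longrightarrow> commutator x y \<in> K"
      using exists_normal_below[OF lower_p_normal] by metis
    have "lower_p (Suc k) \<subseteq> K" by (rule lower_p_incl[OF K(1,3,4)])
    then have "lower_p (Suc k) \<subset> lower_p k" using K(2) by blast
    then have "card (lower_p (Suc k)) < card (lower_p k)"
      using finite_subgroup[OF lower_p_subgroup] psubset_card_mono by blast
    then show ?case using Suc by linarith
  qed simp
  from this[of "Suc (card (carrier G))"] show False by simp
qed

lemma lower_p_pow_mult:
  assumes "a \<in> lower_p i" "b \<in> lower_p i"
  shows "(a \<otimes> b) [^] p \<otimes> inv (a [^] p \<otimes> b [^] p) \<in> lower_p (Suc (Suc i))"
proof -
  have a: "a \<in> carrier G" and b: "b \<in> carrier G" using assms lower_p_carrier by blast+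
  have c: "commutator b a \<in> lower_p (Suc i)" using lower_p_commutator[OF assms(2) a] .
  show ?thesis
    by (rule pow_mult_mod[OF lower_p_normal a b lower_p_commutator[OF c a] lower_p_commutator[OF c b] lower_p_pow[OF c]])
qed

lemma power_image_subgroup:
  "subgroup {y \<in> lower_p (Suc i). \<exists>x\<in>lower_p i. y \<otimes> inv (x [^] p) \<in> lower_p (Suc (Suc i))} G"
proof (rule finite_p_subgroupI)
  let ?H = "lower_p (Suc (Suc i))"
  let ?T = "{y \<in> lower_p (Suc i). \<exists>x\<in>lower_p i. y \<otimes> inv (x [^] p) \<in> ?H}"
  have sH: "subgroup ?H G" by (rule lower_p_subgroup)
  show "?T \<subseteq> carrier G" using lower_p_carrier by blast
  show "\<one> \<in> ?T"
    using subgroup.one_closed[OF lower_p_subgroup] by (auto intro!: bexI[of _ \<one>])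
  fix y w assume "y \<in> ?T" "w \<in> ?T"
  then obtain u v where y: "y \<in> lower_p (Suc i)" "u \<in> lower_p i" "y \<otimes> inv (u [^] p) \<in> ?H"
    and w: "w \<in> lower_p (Suc i)" "v \<in> lower_p i" "w \<otimes> inv (v [^] p) \<in> ?H" by blast
  have c: "y \<in> carrier G" "u \<in> carrier G" "w \<in> carrier G" "v \<in> carrier G" using y w lower_p_carrier by blast+
  let ?q = "(u \<otimes> v) [^] p \<otimes> inv (u [^] p \<otimes> v [^] p)"
  have q: "inv ?q \<in> ?H" by (rule subgroup.m_inv_closed[OF sH lower_p_pow_mult[OF y(2) w(2)]])
  have t: "u [^] p \<otimes> (w \<otimes> inv (v [^] p)) \<otimes> inv (u [^] p) \<in> ?H"
    by (rule commutator_conj_closed[OF lower_p_normal _ w(3)]) (use c in simp)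
  have "(y \<otimes> inv (u [^] p)) \<otimes> (u [^] p \<otimes> (w \<otimes> inv (v [^] p)) \<otimes> inv (u [^] p)) \<otimes> inv ?q \<in> ?H"
    by (rule subgroup.m_closed[OF sH subgroup.m_closed[OF sH y(3) t] q])
  moreover have "(y \<otimes> inv (u [^] p)) \<otimes> (u [^] p \<otimes> (w \<otimes> inv (v [^] p)) \<otimes> inv (u [^] p)) \<otimes> inv ?q
      = (y \<otimes> w) \<otimes> inv ((u \<otimes> v) [^] p)"
    using c by (simp add: m_assoc inv_mult_group)
  ultimately have "(y \<otimes> w) \<otimes> inv ((u \<otimes> v) [^] p) \<in> ?H" by simp
  moreover have "u \<otimes> v \<in> lower_p i" using subgroup.m_closed[OF lower_p_subgroup y(2) w(2)] .
  moreover have "y \<otimes> w \<in> lower_p (Suc i)" using subgroup.m_closed[OF lower_p_subgroup y(1) w(1)] .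
  ultimately show "y \<otimes> w \<in> ?T" by blast
qed

text \<open>The power map from each factor of the lower \<open>p\<close>-series to the next one is onto. In the first step this is the
  hypothesis. After that it is enough to treat a commutator \<open>[u^p, y]\<close>, and
  \<open>y u^p y^-1 = ([y,u] u)^p\<close> is congruent to \<open>[y,u]^p u^p\<close>.\<close>

lemma power_map_onto:
  assumes pw: "\<And>x y. x \<in> carrier G \<Longrightarrow> y \<in> carrier G \<Longrightarrow> commutator x y \<in> N"
  shows "y \<in> lower_p (Suc i) \<Longrightarrow> \<exists>x\<in>lower_p i. y \<otimes> inv (x [^] p) \<in> lower_p (Suc (Suc i))"
proof (induction i arbitrary: y)
  case (0 y)
  let ?T = "{y \<in> lower_p (Suc 0). \<exists>x\<in>lower_p 0. y \<otimes> inv (x [^] p) \<in> lower_p (Suc (Suc 0))}"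
  have sT: "subgroup ?T G" by (rule power_image_subgroup)
  have pT: "x [^] p \<in> ?T" if "x \<in> lower_p 0" for x
  proof -
    have "x [^] p \<otimes> inv (x [^] p) \<in> lower_p (Suc (Suc 0))"
      using subgroup.one_closed[OF lower_p_subgroup] lower_p_carrier[OF that] by simp
    then show ?thesis using lower_p_pow[OF that] that by blast
  qed
  have dT: "c \<in> ?T" if "c \<in> lower_p (Suc (Suc 0))" for c
  proof -
    have "c \<otimes> inv (\<one> [^] p) \<in> lower_p (Suc (Suc 0))" using that lower_p_carrier[OF that] by simp
    then show ?thesis using that lower_p_antimono_Suc subgroup.one_closed[OF lower_p_subgroup] by blast
  qed
  have "N \<subseteq> ?T"
  proof (rule N_subset_if[OF sT])
    show "x [^] p \<in> ?T" if "x \<in> carrier G" for x using pT that by simp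
    fix c w assume c: "c \<in> commutator_subgroup G (carrier G) (carrier G)" and w: "w \<in> carrier G"
    have "commutator_subgroup G (carrier G) (carrier G) \<subseteq> lower_p (Suc 0)"
      by (rule commutator_subgroup_incl[OF lower_p_subgroup]) (rule lower_p_commutator, simp_all)
    then show "commutator c w \<in> ?T" using dT lower_p_commutator[OF _ w] c by blast
  qed
  then have "lower_p (Suc 0) \<subseteq> ?T"
    by (intro lower_p_incl[OF sT] pT) (use pw in auto)
  then show ?case using 0 by blast
next
  case (Suc j y)
  let ?H = "lower_p (Suc (Suc (Suc j)))"
  let ?T = "{y \<in> lower_p (Suc (Suc j)). \<exists>x\<in>lower_p (Suc j). y \<otimes> inv (x [^] p) \<in> ?H}"
  have sT: "subgroup ?T G" by (rule power_image_subgroup)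
  have pT: "x [^] p \<in> ?T" if "x \<in> lower_p (Suc j)" for x
  proof -
    have "x [^] p \<otimes> inv (x [^] p) \<in> ?H"
      using subgroup.one_closed[OF lower_p_subgroup] lower_p_carrier[OF that] by simp
    then show ?thesis using lower_p_pow[OF that] that by blast
  qed
  have dT: "c \<in> ?T" if "c \<in> ?H" for c
  proof -
    have "c \<otimes> inv (\<one> [^] p) \<in> ?H" using that lower_p_carrier[OF that] by simp
    then show ?thesis using that lower_p_antimono_Suc subgroup.one_closed[OF lower_p_subgroup] by blast
  qed
  have "commutator x y \<in> ?T" if xj: "x \<in> lower_p (Suc j)" and y: "y \<in> carrier G" for x y
  proof -
    obtain u where u: "u \<in> lower_p j" "x \<otimes> inv (u [^] p) \<in> lower_p (Suc (Suc j))" using Suc.IH[OF xj] by blast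
    define w where "w = x \<otimes> inv (u [^] p)"
    define c where "c = commutator y u"
    have uc: "u \<in> carrier G" and xc: "x \<in> carrier G" and wH: "w \<in> lower_p (Suc (Suc j))" and wc: "w \<in> carrier G"
      using u xj lower_p_carrier unfolding w_def by blast+
    have xw: "x = w \<otimes> u [^] p" unfolding w_def using xc uc by (simp add: m_assoc)
    have cj: "c \<in> lower_p (Suc j)"
      using subgroup.m_inv_closed[OF lower_p_subgroup lower_p_commutator[OF u(1) y]] inv_commutator[OF uc y]
      unfolding c_def by simp
    have cc: "c \<in> carrier G" using lower_p_carrier[OF cj] .
    have uc': "commutator u c \<in> lower_p (Suc (Suc j))"
      using subgroup.m_inv_closed[OF lower_p_subgroup lower_p_commutator[OF cj uc]] inv_commutator[OF cc uc] by simp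
    define h where "h = (c \<otimes> u) [^] p \<otimes> inv (c [^] p \<otimes> u [^] p)"
    have hH: "h \<in> ?H" unfolding h_def
      by (rule pow_mult_mod[OF lower_p_normal cc uc lower_p_commutator[OF uc' cc] lower_p_commutator[OF uc' uc] lower_p_pow[OF uc']])
    have hc: "h \<in> carrier G" using lower_p_carrier[OF hH] .
    have cup: "(c \<otimes> u) [^] p = h \<otimes> (c [^] p \<otimes> u [^] p)" unfolding h_def using cc uc by (simp add: m_assoc)
    define q where "q = (inv c) [^] p \<otimes> inv h"
    have "commutator (u [^] p) y = u [^] p \<otimes> inv (y \<otimes> u [^] p \<otimes> inv y)"
      using uc y by (simp add: commutator_def m_assoc inv_mult_group)
    also have "y \<otimes> u [^] p \<otimes> inv y = (c \<otimes> u) [^] p"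
      using conj_nat_pow[OF y uc] conj_eq_commutator_mult[OF y uc] unfolding c_def by simp
    also have "u [^] p \<otimes> inv ((c \<otimes> u) [^] p) = q" unfolding cup q_def
      using uc cc hc by (simp add: m_assoc inv_mult_group nat_pow_inv)
    finally have uq: "commutator (u [^] p) y = q" .
    have qT: "q \<in> ?T" unfolding q_def
      by (rule subgroup.m_closed[OF sT pT[OF subgroup.m_inv_closed[OF lower_p_subgroup cj]]
            dT[OF subgroup.m_inv_closed[OF lower_p_subgroup hH]]])
    have qc: "q \<in> carrier G" unfolding q_def using cc hc by simp
    have "commutator x y = commutator w q \<otimes> q \<otimes> commutator w y"
      unfolding xw using commutator_mult_left[OF wc _ y, of "u [^] p"] uc uq conj_eq_commutator_mult[OF wc qc] by simp
    moreover have "commutator w q \<otimes> q \<otimes> commutator w y \<in> ?T"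
      by (rule subgroup.m_closed[OF sT subgroup.m_closed[OF sT dT[OF lower_p_commutator[OF wH qc]] qT]
            dT[OF lower_p_commutator[OF wH y]]])
    ultimately show ?thesis by (simp only:)
  qed
  then have "lower_p (Suc (Suc j)) \<subseteq> ?T" by (intro lower_p_incl[OF sT] pT) auto
  then show ?case using Suc.prems by blast
qed

text \<open>Write \<open>P i\<close> for \<open>lower_p i\<close>. The power map from \<open>P i / P (i+1)\<close> onto \<open>P (i+1) / P (i+2)\<close> kills the image of
\<open>U \<inter> P i\<close>. Comparing orders, the bound \<open>|U \<inter> P i| \<le> |P i : P (i+1)|\<close> follows from the same bound for
\<open>i + 1\<close>.\<close>

lemma card_elementary_le:
  assumes pw: "\<And>x y. x \<in> carrier G \<Longrightarrow> y \<in> carrier G \<Longrightarrow> commutator x y \<in> N"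
    and U: "subgroup U G" "\<And>u. u \<in> U \<Longrightarrow> u [^] p = \<one>"
  shows "card U * card (lower_p (Suc 0)) \<le> card (carrier G)"
proof -
  obtain k where k: "lower_p k = {\<one>}" using lower_p_terminates by blast
  have pos: "0 < card (lower_p i)" for i
    using finite_subgroup[OF lower_p_subgroup] subgroup.one_closed[OF lower_p_subgroup] card_gt_0_iff by blast
  have step: "card (U \<inter> lower_p i) * card (lower_p (Suc i)) \<le> card (lower_p i)"
    if IH: "card (U \<inter> lower_p (Suc i)) * card (lower_p (Suc (Suc i))) \<le> card (lower_p (Suc i))" for i
  proof -
    let ?P = "lower_p i" and ?Q = "lower_p (Suc i)" and ?R = "lower_p (Suc (Suc i))"
    let ?K = "{x \<in> ?P. x [^] p \<in> ?R}"
    have sR: "subgroup ?R G" by (rule lower_p_subgroup)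
    have sK: "subgroup ?K G"
    proof (rule finite_p_subgroupI)
      show "?K \<subseteq> carrier G" using lower_p_carrier by blast
      show "\<one> \<in> ?K" using subgroup.one_closed[OF lower_p_subgroup] by simp
      fix a b assume ab: "a \<in> ?K" "b \<in> ?K"
      have c: "a \<in> carrier G" "b \<in> carrier G" using ab lower_p_carrier by blast+
      let ?q = "(a \<otimes> b) [^] p \<otimes> inv (a [^] p \<otimes> b [^] p)"
      have "?q \<in> ?R" using lower_p_pow_mult ab by blast
      moreover have "a [^] p \<otimes> b [^] p \<in> ?R" using ab subgroup.m_closed[OF sR] by blast
      ultimately have "?q \<otimes> (a [^] p \<otimes> b [^] p) \<in> ?R" using subgroup.m_closed[OF sR] by blast
      then have "(a \<otimes> b) [^] p \<in> ?R" using c by (simp add: m_assoc)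
      moreover have "a \<otimes> b \<in> ?P" using ab subgroup.m_closed[OF lower_p_subgroup] by blast
      ultimately show "a \<otimes> b \<in> ?K" by blast
    qed
    have QK: "?Q \<subseteq> ?K" using lower_p_antimono_Suc lower_p_pow by blast
    have UK: "U \<inter> ?P \<subseteq> ?K" using U(2) subgroup.one_closed[OF sR] by auto
    have "card (U \<inter> ?P) * card ?Q \<le> card ?K * card ((U \<inter> ?P) \<inter> ?Q)"
      by (rule card_subgroups_le[OF _ lower_p_subgroup sK finite_subgroup[OF sK] UK QK])
        (rule subgroups_Inter_pair[OF U(1) lower_p_subgroup])
    also have "(U \<inter> ?P) \<inter> ?Q = U \<inter> ?Q" using lower_p_antimono_Suc by blast
    finally have 1: "card (U \<inter> ?P) * card ?Q \<le> card ?K * card (U \<inter> ?Q)" .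
    \<comment> \<open>\<open>r\<close> selects a root modulo the next term; it replaces the isomorphism theorem for the power map\<close>
    define r where "r = (\<lambda>y. SOME x. x \<in> ?P \<and> y \<otimes> inv (x [^] p) \<in> ?R)"
    have r: "r y \<in> ?P \<and> y \<otimes> inv (r y [^] p) \<in> ?R" if "y \<in> ?Q" for y
      unfolding r_def by (rule someI_ex) (use power_map_onto[OF pw that] in blast)
    let ?f = "\<lambda>(a, y). (r y \<otimes> a, y \<otimes> inv ((r y \<otimes> a) [^] p))"
    have "card (?K \<times> ?Q) \<le> card (?P \<times> ?R)"
    proof (rule card_inj_on_le)
      show "inj_on ?f (?K \<times> ?Q)"
      proof (rule inj_onI, clarify)
        fix a y b w assume a: "a \<in> ?P" "y \<in> ?Q" "b \<in> ?P" "w \<in> ?Q"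
          and 1: "r y \<otimes> a = r w \<otimes> b" and 2: "y \<otimes> inv ((r y \<otimes> a) [^] p) = w \<otimes> inv ((r w \<otimes> b) [^] p)"
        have c: "a \<in> carrier G" "b \<in> carrier G" "y \<in> carrier G" "w \<in> carrier G" "r y \<in> carrier G" "r w \<in> carrier G"
          using a r[OF a(2)] r[OF a(4)] lower_p_carrier by blast+
        have t: "inv ((r w \<otimes> b) [^] p) \<in> carrier G" using c by simp
        have yw: "y = w" by (rule r_cancel[OF 2[unfolded 1] c(3,4) t])
        moreover have "a = b" by (rule l_cancel[OF 1[unfolded yw] c(1,2,6)])
        ultimately show "a = b \<and> y = w" by simp
      qed
      show "?f ` (?K \<times> ?Q) \<subseteq> ?P \<times> ?R"
      proof clarify
        fix a y assume a: "a \<in> ?P" "a [^] p \<in> ?R" and y: "y \<in> ?Q"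
        have c: "a \<in> carrier G" "y \<in> carrier G" "r y \<in> carrier G"
          using a y r[OF y] lower_p_carrier by blast+
        have ry: "r y \<in> ?P" "y \<otimes> inv (r y [^] p) \<in> ?R" using r[OF y] by auto
        let ?q = "(r y \<otimes> a) [^] p \<otimes> inv (r y [^] p \<otimes> a [^] p)"
        have q: "inv ?q \<in> ?R" by (rule subgroup.m_inv_closed[OF sR lower_p_pow_mult[OF ry(1) a(1)]])
        have t: "y \<otimes> inv (a [^] p) \<otimes> inv y \<in> ?R"
          by (rule commutator_conj_closed[OF lower_p_normal c(2) subgroup.m_inv_closed[OF sR a(2)]])
        have "(y \<otimes> inv (a [^] p) \<otimes> inv y) \<otimes> (y \<otimes> inv (r y [^] p)) \<otimes> inv ?q \<in> ?R"
          by (rule subgroup.m_closed[OF sR subgroup.m_closed[OF sR t ry(2)] q])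
        moreover have "(y \<otimes> inv (a [^] p) \<otimes> inv y) \<otimes> (y \<otimes> inv (r y [^] p)) \<otimes> inv ?q = y \<otimes> inv ((r y \<otimes> a) [^] p)"
          using c by (simp add: m_assoc inv_mult_group)
        moreover have "r y \<otimes> a \<in> ?P" by (rule subgroup.m_closed[OF lower_p_subgroup ry(1) a(1)])
        ultimately show "r y \<otimes> a \<in> ?P \<and> y \<otimes> inv ((r y \<otimes> a) [^] p) \<in> ?R" by simp
      qed
      show "finite (?P \<times> ?R)" using finite_subgroup[OF lower_p_subgroup] by blast
    qed
    then have 2: "card ?K * card ?Q \<le> card ?P * card ?R" by (simp add: card_cartesian_product)
    have "(card (U \<inter> ?P) * card ?Q) * (card ?Q * card ?R) \<le> (card ?K * card (U \<inter> ?Q)) * (card ?Q * card ?R)"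
      using 1 by (rule mult_le_mono1)
    also have "\<dots> = (card ?K * card ?Q) * (card (U \<inter> ?Q) * card ?R)" by (simp only: mult_ac)
    also have "\<dots> \<le> (card ?P * card ?R) * card ?Q" by (rule mult_le_mono[OF 2 IH])
    also have "\<dots> = card ?P * (card ?Q * card ?R)" by (simp only: mult_ac)
    finally show ?thesis using pos[of "Suc i"] pos[of "Suc (Suc i)"] by simp
  qed
  have "card (U \<inter> lower_p (k - j)) * card (lower_p (Suc (k - j))) \<le> card (lower_p (k - j))" if "j \<le> k" for j
    using that
  proof (induction j)
    case 0
    have "lower_p (Suc k) \<subseteq> {\<one>}" using lower_p_antimono_Suc[of k] k by simp
    then have "card (lower_p (Suc k)) \<le> 1" using card_mono[of "{\<one>}"] by fastforce
    moreover have "card (U \<inter> {\<one>}) \<le> 1" using card_mono[of "{\<one>}" "U \<inter> {\<one>}"] by simp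
    ultimately have "card (U \<inter> {\<one>}) * card (lower_p (Suc k)) \<le> 1 * 1" by (rule mult_le_mono[rotated])
    then show ?case using k by simp
  next
    case (Suc j)
    have "Suc (k - Suc j) = k - j" using Suc.prems by simp
    then show ?case using step[of "k - Suc j"] Suc by simp
  qed
  from this[of k] have "card (U \<inter> carrier G) * card (lower_p (Suc 0)) \<le> card (carrier G)"
    by simp
  moreover have "U \<inter> carrier G = U" using subgroup.subset[OF U(1)] by blast
  ultimately show ?thesis by simp
qed

lemma card_le_generators:
  fixes x :: "nat \<Rightarrow> 'a"
  assumes "\<And>i. i < d \<Longrightarrow> x i \<in> carrier G" "generate G (x ` {..<d}) = carrier G"
  shows "card (carrier G) \<le> p ^ d * card (lower_p (Suc 0))"
proof -
  let ?P = "lower_p (Suc 0)"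
  have "\<exists>H. subgroup H G \<and> ?P \<subseteq> H \<and> x ` {..<k} \<subseteq> H \<and> card H \<le> p ^ k * card ?P" if "k \<le> d" for k
    using that
  proof (induction k)
    case 0 then show ?case using lower_p_subgroup by (intro exI[of _ ?P]) auto
  next
    case (Suc k)
    then obtain H where H: "subgroup H G" "?P \<subseteq> H" "x ` {..<k} \<subseteq> H" "card H \<le> p ^ k * card ?P" by auto
    have xk: "x k \<in> carrier G" using assms(1) Suc.prems by simp
    have Hc: "h \<in> carrier G" if "h \<in> H" for h using subgroup.mem_carrier[OF H(1) that] .
    have nx: "x k \<otimes> h \<otimes> inv (x k) \<in> H" if "h \<in> H" for h
      using conj_eq_commutator_mult[OF xk Hc[OF that]] subgroup.m_closed[OF H(1) _ that]
        lower_p_commutator[of "x k" 0 h] xk Hc[OF that] H(2) by auto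
    have xp: "x k [^] p \<in> H" using lower_p_pow[of "x k" 0] xk H(2) by auto
    note ad = adjoin_subgroup[OF H(1) xk nx]
    have 1: "x ` {..<Suc k} \<subseteq> adjoin H (x k)"
      unfolding lessThan_Suc image_insert insert_subset by (rule conjI[OF ad(3) order_trans[OF H(3) ad(2)]])
    have "p * card H \<le> p ^ Suc k * card ?P" using mult_le_mono2[OF H(4), of p] by (simp add: mult.assoc)
    then have 2: "card (adjoin H (x k)) \<le> p ^ Suc k * card ?P"
      using card_adjoin_le[OF H(1) xk xp] by (rule order_trans[rotated])
    have 3: "?P \<subseteq> adjoin H (x k)" using H(2) ad(2) by (rule order_trans)
    show ?case by (rule exI[of _ "adjoin H (x k)"], intro conjI ad(1) 1 2 3)
  qed
  then obtain H where H: "subgroup H G" "x ` {..<d} \<subseteq> H" "card H \<le> p ^ d * card ?P" by blast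
  have "carrier G \<subseteq> H" using generate_subgroup_incl[OF H(2,1)] assms(2) by simp
  then have "H = carrier G" using subgroup.subset[OF H(1)] by blast
  then show ?thesis using H(3) by simp
qed

end

context dual_inner_p_group
begin

section \<open>The two conclusions\<close>

lemma one_le_m: "1 \<le> m"
proof (rule ccontr)
  assume "\<not> 1 \<le> m"
  then have "m = 0" by simp
  then have g: "generate G {x 0} = carrier G" using x_generate by (simp add: lessThan_Suc)
  have x0: "x 0 \<in> carrier G" by simp
  have "generate G {x 0} \<subseteq> {g \<in> carrier G. \<forall>h\<in>{x 0}. g \<otimes> h = h \<otimes> g}"
    by (rule generate_subgroup_incl[OF _ centralizer_subgroup]) (use x0 in auto)
  then have "x 0 \<in> center G" unfolding mem_center_iff g using x0 by auto
  then have "generate G {x 0} \<subseteq> center G" by (intro generate_subgroup_incl[OF _ center_subgroup]) auto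
  then have "commutator a b = \<one>" if "a \<in> carrier G" "b \<in> carrier G" for a b
    using that g commutator_eq_one_iff[OF that] mem_center_iff by blast
  then show False using exists_noncommuting by blast
qed

text \<open>Otherwise \<open>N\<close> would be trivial. Then all commutators would be central of order dividing \<open>p\<close>, so that \<open>E\<close> would be
the whole group and not contained in the Frattini subgroup.\<close>

lemma z_in_N: "z \<in> N"
proof (rule ccontr)
  assume "z \<notin> N"
  then have N1: "N = {\<one>}" using z_in_normal_subgroup[OF N_normal] by blast
  have "g \<in> E" if g: "g \<in> carrier G" for g
  proof (rule E_I[OF g])
    fix y assume y: "y \<in> carrier G"
    have "commutator g y \<in> center G"
      using commutator_in_N[OF g y] N1 g y by (simp add: mem_center_iff commutator_eq_one_iff)
    moreover have "commutator g y [^] p = \<one>" using pow_in_N[of "commutator g y"] N1 g y by simp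
    ultimately show "\<exists>k::int. commutator g y = z [^] k" by (rule z_root)
  qed
  then have "x 0 \<in> frattini G" using E_subset_frattini by auto
  then have "[phi (e 0) (x 0) = 0] (mod int p)" by (simp add: frattini_iff_dual)
  moreover have "[phi (e 0) (x 0) = 1] (mod int p)" using phi_dual[of 0 0] by simp
  ultimately have "[(0::int) = 1] (mod int p)" using cong_sym cong_trans by blast
  then show False using p_gt_1 by (simp add: cong_def)
qed

text \<open>Let \<open>f\<close> be the quadratic functional on \<open>G/N\<close> that is nonzero at \<open>c = [u,v]\<close>, and \<open>om y w = f [y,w]\<close> its
alternating form. Let \<open>B\<close> be the upper triangular part of \<open>om\<close> in the given generators, so that
\<open>om y w = B y w - B w y\<close>. Then \<open>s y = f y + B y y / 2\<close> has defect \<open>B\<close>. This form involves \<open>e i\<close> only for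
\<open>i < m\<close>, so \<open>derivation_is_inner\<close> applies. At \<open>c\<close> the derivation has the value \<open>z [^] f c\<close>.\<close>

lemma exists_third_center_element:
  assumes uv: "u \<in> carrier G" "v \<in> carrier G" "commutator u v \<notin> N"
  obtains g where "g \<in> carrier G" "\<And>h. h \<in> N \<Longrightarrow> g \<otimes> h = h \<otimes> g" "g \<in> upper_central G 3"
    "commutator g (commutator u v) \<noteq> \<one>"
proof -
  let ?c = "commutator u v"
  have c: "?c \<in> carrier G" using uv by simp
  obtain f where fN: "\<And>y. y \<in> N \<Longrightarrow> [f y = 0] (mod int p)" and fc: "\<not> [f ?c = 0] (mod int p)"
    and f: "\<And>x y. x \<in> carrier G \<Longrightarrow> y \<in> carrier G \<Longrightarrow>
      [f (x \<otimes> y) = f x + f y + int half * f (commutator x y)] (mod int p)"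
    by (rule exists_quadratic_functional[OF c uv(3)]) (use that in blast)
  define om where "om = (\<lambda>y w. f (commutator y w))"
  have f_add: "[f (a \<otimes> b) = f a + f b] (mod int p)" if "a \<in> carrier G" "b \<in> carrier G" "commutator a b \<in> N" for a b
  proof -
    have "[int half * f (commutator a b) = int half * 0] (mod int p)" using fN[OF that(3)] by (rule cong_scalar_left)
    then have "[f a + f b + int half * f (commutator a b) = f a + f b + int half * 0] (mod int p)"
      by (rule cong_add[OF cong_refl])
    then show ?thesis using cong_trans[OF f[OF that(1,2)]] by simp
  qed
  have f_conj: "[f (a \<otimes> commutator b d \<otimes> inv a) = f (commutator b d)] (mod int p)"
    if "a \<in> carrier G" "b \<in> carrier G" "d \<in> carrier G" for a b d
  proof -
    let ?k = "commutator b d"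
    have k: "?k \<in> carrier G" using that by simp
    have n: "commutator a ?k \<in> N"
      using subgroup.m_inv_closed[OF N_subgroup commutator_in_N[OF that(2,3,1)]] inv_commutator[OF k that(1)] by simp
    have "[f (commutator a ?k \<otimes> ?k) = f (commutator a ?k) + f ?k] (mod int p)"
      by (rule f_add) (use that k n normal_commutator_closed(2)[OF N_normal k n] in auto)
    also have "[f (commutator a ?k) + f ?k = 0 + f ?k] (mod int p)"
      by (rule cong_add[OF fN[OF n] cong_refl])
    finally show ?thesis using conj_eq_commutator_mult[OF that(1) k] by simp
  qed
  have om_l: "additive (\<lambda>y. om y w)" if w: "w \<in> carrier G" for w
    unfolding additive_def om_def
  proof (intro ballI)
    fix a b assume ab: "a \<in> carrier G" "b \<in> carrier G"
    have "[f ((a \<otimes> commutator b w \<otimes> inv a) \<otimes> commutator a w) = f (a \<otimes> commutator b w \<otimes> inv a) + f (commutator a w)] (mod int p)"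
    proof (rule f_add)
      have "commutator (commutator a w) (a \<otimes> commutator b w \<otimes> inv a) \<in> N"
        by (rule commutator_in_N) (use ab w in auto)
      then show "commutator (a \<otimes> commutator b w \<otimes> inv a) (commutator a w) \<in> N"
        using subgroup.m_inv_closed[OF N_subgroup] inv_commutator[of "commutator a w" "a \<otimes> commutator b w \<otimes> inv a"] ab w
        by (metis commutator_closed inv_closed m_closed)
    qed (use ab w in auto)
    also have "[f (a \<otimes> commutator b w \<otimes> inv a) + f (commutator a w) = f (commutator b w) + f (commutator a w)] (mod int p)"
      by (rule cong_add[OF f_conj cong_refl]) (use ab w in auto)
    finally show "[f (commutator (a \<otimes> b) w) = f (commutator a w) + f (commutator b w)] (mod int p)"
      using commutator_mult_left[OF ab w] by (simp add: add.commute)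
  qed
  have f_one: "[f \<one> = 0] (mod int p)" using fN subgroup.one_closed[OF N_subgroup] by blast
  have om_skew: "[om y w = - om w y] (mod int p)" if "y \<in> carrier G" "w \<in> carrier G" for y w
  proof -
    have i: "commutator y w \<otimes> commutator w y = \<one>" using inv_commutator[OF that] that
      by (metis commutator_closed r_inv)
    have "[f (commutator y w \<otimes> commutator w y) = om y w + om w y] (mod int p)" unfolding om_def
      by (rule f_add) (use that commutator_in_N in auto)
    then have "[0 = om y w + om w y] (mod int p)" unfolding i using f_one cong_trans cong_sym by blast
    then have "int p dvd - (om y w + om w y)" by (simp only: cong_iff_dvd_diff diff_0)
    then have "int p dvd om y w + om w y" by (simp only: dvd_minus_iff)
    then have "int p dvd om y w - (- om w y)" by simp
    then show ?thesis by (simp only: cong_iff_dvd_diff)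
  qed
  have om_r: "additive (\<lambda>w. om y w)" if y: "y \<in> carrier G" for y
    unfolding additive_def
  proof (intro ballI)
    fix a b assume ab: "a \<in> carrier G" "b \<in> carrier G"
    have "[om y (a \<otimes> b) = - om (a \<otimes> b) y] (mod int p)" by (rule om_skew) (use y ab in auto)
    also have "[- om (a \<otimes> b) y = - (om a y + om b y)] (mod int p)"
      using additiveD[OF om_l[OF y] ab] by (simp only: cong_minus_minus_iff)
    also have "- (om a y + om b y) = - om a y + - om b y" by simp
    also have "[- om a y + - om b y = om y a + om y b] (mod int p)"
      using om_skew[OF y ab(1)] om_skew[OF y ab(2)] by (intro cong_add) (auto intro: cong_sym)
    finally show "[om y (a \<otimes> b) = om y a + om y b] (mod int p)" .
  qed
  have om_self: "[om y y = 0] (mod int p)" if "y \<in> carrier G" for y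
    using f_one that commutator_eq_one_iff[of y y] by (simp add: om_def)
  \<comment> \<open>the rows of the triangular form; row \<open>m\<close> is zero\<close>
  define be where "be = (\<lambda>i w. \<Sum>j<Suc m. (if i < j then om (x i) (x j) else 0) * phi (e j) w)"
  have be: "additive (be i)" for i unfolding be_def by (rule additive_sum) (simp add: additive_phi)
  have be_x: "[be i (x l) = (if i < l then om (x i) (x l) else 0)] (mod int p)" if l: "l < Suc m" for i l
  proof -
    have "[be i (x l) = (\<Sum>j<Suc m. (if i < j then om (x i) (x j) else 0) * (if j = l then 1 else 0))] (mod int p)"
      unfolding be_def by (rule cong_sum, rule cong_scalar_left, rule phi_dual) (use l in auto)
    also have "(\<Sum>j<Suc m. (if i < j then om (x i) (x j) else 0) * (if j = l then 1 else 0))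
       = (if i < l then om (x i) (x l) else 0)"
      using l by (simp add: sum.delta' if_distrib[of "\<lambda>t. _ * t"] cong: if_cong del: sum.lessThan_Suc)
    finally show ?thesis .
  qed
  define B where "B = (\<lambda>y w. \<Sum>i<m. phi (e i) y * be i w)"
  have B_r: "additive (B y)" for y unfolding B_def by (rule additive_sum) (rule be)
  have B_alt: "B y w = (\<Sum>i<m. be i w * phi (e i) y)" for y w unfolding B_def by (simp add: mult.commute)
  have B_l: "additive (\<lambda>y. B y w)" for w
    unfolding B_alt by (rule additive_sum) (simp add: additive_phi)
  have B_x: "[B (x k) (x l) = (if k < l then om (x k) (x l) else 0)] (mod int p)"
    if k: "k < Suc m" and l: "l < Suc m" for k l
  proof -
    have "[B (x k) (x l) = (\<Sum>i<m. (if i = k then 1 else 0) * (if i < l then om (x i) (x l) else 0))] (mod int p)"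
      unfolding B_def by (rule cong_sum, rule cong_mult, rule phi_dual) (use k l be_x in auto)
    also have "(\<Sum>i<m. (if i = k then 1 else 0) * (if i < l then om (x i) (x l) else 0))
       = (\<Sum>i<m. if i = k then (if i < l then om (x i) (x l) else 0) else 0)"
      by (rule sum.cong) auto
    also have "\<dots> = (if k < m then (if k < l then om (x k) (x l) else 0) else 0)"
      by (simp add: sum.delta)
    also have "\<dots> = (if k < l then om (x k) (x l) else 0)" using l by auto
    finally show ?thesis .
  qed
  have om_B: "[om y w = B y w - B w y] (mod int p)" if y: "y \<in> carrier G" and w: "w \<in> carrier G" for y w
  proof -
    have gen: "[om (x k) w - (B (x k) w - B w (x k)) = 0] (mod int p)" if k: "k < Suc m" for k
    proof (rule additive_eq_0_if[OF _ _ w])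
      show "additive (\<lambda>w. om (x k) w - (B (x k) w - B w (x k)))"
        by (intro additive_diff om_r B_r B_l x_carrier k)
      fix l assume l: "l < Suc m"
      have "[om (x k) (x l) - (B (x k) (x l) - B (x l) (x k)) =
        om (x k) (x l) - ((if k < l then om (x k) (x l) else 0) - (if l < k then om (x l) (x k) else 0))] (mod int p)"
        by (intro cong_diff cong_refl B_x k l)
      also have "[om (x k) (x l) - ((if k < l then om (x k) (x l) else 0) - (if l < k then om (x l) (x k) else 0)) = 0] (mod int p)"
      proof (cases k l rule: linorder_cases)
        case less then show ?thesis by simp
      next
        case equal then show ?thesis using om_self[of "x l"] l by simp
      next
        case greater
        have "[om (x k) (x l) = - om (x l) (x k)] (mod int p)" using om_skew k l by simp
        then show ?thesis using greater by (simp add: cong_iff_dvd_diff)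
      qed
      finally show "[om (x k) (x l) - (B (x k) (x l) - B (x l) (x k)) = 0] (mod int p)" .
    qed
    have "[om y w - (B y w - B w y) = 0] (mod int p)"
    proof (rule additive_eq_0_if[where f = "\<lambda>y. om y w - (B y w - B w y)", OF _ gen y])
      show "additive (\<lambda>y. om y w - (B y w - B w y))"
        by (intro additive_diff om_l B_r B_l w)
    qed
    then show ?thesis by (simp add: cong_iff_dvd_diff)
  qed
  define s where "s = (\<lambda>y. f y + int half * B y y)"
  have s_mult: "[s (y \<otimes> w) = s y + s w + B y w] (mod int p)" if y: "y \<in> carrier G" and w: "w \<in> carrier G" for y w
  proof -
    have "[B (y \<otimes> w) (y \<otimes> w) = B y (y \<otimes> w) + B w (y \<otimes> w)] (mod int p)" by (rule additiveD[OF B_l y w])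
    also have "[B y (y \<otimes> w) + B w (y \<otimes> w) = (B y y + B y w) + (B w y + B w w)] (mod int p)"
      by (intro cong_add additiveD[OF B_r] y w)
    finally have 1: "[B (y \<otimes> w) (y \<otimes> w) = (B y y + B y w) + (B w y + B w w)] (mod int p)" .
    have "[f (y \<otimes> w) = f y + f w + int half * om y w] (mod int p)" unfolding om_def by (rule f[OF y w])
    also have "[f y + f w + int half * om y w = f y + f w + int half * (B y w - B w y)] (mod int p)"
      by (intro cong_add cong_refl cong_scalar_left om_B y w)
    finally have "[s (y \<otimes> w) = (f y + f w + int half * (B y w - B w y)) + int half * ((B y y + B y w) + (B w y + B w w))] (mod int p)"
      unfolding s_def by (rule cong_add[OF _ cong_scalar_left[OF 1]])
    also have "(f y + f w + int half * (B y w - B w y)) + int half * ((B y y + B y w) + (B w y + B w w)) =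
      s y + s w + int (2 * half) * B y w" unfolding s_def by (simp add: algebra_simps)
    also have "[s y + s w + int (2 * half) * B y w = s y + s w + B y w] (mod int p)"
      unfolding two_half by (simp add: cong_iff_dvd_diff algebra_simps)
    finally show ?thesis .
  qed
  have B_fr: "[B y y = 0] (mod int p)" if "y \<in> frattini G" for y using that B_r by (simp add: frattini_iff)
  have s_fr: "[s y = f y] (mod int p)" if "y \<in> frattini G" for y
  proof -
    have "[int half * B y y = int half * 0] (mod int p)" by (rule cong_scalar_left[OF B_fr[OF that]])
    then have "[f y + int half * B y y = f y + int half * 0] (mod int p)" by (rule cong_add[OF cong_refl])
    then show ?thesis unfolding s_def by simp
  qed
  have s_N: "[s y = 0] (mod int p)" if "y \<in> N" for y
    using s_fr fN[OF that] N_subset_frattini that cong_trans by blast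
  let ?al = "\<lambda>i y. - be i y"
  have al: "additive (?al i)" for i using additive_scale[OF be, of "-1"] by simp
  have al_fr: "[?al i y = 0] (mod int p)" if "y \<in> frattini G" for i y
    using al[of i] that unfolding frattini_iff by blast
  have "\<exists>g\<in>carrier G. \<forall>y\<in>carrier G. commutator g y = eprod e m (\<lambda>i. ?al i y) \<otimes> z [^] s y"
  proof (rule derivation_is_inner)
    show "[s (y \<otimes> w) = s y + s w - (\<Sum>i<m. ?al i w * phi (e i) y)] (mod int p)"
      if "y \<in> carrier G" "w \<in> carrier G" for y w
      using s_mult[OF that] unfolding B_alt by (simp add: sum_negf)
    show "[?al i (e j) = 0] (mod int p)" if "i < m" "j < m" for i j
      by (rule al_fr[OF e_frattini]) (use that in simp)
  qed (use e_commute e_pow al s_N z_in_N in auto)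
  then obtain g where g: "g \<in> carrier G"
    "\<And>y. y \<in> carrier G \<Longrightarrow> commutator g y = eprod e m (\<lambda>i. ?al i y) \<otimes> z [^] s y" by blast
  have fr_comm: "commutator g y = z [^] s y" if y: "y \<in> frattini G" for y
  proof -
    have "eprod e m (\<lambda>i. ?al i y) = \<one>" by (rule eprod_eq_one) (use e_pow al_fr[OF y] in auto)
    then show ?thesis using g(2)[of y] y frattini_subset by auto
  qed
  have gE: "commutator g y \<in> E" if "y \<in> carrier G" for y
    unfolding g(2)[OF that] by (intro E_mult zpow_E eprod_E) simp
  show thesis
  proof (rule that[OF g(1)])
    fix h assume h: "h \<in> N"
    then have "commutator g h = \<one>" using fr_comm[of h] N_subset_frattini s_N[OF h] zpow_eq_one_iff by auto
    then show "g \<otimes> h = h \<otimes> g" using commutator_eq_one_iff[OF g(1) subgroup.mem_carrier[OF N_subgroup h]] by simp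
  next
    have "commutator (commutator (commutator g y) w) v = \<one>" if "y \<in> carrier G" "w \<in> carrier G" "v \<in> carrier G" for y w v
      unfolding commutator_E[OF gE[OF that(1)] that(2)] using that zpow_comm by (simp add: commutator_eq_one_iff)
    then show "g \<in> upper_central G 3" using g(1)
      by (simp add: numeral_3_eq_3 upper_central_Suc_iff del: upper_central.simps(2))
  next
    have cf: "?c \<in> frattini G" by (rule commutator_in_frattini[OF uv(1,2)])
    have "\<not> [s ?c = 0] (mod int p)" using fc s_fr[OF cf] cong_trans cong_sym by blast
    then show "commutator g ?c \<noteq> \<one>" unfolding fr_comm[OF cf] zpow_eq_one_iff .
  qed
qed

lemma card_carrier_ge_C: "p ^ Suc m * card C \<le> card (carrier G)"
proof -
  have "p ^ card {..<Suc m} * card C \<le> card (carrier G)"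
  proof (rule card_ge_of_separating_subgroups[where H = "\<lambda>j. {y \<in> carrier G. [phi (e j) y = 0] (mod int p)}" and g = x])
    show "subgroup {y \<in> carrier G. [phi (e k) y = 0] (mod int p)} G" if "k \<in> {..<Suc m}" for k
      by (rule additive_kernel_subgroup[OF additive_phi]) (use that in simp)
    show "C \<subseteq> {y \<in> carrier G. [phi (e k) y = 0] (mod int p)}" if "k \<in> {..<Suc m}" for k
    proof
      fix g assume "g \<in> C"
      then have "g \<in> frattini G" using C_subset_frattini by blast
      then show "g \<in> {y \<in> carrier G. [phi (e k) y = 0] (mod int p)}"
        using that unfolding frattini_iff_dual by blast
    qed
    show "x k \<notin> {y \<in> carrier G. [phi (e k) y = 0] (mod int p)}" if "k \<in> {..<Suc m}" for k
      using phi_dual[of k k] that p_gt_1 by (auto simp: cong_def)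
    show "x k \<in> {y \<in> carrier G. [phi (e l) y = 0] (mod int p)}"
      if "k \<in> {..<Suc m}" "l \<in> {..<Suc m}" "k \<noteq> l" for k l
      using phi_dual[of l k] that by simp
  qed (use C_subgroup subgroup_self CD(1) in auto)
  then show ?thesis by simp
qed

text \<open>\<open>U\<close> is the kernel of the power map on the abelian group \<open>C\<close>, whose image is central.\<close>

lemma card_C_le:
  obtains U where "subgroup U G" "\<And>u. u \<in> U \<Longrightarrow> u [^] p = \<one>" "card C \<le> card U * card (center G)"
proof -
  define U where "U = {g \<in> C. g [^] p = \<one>}"
  have Cc: "g \<in> carrier G" if "g \<in> C" for g using CD(1)[OF that] .
  have Cpow: "(g \<otimes> h) [^] p = g [^] p \<otimes> h [^] p" if gh: "g \<in> C" "h \<in> C" for g h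
    by (rule pow_mult_distrib) (use CD(2)[OF gh(1)] C_subset_frattini gh Cc in auto)
  have sU: "subgroup U G"
  proof (rule finite_p_subgroupI)
    show "U \<subseteq> carrier G" using Cc by (auto simp: U_def)
    show "\<one> \<in> U" using subgroup.one_closed[OF C_subgroup] by (simp add: U_def)
    fix g h assume "g \<in> U" "h \<in> U"
    then show "g \<otimes> h \<in> U" using Cpow[of g h] subgroup.m_closed[OF C_subgroup, of g h] by (simp add: U_def)
  qed
  define r where "r = (\<lambda>y. SOME g. g \<in> C \<and> g [^] p = y)"
  have r: "r (g [^] p) \<in> C \<and> r (g [^] p) [^] p = g [^] p" if "g \<in> C" for g
    unfolding r_def by (rule someI[of _ g]) (use that in simp)
  have "card C \<le> card (U \<times> center G)"
  proof (rule card_inj_on_le)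
    show "inj_on (\<lambda>g. (inv (r (g [^] p)) \<otimes> g, g [^] p)) C"
    proof (rule inj_onI)
      fix g h assume gh: "g \<in> C" "h \<in> C"
        and eq: "(inv (r (g [^] p)) \<otimes> g, g [^] p) = (inv (r (h [^] p)) \<otimes> h, h [^] p)"
      have p: "g [^] p = h [^] p" and i: "inv (r (g [^] p)) \<otimes> g = inv (r (h [^] p)) \<otimes> h" using eq by auto
      have rc: "inv (r (h [^] p)) \<in> carrier G" using r[OF gh(2)] Cc by simp
      show "g = h" by (rule l_cancel[OF i[unfolded p] Cc[OF gh(1)] Cc[OF gh(2)] rc])
    qed
    show "(\<lambda>g. (inv (r (g [^] p)) \<otimes> g, g [^] p)) ` C \<subseteq> U \<times> center G"
    proof clarify
      fix g assume g: "g \<in> C"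
      have rC: "r (g [^] p) \<in> C" and rp: "r (g [^] p) [^] p = g [^] p" using r[OF g] by auto
      have iC: "inv (r (g [^] p)) \<in> C" by (rule subgroup.m_inv_closed[OF C_subgroup rC])
      have "(inv (r (g [^] p)) \<otimes> g) [^] p = inv (r (g [^] p)) [^] p \<otimes> g [^] p" by (rule Cpow[OF iC g])
      also have "inv (r (g [^] p)) [^] p = inv (g [^] p)" using nat_pow_inv[OF Cc[OF rC], of p] rp by simp
      finally have "(inv (r (g [^] p)) \<otimes> g) [^] p = \<one>" using Cc[OF g] by simp
      then show "inv (r (g [^] p)) \<otimes> g \<in> U \<and> g [^] p \<in> center G"
        using subgroup.m_closed[OF C_subgroup iC g] C_pow_p_central[OF g] by (simp add: U_def)
    qed
    show "finite (U \<times> center G)" using finite_subgroup[OF sU] finite_subgroup[OF center_subgroup] by blast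
  qed
  then have "card C \<le> card U * card (center G)" by (simp add: card_cartesian_product)
  then show thesis using that[OF sU] by (auto simp: U_def)
qed

text \<open>A group of this kind with derived subgroup inside \<open>N\<close> would have an elementary abelian subgroup
  larger than its Frattini quotient.\<close>

lemma commutator_not_in_N: "\<exists>u\<in>carrier G. \<exists>v\<in>carrier G. commutator u v \<notin> N"
proof (rule ccontr)
  assume "\<not> ?thesis"
  then have pw: "commutator u v \<in> N" if "u \<in> carrier G" "v \<in> carrier G" for u v using that by blast
  obtain U where U: "subgroup U G" "\<And>u. u \<in> U \<Longrightarrow> u [^] p = \<one>" "card C \<le> card U * card (center G)"
    by (rule card_C_le) (use that in blast)
  have Zpos: "0 < card (center G)"
    using finite_subgroup[OF center_subgroup] subgroup.one_closed[OF center_subgroup] card_gt_0_iff by blast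
  have Ppos: "0 < card (lower_p (Suc 0))"
    using finite_subgroup[OF lower_p_subgroup] subgroup.one_closed[OF lower_p_subgroup] card_gt_0_iff by blast
  have "card U * card (lower_p (Suc 0)) \<le> p ^ Suc m * card (lower_p (Suc 0))"
    using card_elementary_le[OF pw U(1,2)] card_le_generators[OF x_carrier x_generate] by linarith
  then have "card U \<le> p ^ Suc m" using Ppos by simp
  moreover have "p ^ ((Suc m + 1) choose 2) \<le> card U"
    using card_C_ge U(3) Zpos by (metis le_trans mult_le_cancel2)
  ultimately have "p ^ ((Suc m + 1) choose 2) \<le> p ^ Suc m" by linarith
  then have "(Suc m + 1) choose 2 \<le> Suc m" using p_gt_1 by (simp only: power_increasing_iff)
  moreover have "(Suc m + 1) choose 2 = ((m + 1) choose 2) + Suc m" by (simp add: numeral_2_eq_2)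
  moreover have "0 < (m + 1) choose 2" using one_le_m by (intro zero_less_binomial) simp
  ultimately show False by linarith
qed

lemma upper_central_strict:
  assumes "upper_central G i \<noteq> carrier G" shows "p * card (upper_central G i) \<le> card (upper_central G (Suc i))"
proof (rule card_psubset_subgroup[OF upper_central_subgroup upper_central_subgroup])
  have "upper_central G i \<subset> carrier G" using assms subgroup.subset[OF upper_central_subgroup] by blast
  then obtain y where "y \<in> carrier G" "y \<notin> upper_central G i" "y [^] p \<in> upper_central G i"
    "\<And>w. w \<in> carrier G \<Longrightarrow> commutator y w \<in> upper_central G i"
    using central_step[OF upper_central_normal normal_self] by metis
  then have "y \<in> upper_central G (Suc i)" "y \<notin> upper_central G i" using upper_central_Suc_iff by blast+
  then show "upper_central G i \<subset> upper_central G (Suc i)" using upper_central_mono_Suc by blast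
qed

lemma upper_central_reaches: "\<exists>k. upper_central G k = carrier G"
proof (rule ccontr)
  assume ne: "\<not> ?thesis"
  have "k < card (upper_central G k)" for k
  proof (induction k)
    case (Suc k)
    have "2 * card (upper_central G k) \<le> p * card (upper_central G k)" using p_gt_1 by (intro mult_le_mono1) simp
    moreover have "p * card (upper_central G k) \<le> card (upper_central G (Suc k))"
      by (rule upper_central_strict) (use ne in blast)
    ultimately show ?case using Suc.IH by linarith
  qed simp
  from this[of "card (carrier G)"] show False
    using card_mono[OF finite_G subgroup.subset[OF upper_central_subgroup], of "card (carrier G)"] by linarith
qed

lemma lower_central_le_upper_central:
  assumes "upper_central G k = carrier G"
  shows "i \<le> k \<Longrightarrow> lower_central G (Suc i) \<subseteq> upper_central G (k - i)"
proof (induction i)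
  case 0 then show ?case using assms by simp
next
  case (Suc i)
  obtain j where j: "k - i = Suc j" "k - Suc i = j" using Suc.prems by (metis Suc_diff_Suc Suc_le_lessD)
  have IH: "lower_central G (Suc i) \<subseteq> upper_central G (Suc j)" using Suc j by simp
  have "commutator_subgroup G (lower_central G (Suc i)) (carrier G) \<subseteq> upper_central G j"
    by (rule commutator_subgroup_incl[OF upper_central_subgroup])
      (use IH upper_central_Suc_iff in blast)
  then show ?case using j by simp
qed

lemma nilpotency_class_le:
  assumes "upper_central G k = carrier G" shows "nilpotency_class G \<le> k"
  unfolding nilpotency_class_def
proof (rule Least_le)
  have "lower_central G (Suc k) \<subseteq> {\<one>}" using lower_central_le_upper_central[OF assms, of k] by simp
  moreover have "\<one> \<in> lower_central G (Suc k)"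
    using subgroup.one_closed[OF normal_imp_subgroup[OF lower_central_normal]] .
  ultimately show "lower_central G (Suc k) = {\<one>}" by blast
qed

text \<open>If \<open>G\<close> were generated by a term \<open>H\<close> of the upper central series and one further element \<open>y\<close>, then \<open>y\<close> itself would
  lie in \<open>H\<close>. So there is a subgroup strictly between \<open>H\<close> and \<open>G\<close>.\<close>

lemma card_last_upper_central:
  assumes "upper_central G (Suc i) \<noteq> carrier G"
  shows "p * (p * card (upper_central G (Suc i))) \<le> card (carrier G)"
proof -
  let ?H = "upper_central G (Suc i)"
  have sH: "subgroup ?H G" by (rule upper_central_subgroup)
  have Hn: "?H \<lhd> G" by (rule upper_central_normal)
  have Hc: "h \<in> carrier G" if "h \<in> ?H" for h using subgroup.mem_carrier[OF sH that] .
  have "?H \<subset> carrier G" using assms subgroup.subset[OF sH] by blast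
  then obtain y where y: "y \<in> carrier G" "y \<notin> ?H" by blast
  have ny: "y \<otimes> h \<otimes> inv y \<in> ?H" if "h \<in> ?H" for h by (rule commutator_conj_closed[OF Hn y(1) that])
  note ad = adjoin_subgroup[OF sH y(1) ny]
  have "adjoin ?H y \<noteq> carrier G"
  proof
    assume a: "adjoin ?H y = carrier G"
    have "commutator y w \<in> upper_central G i" if w: "w \<in> carrier G" for w
    proof -
      obtain h n where h: "h \<in> ?H" "w = h \<otimes> y [^] (n::nat)"
        using w unfolding a[symmetric] adjoin_def by blast
      have "y \<otimes> y [^] n = y [^] n \<otimes> y" using y(1) by (metis nat_pow_Suc nat_pow_Suc2)
      then have "commutator y (y [^] n) = \<one>" using y(1) commutator_eq_one_iff by simp
      then have "commutator y w = commutator y h"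
        unfolding h(2) using commutator_mult_right[of h "y [^] n" y] y(1) Hc[OF h(1)] by simp
      also have "\<dots> = inv (commutator h y)" using inv_commutator[OF Hc[OF h(1)] y(1)] by simp
      also have "\<dots> \<in> upper_central G i"
        using h(1) y(1) upper_central_Suc_iff subgroup.m_inv_closed[OF upper_central_subgroup] by blast
      finally show ?thesis .
    qed
    then show False using y upper_central_Suc_iff by blast
  qed
  then have "adjoin ?H y \<subset> carrier G" using subgroup.subset[OF ad(1)] by blast
  then have 1: "p * card (adjoin ?H y) \<le> card (carrier G)"
    by (intro card_psubset_subgroup ad(1) subgroup_self)
  have "?H \<subset> adjoin ?H y" using ad(2,3) y(2) by blast
  then have 2: "p * card ?H \<le> card (adjoin ?H y)" by (intro card_psubset_subgroup sH ad(1))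
  show ?thesis using mult_le_mono2[OF 2, of p] 1 by linarith
qed

lemma not_subset_center_frattini:
  "\<not> (centralizer G N \<inter> upper_central G 3 \<subseteq> center (G\<lparr>carrier := frattini G\<rparr>))"
proof
  assume sub: "centralizer G N \<inter> upper_central G 3 \<subseteq> center (G\<lparr>carrier := frattini G\<rparr>)"
  obtain u v where uv: "u \<in> carrier G" "v \<in> carrier G" "commutator u v \<notin> N" using commutator_not_in_N by blast
  obtain g where g: "g \<in> carrier G" "\<And>h. h \<in> N \<Longrightarrow> g \<otimes> h = h \<otimes> g" "g \<in> upper_central G 3"
    "commutator g (commutator u v) \<noteq> \<one>"
    by (rule exists_third_center_element[OF uv]) (use that in blast)
  have "g \<in> centralizer G N \<inter> upper_central G 3" using g(1-3) unfolding centralizer_def by blast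
  then have "g \<in> center (G\<lparr>carrier := frattini G\<rparr>)" using sub by blast
  then have "g \<otimes> commutator u v = commutator u v \<otimes> g"
    using commutator_in_frattini[OF uv(1,2)] unfolding center_def centralizer_def by simp
  then show False using g(4) commutator_eq_one_iff[OF g(1), of "commutator u v"] uv by simp
qed

text \<open>If the third centre is not \<open>G\<close>, the orders above the identity multiply to at least \<open>p\<close> for \<open>Z\<close>,
\<open>p^(d(d+1)/2)\<close> for \<open>C/Z\<close>, \<open>p\<close> for the third centre over \<open>C\<close>, \<open>p\<close> for each further factor and \<open>p\<^sup>2\<close> for the last
one, which is the class plus \<open>d(d+1)/2\<close> in the exponent. If the third centre is \<open>G\<close>, the class is at most
\<open>3\<close> and \<open>|G : C| \<ge> p^d \<ge> p\<^sup>2\<close> gives the same bound.\<close>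

lemma coclass_ge: "int ((Suc m + 1) choose 2) \<le> coclass p G"
proof -
  let ?b = "(Suc m + 1) choose 2"
  obtain n where n: "order G = p ^ n" using p_group by (auto simp: finite_p_group_def)
  have "(THE n. order G = p ^ n) = n"
    by (rule the_equality) (use n p_gt_1 in auto)
  then have cc: "coclass p G = int n - int (nilpotency_class G)" by (simp add: coclass_def)
  define k where "k = (LEAST k. upper_central G k = carrier G)"
  have k: "upper_central G k = carrier G" unfolding k_def by (rule LeastI_ex[OF upper_central_reaches])
  have lt: "upper_central G j \<noteq> carrier G" if "j < k" for j
    using not_less_Least[of j "\<lambda>k. upper_central G k = carrier G"] that unfolding k_def by blast
  have cl: "nilpotency_class G \<le> k" by (rule nilpotency_class_le[OF k])
  have "{\<one>} \<subset> center G"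
    using z_ne_one z_comm subgroup.one_closed[OF center_subgroup] by (auto simp: mem_center_iff)
  then have "p * card {\<one>} \<le> card (center G)" by (rule card_psubset_subgroup[OF triv_subgroup center_subgroup])
  then have Z: "p \<le> card (center G)" by simp
  have C: "p ^ Suc ?b \<le> card C"
  proof -
    have "p ^ ?b * p \<le> p ^ ?b * card (center G)" using Z by (rule mult_le_mono2)
    also have "\<dots> \<le> card C" by (rule card_C_ge)
    finally show ?thesis by (simp only: power_Suc mult.commute)
  qed
  have G: "card (carrier G) = p ^ n" using n by (simp add: order_def)
  have "k + ?b \<le> n"
  proof (cases "upper_central G 3 = carrier G")
    case True
    then have "k \<le> 3" unfolding k_def by (rule Least_le)
    have "p ^ (Suc m + Suc ?b) \<le> p ^ Suc m * card C" unfolding power_add using C by (rule mult_le_mono2)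
    also have "\<dots> \<le> p ^ n" using card_carrier_ge_C G by simp
    finally have "Suc m + Suc ?b \<le> n" using p_gt_1 by (simp only: power_increasing_iff)
    then show ?thesis using \<open>k \<le> 3\<close> one_le_m by linarith
  next
    case False
    have k3: "3 < k"
    proof (rule ccontr)
      assume "\<not> 3 < k"
      then have "carrier G \<subseteq> upper_central G 3" using upper_central_mono[of k 3] k by simp
      then show False using False subgroup.subset[OF upper_central_subgroup] by blast
    qed
    have "\<not> (centralizer G N \<inter> upper_central G 3 \<subseteq> C)"
    proof
      assume s: "centralizer G N \<inter> upper_central G 3 \<subseteq> C"
      have "C \<subseteq> center (G\<lparr>carrier := frattini G\<rparr>)"
        using C_subset_frattini CD(2) unfolding center_def centralizer_def by auto
      then show False using s not_subset_center_frattini by blast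
    qed
    then have "C \<subset> upper_central G 3" using C_subset_upper_central by blast
    then have "p * card C \<le> card (upper_central G 3)"
      by (rule card_psubset_subgroup[OF C_subgroup upper_central_subgroup])
    with mult_le_mono2[OF C] have "p * p ^ Suc ?b \<le> card (upper_central G 3)" by (rule order_trans)
    then have Z3: "p ^ Suc (Suc ?b) \<le> card (upper_central G 3)" by (simp only: power_Suc)
    have up: "p ^ (j + Suc (Suc ?b)) \<le> card (upper_central G (3 + j))" if "3 + j < k" for j
      using that
    proof (induction j)
      case 0 then show ?case using Z3 by simp
    next
      case (Suc j)
      have "p * p ^ (j + Suc (Suc ?b)) \<le> p * card (upper_central G (3 + j))"
        by (rule mult_le_mono2) (use Suc in simp)
      also have "\<dots> \<le> card (upper_central G (Suc (3 + j)))"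
        by (rule upper_central_strict[OF lt]) (use Suc.prems in simp)
      finally show ?case by simp
    qed
    obtain j where j: "k = 4 + j" using k3 le_Suc_ex[of 4 k] by auto
    have "upper_central G (Suc (2 + j)) \<noteq> carrier G" by (rule lt) (use j in simp)
    then have l: "p * (p * card (upper_central G (Suc (2 + j)))) \<le> card (carrier G)" by (rule card_last_upper_central)
    have "p ^ (j + Suc (Suc ?b)) \<le> card (upper_central G (Suc (2 + j)))"
      using up[of j] j by (simp add: numeral_3_eq_3 numeral_2_eq_2 del: upper_central.simps)
    then have "p * (p * p ^ (j + Suc (Suc ?b))) \<le> p * (p * card (upper_central G (Suc (2 + j))))"
      by (intro mult_le_mono2)
    then have "p * (p * p ^ (j + Suc (Suc ?b))) \<le> p ^ n" using l unfolding G by (rule order_trans)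
    then have "p ^ Suc (Suc (j + Suc (Suc ?b))) \<le> p ^ n" by (simp only: power_Suc)
    then have "Suc (Suc (j + Suc (Suc ?b))) \<le> n" using p_gt_1 by (simp only: power_increasing_iff)
    then show ?thesis using j by simp
  qed
  then show ?thesis using cc cl by linarith
qed

end

section \<open>Cyclic centre\<close>

context p_group
begin

text \<open>The two facts about a cyclic \<open>p\<close>-group: its elements of order dividing \<open>p\<close> form one cyclic subgroup, and an element
that is not a \<open>p\<close>-th power generates it.\<close>

lemma cyclic_center_socle:
  assumes cyc: "cyclic_group (G\<lparr>carrier := center G\<rparr>)" and ne: "carrier G \<noteq> {\<one>}"
  obtains z where "z \<in> carrier G" "\<And>x. x \<in> carrier G \<Longrightarrow> z \<otimes> x = x \<otimes> z" "z [^] p = \<one>" "z \<noteq> \<one>"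
    "\<And>y. y \<in> center G \<Longrightarrow> y [^] p = \<one> \<Longrightarrow> \<exists>k::int. y = z [^] k"
    "\<And>u. u \<in> center G \<Longrightarrow> (\<exists>v\<in>center G. u = v [^] p) \<or> (\<forall>y\<in>center G. \<exists>k::int. y = u [^] k)"
proof -
  have sZ: "subgroup (center G) G" by (rule center_subgroup)
  interpret Z: group "G\<lparr>carrier := center G\<rparr>" by (rule subgroup_imp_group[OF sZ])
  have "\<exists>w\<in>center G. center G = range (\<lambda>n::int. w [^]\<^bsub>G\<lparr>carrier := center G\<rparr>\<^esub> n)"
    using iffD1[OF Z.cyclic_group cyc] by simp
  then obtain w where w0: "w \<in> center G" "center G = range (\<lambda>n::int. w [^]\<^bsub>G\<lparr>carrier := center G\<rparr>\<^esub> n)" ..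
  have w: "w \<in> center G" "center G = range (\<lambda>n::int. w [^] n)"
    using w0 unfolding int_pow_consistent[OF sZ w0(1)] by this
  have wc: "w \<in> carrier G" using w(1) by (simp add: mem_center_iff)
  have wcen: "w [^] (k::int) \<in> center G" for k using w(2) by blast
  obtain n where n: "order G = p ^ n" using p_group by (auto simp: finite_p_group_def)
  obtain t where t: "ord w = p ^ t"
    using ord_dvd_group_order[OF wc] unfolding n divides_primepow_nat[OF prime_p] by blast
  have weq: "w [^] (a::int) = w [^] (b::int)" if "int (p ^ t) dvd b - a" for a b
    using int_pow_eq[OF wc] t that by simp
  have "{\<one>} \<subset> carrier G" using ne by blast
  then obtain z where "z \<in> carrier G" "z \<notin> {\<one>}" "z [^] p \<in> {\<one>}" "\<And>y. y \<in> carrier G \<Longrightarrow> commutator z y \<in> {\<one>}"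
    using central_step[OF one_is_normal normal_self] by metis
  then have z: "z \<in> carrier G" "z \<noteq> \<one>" "z [^] p = \<one>" "\<And>y. y \<in> carrier G \<Longrightarrow> z \<otimes> y = y \<otimes> z"
    by (auto simp: commutator_eq_one_iff)
  have "z \<in> center G" using z by (simp add: mem_center_iff)
  then obtain b :: int where b: "z = w [^] b" using w(2) by blast
  have t0: "t \<noteq> 0"
  proof
    assume "t = 0"
    then have "w = \<one>" using t ord_eq_1[OF wc] by simp
    then show False using b z(2) by simp
  qed
  then obtain q where q: "t = Suc q" using not0_implies_Suc by blast
  have root: "int (p ^ q) dvd a" if "(w [^] (a::int)) [^] p = \<one>" for a
  proof -
    have "w [^] (a * int p) = \<one>" using that wc by (simp add: int_pow_pow flip: int_pow_int)
    then have "int (p ^ t) dvd a * int p" using int_pow_eq_id[OF wc, of "a * int p"] t by simp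
    then have "int p * int (p ^ q) dvd int p * a" using q by (simp add: mult.commute)
    then show ?thesis using p_gt_1 by simp
  qed
  obtain b' where b': "b = int (p ^ q) * b'" using root[of b] z(3) b by (auto elim: dvdE)
  have nb: "\<not> [b' = 0] (mod int p)"
  proof
    assume "[b' = 0] (mod int p)"
    then have "int (p ^ t) dvd 0 - b" unfolding b' q by (simp add: cong_0_iff mult.commute)
    then have "w [^] b = w [^] (0::int)" by (rule weq)
    then show False using z(2) b by simp
  qed
  obtain l :: nat where l: "[int l * b' = 1] (mod int p)" using exists_inverse_mod_p[OF nb] .
  have roots: "\<exists>k::int. y = z [^] k" if y: "y \<in> center G" "y [^] p = \<one>" for y
  proof -
    obtain a :: int where a: "y = w [^] a" using y(1) w(2) by blast
    obtain a' where a': "a = int (p ^ q) * a'" using root[of a] y(2) a by (auto elim: dvdE)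
    have "int p dvd 1 - int l * b'" using cong_sym[OF l] by (simp only: cong_iff_dvd_diff)
    then have "int (p ^ q) * int p dvd int (p ^ q) * (1 - int l * b')" by (rule mult_dvd_mono[OF dvd_refl])
    then have "int (p ^ t) dvd int (p ^ q) * (1 - int l * b')" unfolding q by (simp add: mult.commute)
    then have "int (p ^ t) dvd (int (p ^ q) * (1 - int l * b')) * a'" by (rule dvd_mult2)
    then have "int (p ^ t) dvd a - b * (int l * a')" unfolding a' b' by (simp add: algebra_simps)
    then have "w [^] (b * (int l * a')) = w [^] a" by (rule weq)
    then have "y = z [^] (int l * a')" unfolding a b using wc by (simp add: int_pow_pow)
    then show ?thesis by blast
  qed
  have gen: "(\<exists>v\<in>center G. u = v [^] p) \<or> (\<forall>y\<in>center G. \<exists>k::int. y = u [^] k)" if u: "u \<in> center G" for u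
  proof -
    obtain a :: int where a: "u = w [^] a" using u w(2) by blast
    show ?thesis
    proof (cases "int p dvd a")
      case True
      then obtain a' where "a = int p * a'" by blast
      then have "u = (w [^] a') [^] p" using a wc by (simp add: int_pow_pow mult.commute flip: int_pow_int)
      then show ?thesis using wcen by blast
    next
      case False
      then have "coprime a (int p)"
        using prime_p by (metis coprime_commute prime_imp_coprime prime_nat_int_transfer)
      then have "coprime a (int (p ^ t))" by simp
      then obtain c where c: "[a * c = 1] (mod int (p ^ t))" using cong_solve_coprime_int by blast
      have "\<exists>k::int. y = u [^] k" if y: "y \<in> center G" for y
      proof -
        obtain d :: int where d: "y = w [^] d" using y w(2) by blast
        have "int (p ^ t) dvd (1 - a * c) * d" using cong_sym[OF c] by (simp add: cong_iff_dvd_diff)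
        then have "int (p ^ t) dvd d - a * (c * d)" by (simp add: algebra_simps)
        then have "w [^] (a * (c * d)) = w [^] d" by (rule weq)
        then have "y = u [^] (c * d)" using a d wc by (simp add: int_pow_pow)
        then show ?thesis by blast
      qed
      then show ?thesis by blast
    qed
  qed
  show thesis using that[OF z(1,4,3,2) roots gen] by blast
qed

end

theorem theorem4p2:
  fixes G :: "('a, 'b) monoid_scheme" and p :: nat
  assumes "Factorial_Ring.prime p" and "odd p"
    and "finite_p_group p G"
    and "\<not> comm_group G"
    and "cyclic_group (G\<lparr>carrier := center G\<rparr>)"
    and "\<forall>f \<in> auto G. group.ord (AutoGroup G) f = p \<longrightarrow>
           (\<forall>x \<in> power_subgroup G p <#>\<^bsub>G\<^esub> lower_central G 3. f x = x) \<longrightarrow>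
           f \<in> inner_autos G"
  shows "\<not> (centralizer G (power_subgroup G p <#>\<^bsub>G\<^esub> lower_central G 3) \<inter> upper_central G 3
             \<subseteq> center (G\<lparr>carrier := frattini G\<rparr>))
         \<and> int ((min_generators G + 1) choose 2) \<le> coclass p G"
proof -
  interpret group G using assms(3) by (simp add: finite_p_group_def)
  interpret p_group G p by unfold_locales (use assms(1,3) in auto)
  interpret odd_p_group G p by unfold_locales (rule assms(2))
  have "carrier G \<noteq> {\<one>\<^bsub>G\<^esub>}"
  proof
    assume "carrier G = {\<one>\<^bsub>G\<^esub>}"
    then have "comm_group G" by (intro group_comm_groupI) auto
    then show False using assms(4) by simp
  qed
  then obtain z where z: "z \<in> carrier G" "\<And>x. x \<in> carrier G \<Longrightarrow> z \<otimes>\<^bsub>G\<^esub> x = x \<otimes>\<^bsub>G\<^esub> z"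
    "z [^]\<^bsub>G\<^esub> p = \<one>\<^bsub>G\<^esub>" "z \<noteq> \<one>\<^bsub>G\<^esub>"
    "\<And>y. y \<in> center G \<Longrightarrow> y [^]\<^bsub>G\<^esub> p = \<one>\<^bsub>G\<^esub> \<Longrightarrow> \<exists>k::int. y = z [^]\<^bsub>G\<^esub> k"
    "\<And>u. u \<in> center G \<Longrightarrow> (\<exists>v\<in>center G. u = v [^]\<^bsub>G\<^esub> p) \<or> (\<forall>y\<in>center G. \<exists>k::int. y = u [^]\<^bsub>G\<^esub> k)"
    by (rule cyclic_center_socle[OF assms(5)]) (rule that, assumption+)
  interpret inner_p_group G p z
    by unfold_locales (fact z assms(4) assms(6)[folded N_def])+
  obtain x0 e0 where D: "dual (min_generators G) x0 e0" using exists_dual by blast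
  have "min_generators G \<noteq> 0"
  proof
    assume "min_generators G = 0"
    then have "generate G {} = carrier G" using D by (simp add: dual_def)
    then show False using \<open>carrier G \<noteq> {\<one>\<^bsub>G\<^esub>}\<close> generate_empty by simp
  qed
  then obtain m where m: "min_generators G = Suc m" using not0_implies_Suc by blast
  obtain x e where xe: "dual (Suc m) x e" "\<forall>i<m. e i [^]\<^bsub>G\<^esub> p = \<one>\<^bsub>G\<^esub>"
    using exists_dual_order_p[of m] D m by metis
  interpret dual_inner_p_group G p z m x e
    by unfold_locales (use xe in blast)+
  show ?thesis using not_subset_center_frattini coclass_ge unfolding m N_def by blast
qed

end
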